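(* Let $\mathcal{J}=(a,b)$ be a finite interval, $m\geq3$, $Q\in L_1(\mathcal{J};\mathbb{R})$, and let $\Gamma_1,\Gamma_2:\operatorname{Dom}(L_{\max})\to\mathbb{C}^m$ be the maps defined in the context. For a bounded operator $K$ on $\mathbb{C}^m$ let $L_K$ be the restriction of $L_{\max}$ to $\{y\in\operatorname{Dom}(L_{\max}): (K-I)\Gamma_1y+i(K+I)\Gamma_2y=0\}$. Then for every contraction $K$ on $\mathbb{C}^m$, $L_K$ is a maximal dissipative extension of $L_{\min}$. Conversely, for every maximal dissipative extension $\widetilde L$ of $L_{\min}$ there is a contraction $K$ with $\widetilde L=L_K$. The correspondence between contractions $K$ and maximal dissipative extensions $\widetilde L$ is bijective.
   Context: Quasi-derivatives: $D^{[k]}y=y^{(k)}$ for $k=0,\dots,m-2$; $D^{[m-1]}y=y^{(m-1)}+i^{-m}Qy$; $D^{[m]}y=(D^{[m-1]}y)'-i^{-m}QD^{[1]}y$. $L_{\max}$ acts by $y\mapsto i^mD^{[m]}y$ in $L_2(\mathcal{J};\mathbb{C})$ on $\{y: D^{[k]}y\in AC([a,b];\mathbb{C}),\ k=0,\dots,m-1,\ D^{[m]}y\in L_2\}$; $L_{\min}$ is its restriction to functions with $D^{[k]}y(a)=D^{[k]}y(b)=0$, $k=0,\dots,m-1$ (a closed symmetric operator). The maps: if $m=2n$, $\Gamma_1y=i^{2n}(-D^{[2n-1]}y(a),\dots,(-1)^nD^{[n]}y(a),D^{[2n-1]}y(b),\dots,(-1)^{n-1}D^{[n]}y(b))$ (entries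 $(-1)^kD^{[2n-k]}y(a)$, then $(-1)^{k-1}D^{[2n-k]}y(b)$, $k=1,\dots,n$) and $\Gamma_2y=(D^{[0]}y(a),\dots,D^{[n-1]}y(a),D^{[0]}y(b),\dots,D^{[n-1]}y(b))$; if $m=2n+1$, $\Gamma_1y=i^{2n+1}(-D^{[2n]}y(a),\dots,(-1)^nD^{[n+1]}y(a),D^{[2n]}y(b),\dots,(-1)^{n-1}D^{[n+1]}y(b),D^{[n]}y(b)+D^{[n]}y(a))$ and $\Gamma_2y=(D^{[0]}y(a),\dots,D^{[n-1]}y(a),D^{[0]}y(b),\dots,D^{[n-1]}y(b),\gamma D^{[n]}y(b)+\delta D^{[n]}y(a))$ with $\gamma=\frac{(-1)^n}{2}+i$, $\delta=\frac{(-1)^{n+1}}{2}+i$. A densely defined operator $L$ in a Hilbert space is dissipative if $\operatorname{Im}(Lf,f)\geq0$ for all $f\in\operatorname{Dom}L$, and maximal dissipative if moreover it has no nontrivial dissipative extension in that space. *)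

theory Defs
  imports "HOL-Analysis.Analysis"
begin

definition ac_on :: "real \<Rightarrow> real \<Rightarrow> (real \<Rightarrow> complex) \<Rightarrow> bool" where
  "ac_on a b f \<longleftrightarrow>
     (\<forall>\<epsilon>>0. \<exists>\<delta>>0. \<forall>S. finite S \<and> (\<forall>(u,v)\<in>S. a \<le> u \<and> u \<le> v \<and> v \<le> b)
        \<and> disjoint_family_on (\<lambda>(u,v). {u<..<v}) S \<and> (\<Sum>(u,v)\<in>S. v - u) < \<delta>
        \<longrightarrow> (\<Sum>(u,v)\<in>S. cmod (f v - f u)) < \<epsilon>)"

definition l2fun :: "real \<Rightarrow> real \<Rightarrow> (real \<Rightarrow> complex) \<Rightarrow> bool" where
  "l2fun a b f \<longleftrightarrow> f \<in> borel_measurable (lebesgue_on {a..b})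
      \<and> integrable (lebesgue_on {a..b}) (\<lambda>x. (cmod (f x))\<^sup>2)"

definition aeq :: "real \<Rightarrow> real \<Rightarrow> (real \<Rightarrow> complex) \<Rightarrow> (real \<Rightarrow> complex) \<Rightarrow> bool" where
  "aeq a b f g \<longleftrightarrow> (AE x in lebesgue_on {a..b}. f x = g x)"

definition l2inner :: "real \<Rightarrow> real \<Rightarrow> (real \<Rightarrow> complex) \<Rightarrow> (real \<Rightarrow> complex) \<Rightarrow> complex" where
  "l2inner a b f g = (LINT x|lebesgue_on {a..b}. f x * cnj (g x))"

type_synonym graph = "((real \<Rightarrow> complex) \<times> (real \<Rightarrow> complex)) set"

text \<open>The operator in L_2 whose graph consists of the (classes of the) pairs in G.\<close>
definition sat :: "real \<Rightarrow> real \<Rightarrow> graph \<Rightarrow> graph" where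
  "sat a b G = {(f,g). l2fun a b f \<and> l2fun a b g \<and>
      (\<exists>(f',g')\<in>G. aeq a b f f' \<and> aeq a b g g')}"

definition is_operator :: "real \<Rightarrow> real \<Rightarrow> graph \<Rightarrow> bool" where
  "is_operator a b G \<longleftrightarrow> sat a b G = G
     \<and> ((\<lambda>_. 0), (\<lambda>_. 0)) \<in> G
     \<and> (\<forall>(f,g)\<in>G. \<forall>(f',g')\<in>G. (\<lambda>x. f x + f' x, \<lambda>x. g x + g' x) \<in> G)
     \<and> (\<forall>(f,g)\<in>G. \<forall>c::complex. (\<lambda>x. c * f x, \<lambda>x. c * g x) \<in> G)
     \<and> (\<forall>(f,g)\<in>G. \<forall>(f',g')\<in>G. aeq a b f f' \<longrightarrow> aeq a b g g')"

definition densely_defined :: "real \<Rightarrow> real \<Rightarrow> graph \<Rightarrow> bool" where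
  "densely_defined a b G \<longleftrightarrow> (\<forall>f. l2fun a b f \<longrightarrow>
     (\<forall>\<epsilon>>0. \<exists>(g,h)\<in>G. (LINT x|lebesgue_on {a..b}. (cmod (f x - g x))\<^sup>2) < \<epsilon>))"

definition dissipative :: "real \<Rightarrow> real \<Rightarrow> graph \<Rightarrow> bool" where
  "dissipative a b G \<longleftrightarrow> is_operator a b G \<and> densely_defined a b G
     \<and> (\<forall>(f,g)\<in>G. Im (l2inner a b g f) \<ge> 0)"

definition max_dissipative :: "real \<Rightarrow> real \<Rightarrow> graph \<Rightarrow> bool" where
  "max_dissipative a b G \<longleftrightarrow> dissipative a b G
     \<and> (\<forall>G'. dissipative a b G' \<and> G \<subseteq> G' \<longrightarrow> G' = G)"

definition quasi_derivs ::
  "nat \<Rightarrow> (real \<Rightarrow> real) \<Rightarrow> real \<Rightarrow> real \<Rightarrow> (real \<Rightarrow> complex) \<Rightarrow> (nat \<Rightarrow> real \<Rightarrow> complex) \<Rightarrow> bool" where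
  "quasi_derivs m Q a b y D \<longleftrightarrow>
     (\<forall>x\<in>{a..b}. D 0 x = y x)
     \<and> (\<forall>k<m. ac_on a b (D k))
     \<and> (\<forall>k. k + 2 < m \<longrightarrow>
          (AE x in lebesgue_on {a..b}. (D k has_vector_derivative D (Suc k) x) (at x)))
     \<and> (AE x in lebesgue_on {a..b}.
          (D (m-2) has_vector_derivative (D (m-1) x - inverse (\<i> ^ m) * of_real (Q x) * D 0 x)) (at x))
     \<and> (AE x in lebesgue_on {a..b}.
          (D (m-1) has_vector_derivative (D m x + inverse (\<i> ^ m) * of_real (Q x) * D 1 x)) (at x))"

section \<open>Boundary maps (vectors in C^m are functions on {..<m})\<close>

definition Gamma1 :: "nat \<Rightarrow> real \<Rightarrow> real \<Rightarrow> (nat \<Rightarrow> real \<Rightarrow> complex) \<Rightarrow> nat \<Rightarrow> complex" where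
  "Gamma1 m a b D j = (let n = m div 2 in \<i> ^ m *
     (if even m then
        (if j < n then (-1) ^ (j+1) * D (2*n - (j+1)) a
         else (-1) ^ (j-n) * D (2*n - (j-n+1)) b)
      else
        (if j < n then (-1) ^ (j+1) * D (2*n + 1 - (j+1)) a
         else if j < 2*n then (-1) ^ (j-n) * D (2*n + 1 - (j-n+1)) b
         else D n b + D n a)))"

definition Gamma2 :: "nat \<Rightarrow> real \<Rightarrow> real \<Rightarrow> (nat \<Rightarrow> real \<Rightarrow> complex) \<Rightarrow> nat \<Rightarrow> complex" where
  "Gamma2 m a b D j = (let n = m div 2 in
     (if j < n then D j a
      else if j < 2*n then D (j-n) b
      else ((-1) ^ n / 2 + \<i>) * D n b + ((-1) ^ (n+1) / 2 + \<i>) * D n a))"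

definition mat_app :: "nat \<Rightarrow> (nat \<Rightarrow> nat \<Rightarrow> complex) \<Rightarrow> (nat \<Rightarrow> complex) \<Rightarrow> nat \<Rightarrow> complex" where
  "mat_app m K v i = (\<Sum>j<m. K i j * v j)"

definition contraction :: "nat \<Rightarrow> (nat \<Rightarrow> nat \<Rightarrow> complex) \<Rightarrow> bool" where
  "contraction m K \<longleftrightarrow>
     (\<forall>v. (\<Sum>i<m. (cmod (mat_app m K v i))\<^sup>2) \<le> (\<Sum>i<m. (cmod (v i))\<^sup>2))"

definition L_max :: "nat \<Rightarrow> (real \<Rightarrow> real) \<Rightarrow> real \<Rightarrow> real \<Rightarrow> graph" where
  "L_max m Q a b = sat a b {(y, \<lambda>x. \<i> ^ m * D m x) | y D.
       quasi_derivs m Q a b y D \<and> l2fun a b (D m)}"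

definition L_min :: "nat \<Rightarrow> (real \<Rightarrow> real) \<Rightarrow> real \<Rightarrow> real \<Rightarrow> graph" where
  "L_min m Q a b = sat a b {(y, \<lambda>x. \<i> ^ m * D m x) | y D.
       quasi_derivs m Q a b y D \<and> l2fun a b (D m)
       \<and> (\<forall>k<m. D k a = 0 \<and> D k b = 0)}"

definition L_K :: "nat \<Rightarrow> (real \<Rightarrow> real) \<Rightarrow> real \<Rightarrow> real \<Rightarrow> (nat \<Rightarrow> nat \<Rightarrow> complex) \<Rightarrow> graph" where
  "L_K m Q a b K = sat a b {(y, \<lambda>x. \<i> ^ m * D m x) | y D.
       quasi_derivs m Q a b y D \<and> l2fun a b (D m)
       \<and> (\<forall>i<m. (mat_app m K (Gamma1 m a b D) i - Gamma1 m a b D i)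
                 + \<i> * (mat_app m K (Gamma2 m a b D) i + Gamma2 m a b D i) = 0)}"

end

(* The proof turns the extension problem into one about contractions of C^m.

   Analytic part.  Gauge integration gives the fundamental theorem of calculus for absolutely
   continuous functions and the Lebesgue differentiation theorem, and Picard iteration then solves
   D^[m] y = f with arbitrary initial data at either endpoint.  The Green formula identifies
   (Ly,z) - (y,Lz) with (Gamma1 y, Gamma2 z) - (Gamma2 y, Gamma1 z), and the range of L_min is
   exactly the orthogonal complement of the m-dimensional kernel of L_max.  Hence all boundary
   data occur, L_min is densely defined, and every dissipative extension of L_min is a restriction
   of L_max (a dissipative extension of a symmetric operator lies in its adjoint).

   Algebraic part.  Put u = Gamma1 y + i Gamma2 y and v = Gamma1 y - i Gamma2 y.  The boundary
   condition of L_K reads K u = v, and 4 Im (Ly,y) = |u|^2 - |v|^2.  A dissipative extension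
   therefore corresponds to the graph of a contraction defined on a subspace of C^m, and it is
   maximal iff that subspace is all of C^m. *)
theory Submission
  imports Defs
begin

section \<open>Absolutely continuous functions\<close>

text \<open>Two obstacles shape the proof. First, \<open>Q\<close> is merely integrable, so
  integration by parts and initial value problems must be handled for absolutely continuous
  functions whose differential equations hold almost everywhere. Second, elements of L_2 are
  represented by functions and operators by graphs saturated under almost everywhere equality;
  boundary values make sense there only because the class of y fixes its quasi-derivatives below
  order m at every point and D^[m] y almost everywhere.

  Analysis and linear algebra meet through an asymmetric choice of data: elements of the kernel are
  normalised at b, while solutions of L H = r start with zero data at a. In the Green formula for
  such a pair a single boundary value of H at b survives, and up to a unimodular factor it is the
  inner product of r with the kernel element. The range of L_min and the free choice of boundary
  data thereby become questions about orthogonal residuals and the Gram matrix of m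
  functions.\<close>

lemma AE_lebesgue_on_iff_negligible:
  assumes "S \<in> sets lebesgue"
  shows "(AE x in lebesgue_on S. P x) \<longleftrightarrow> (\<exists>N. negligible N \<and> (\<forall>x\<in>S - N. P x))"
proof -
  have "(AE x in lebesgue_on S. P x) \<longleftrightarrow> (AE x in lebesgue. x \<in> S \<longrightarrow> P x)"
    using assms by (subst AE_restrict_space_iff) auto
  also have "\<dots> \<longleftrightarrow> (\<exists>N. negligible N \<and> {x. \<not> (x \<in> S \<longrightarrow> P x)} \<subseteq> N)"
    by (rule eventually_ae_filter_negligible)
  also have "\<dots> \<longleftrightarrow> (\<exists>N. negligible N \<and> (\<forall>x\<in>S - N. P x))"
    by blast
  finally show ?thesis .
qed

text \<open>A tagged division indexes its intervals by tag and cell, while \<open>ac_on\<close>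
  takes a set of pairs, in which equal intervals would be merged. Disjointness lets only degenerate
  intervals repeat, and these contribute zero to both sums, so they are dropped first.\<close>

lemma ac_on_family:
  assumes "ac_on a b f" and "0 < \<epsilon>"
  shows "\<exists>\<delta>>0. \<forall>(I :: 'i set) u v. finite I \<and> (\<forall>i\<in>I. a \<le> u i \<and> u i \<le> v i \<and> v i \<le> b)
      \<and> disjoint_family_on (\<lambda>i. {u i<..<v i}) I \<and> (\<Sum>i\<in>I. v i - u i) < \<delta>
      \<longrightarrow> (\<Sum>i\<in>I. cmod (f (v i) - f (u i))) < \<epsilon>"
proof -
  obtain \<delta> where "0 < \<delta>" and \<delta>: "\<And>S. \<lbrakk>finite S; \<forall>(u,v)\<in>S. a \<le> u \<and> u \<le> v \<and> v \<le> b;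
      disjoint_family_on (\<lambda>(u,v). {u<..<v}) S; (\<Sum>(u,v)\<in>S. v - u) < \<delta>\<rbrakk>
      \<Longrightarrow> (\<Sum>(u,v)\<in>S. cmod (f v - f u)) < \<epsilon>"
    using assms unfolding ac_on_def by meson
  show ?thesis
  proof (intro exI conjI allI impI, rule \<open>0 < \<delta>\<close>, elim conjE)
    fix I :: "'i set" and u v
    assume fin: "finite I" and I: "\<forall>i\<in>I. a \<le> u i \<and> u i \<le> v i \<and> v i \<le> b"
      and disj: "disjoint_family_on (\<lambda>i. {u i<..<v i}) I" and small: "(\<Sum>i\<in>I. v i - u i) < \<delta>"
    define J where "J = {i\<in>I. u i < v i}"
    have J: "finite J" "J \<subseteq> I" using fin by (auto simp: J_def)
    have outside: "u i = v i" if "i \<in> I - J" for i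
      using I that by (auto simp: J_def)
    have inj: "inj_on (\<lambda>i. (u i, v i)) J"
    proof (rule inj_onI, rule ccontr)
      fix i j assume ij: "i \<in> J" "j \<in> J" "(u i, v i) = (u j, v j)" "i \<noteq> j"
      then have "{u i<..<v i} \<inter> {u j<..<v j} = {}"
        using disj J unfolding disjoint_family_on_def by blast
      moreover have "(u i + v i) / 2 \<in> {u i<..<v i} \<inter> {u j<..<v j}"
        using ij by (auto simp: J_def)
      ultimately show False by blast
    qed
    let ?S = "(\<lambda>i. (u i, v i)) ` J"
    have "(\<Sum>(u,v)\<in>?S. cmod (f v - f u)) < \<epsilon>"
    proof (rule \<delta>)
      show "disjoint_family_on (\<lambda>(u,v). {u<..<v}) ?S"
      proof (clarsimp simp: disjoint_family_on_def simp del: greaterThanLessThan_iff Int_greaterThanLessThan)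
        fix i j assume "i \<in> J" "j \<in> J" and ne: "u i = u j \<longrightarrow> v i \<noteq> v j"
        then have "i \<noteq> j" "i \<in> I" "j \<in> I" using J by auto
        then show "{u i<..<v i} \<inter> {u j<..<v j} = {}"
          using disj unfolding disjoint_family_on_def by blast
      qed
      have "(\<Sum>(u,v)\<in>?S. v - u) = (\<Sum>i\<in>J. v i - u i)"
        using inj by (simp add: sum.reindex)
      also have "\<dots> = (\<Sum>i\<in>I. v i - u i)"
        using fin J outside by (intro sum.mono_neutral_left) auto
      finally show "(\<Sum>(u,v)\<in>?S. v - u) < \<delta>" using small by simp
    qed (use J I in auto)
    also have "(\<Sum>(u,v)\<in>?S. cmod (f v - f u)) = (\<Sum>i\<in>J. cmod (f (v i) - f (u i)))"
      using inj by (simp add: sum.reindex)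
    also have "\<dots> = (\<Sum>i\<in>I. cmod (f (v i) - f (u i)))"
      using fin J outside by (intro sum.mono_neutral_left) auto
    finally show "(\<Sum>i\<in>I. cmod (f (v i) - f (u i))) < \<epsilon>" .
  qed
qed

lemma sum_length_le_measure:
  fixes u v :: "'i \<Rightarrow> real"
  assumes "finite I" "\<And>i. i \<in> I \<Longrightarrow> u i \<le> v i" "disjoint_family_on (\<lambda>i. {u i<..<v i}) I"
    and "\<And>i. i \<in> I \<Longrightarrow> {u i<..<v i} \<subseteq> U" and "U \<in> lmeasurable"
  shows "(\<Sum>i\<in>I. v i - u i) \<le> measure lebesgue U"
proof -
  have "(\<Sum>i\<in>I. v i - u i) = (\<Sum>i\<in>I. measure lebesgue {u i<..<v i})"
    using assms by (intro sum.cong) auto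
  also have "\<dots> = measure lebesgue (\<Union>i\<in>I. {u i<..<v i})"
    using assms by (intro measure_finite_Union[symmetric]) (auto simp: emeasure_lborel_Ioo)
  also have "\<dots> \<le> measure lebesgue U"
    using assms by (intro measure_mono_fmeasurable) (auto intro!: sets.finite_UN)
  finally show ?thesis .
qed

text \<open>On the exceptional set a gauge inside a small open neighbourhood is used: there absolute
  continuity controls the increments, elsewhere differentiability does.\<close>
theorem ac_on_has_integral:
  assumes ab: "a \<le> b" and ac: "ac_on a b f"
    and der: "AE x in lebesgue_on {a..b}. (f has_vector_derivative g x) (at x)"
  shows "(g has_integral f b - f a) {a..b}"
proof -
  obtain N where N: "negligible N"
    and derN: "\<And>x. x \<in> {a..b} - N \<Longrightarrow> (f has_vector_derivative g x) (at x)"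
    using der by (auto simp: AE_lebesgue_on_iff_negligible)
  \<comment> \<open>Nothing is known about \<open>g\<close> on \<open>N\<close>. With
    \<open>h\<close> zero there, a cell tagged in \<open>N\<close> contributes only the increment of
    \<open>f\<close>, and the integral does not see the change.\<close>
  define h where "h x = (if x \<in> N then 0 else g x)" for x
  have "(h has_integral f b - f a) {a..b}"
    unfolding has_integral_real
  proof (intro allI impI)
    fix e :: real assume "0 < e"
    \<comment> \<open>Half of \<open>e\<close> is left for the cells tagged in \<open>N\<close>; the
      summand 1 keeps the denominator positive when \<open>a = b\<close>.\<close>
    define e' where "e' = e / (2 * (b - a + 1))"
    have e': "0 < e'" "e' * (b - a) < e / 2"
      using ab \<open>0 < e\<close> by (auto simp: e'_def field_simps)
    obtain \<delta> where "0 < \<delta>" and \<delta>: "\<And>(I :: (real \<times> real set) set) u v.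
        \<lbrakk>finite I; \<forall>i\<in>I. a \<le> u i \<and> u i \<le> v i \<and> v i \<le> b;
           disjoint_family_on (\<lambda>i. {u i<..<v i}) I; (\<Sum>i\<in>I. v i - u i) < \<delta>\<rbrakk>
         \<Longrightarrow> (\<Sum>i\<in>I. cmod (f (v i) - f (u i))) < e / 2"
      using ac_on_family[OF ac half_gt_zero[OF \<open>0 < e\<close>], where 'i = "real \<times> real set"] by (elim exE conjE) blast
    obtain U where U: "open U" "N \<subseteq> U" "U - N \<in> lmeasurable" "emeasure lebesgue (U - N) < ennreal \<delta>"
      using sets_lebesgue_outer_open[OF negligible_imp_sets[OF N] \<open>0 < \<delta>\<close>] .
    have "U = (U - N) \<union> N" using U by auto
    then have Um: "U \<in> lmeasurable" "measure lebesgue U < \<delta>"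
    proof -
      show "U \<in> lmeasurable"
        using U(3) negligible_imp_measurable[OF N] \<open>U = (U - N) \<union> N\<close>
        by (metis fmeasurable.Un)
      have "measure lebesgue U = measure lebesgue (U - N)"
        using \<open>U \<in> lmeasurable\<close> N by (simp add: measure_Diff_null_set negligible_iff_null_sets fmeasurableD)
      then show "measure lebesgue U < \<delta>"
        using U(3,4) \<open>0 < \<delta>\<close> by (simp add: emeasure_eq_measure2 ennreal_less_iff)
    qed
    have "\<exists>d>0. x \<in> {a..b} - N \<longrightarrow> (\<forall>y. norm (y - x) < d \<longrightarrow>
        norm (f y - f x - (y - x) *\<^sub>R h x) \<le> e' * norm (y - x))" for x
    proof (cases "x \<in> {a..b} - N")
      case True
      then show ?thesis
        using derN[of x] e'(1) unfolding h_def has_vector_derivative_def has_derivative_within_alt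
        by auto
    qed (auto intro: exI[of _ 1])
    then obtain d where d: "\<And>x. 0 < d x" "\<And>x y. \<lbrakk>x \<in> {a..b} - N; norm (y - x) < d x\<rbrakk> \<Longrightarrow>
        norm (f y - f x - (y - x) *\<^sub>R h x) \<le> e' * norm (y - x)"
      by metis
    define \<gamma> where "\<gamma> x = (if x \<in> N then U else ball x (d x))" for x
    have "gauge \<gamma>" using U d(1) by (auto simp: gauge_def \<gamma>_def)
    have close: "norm ((\<Sum>(x,K)\<in>p. measure lborel K *\<^sub>R h x) - (f b - f a)) < e"
      if p: "p tagged_division_of {a..b}" and fine: "\<gamma> fine p" for p
    proof -
      have fin: "finite p" using p by (rule tagged_division_of_finite)
      have K: "\<exists>u v. K = {u..v} \<and> a \<le> u \<and> u \<le> x \<and> x \<le> v \<and> v \<le> b \<and> Inf K = u \<and> Sup K = v"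
        if "(x,K) \<in> p" for x K
      proof -
        obtain u v where "K = cbox u v" using p \<open>(x,K) \<in> p\<close> by blast
        moreover have "x \<in> K" "K \<subseteq> {a..b}" using p \<open>(x,K) \<in> p\<close> by blast+
        ultimately show ?thesis by auto
      qed
      define pN where "pN = {(x,K)\<in>p. x \<in> N}"
      have pN: "pN \<subseteq> p" "finite pN" using fin by (auto simp: pN_def intro: finite_subset)
      have sub: "f b - f a = (\<Sum>(x,K)\<in>p. f (Sup K) - f (Inf K))" "b - a = (\<Sum>(x,K)\<in>p. Sup K - Inf K)"
        using additive_tagged_division_1[OF ab p, of f] additive_tagged_division_1[OF ab p, of "\<lambda>x. x"] by auto
      have disj: "disjoint_family_on (\<lambda>i. {Inf (snd i)<..<Sup (snd i)}) p"
        unfolding disjoint_family_on_def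
      proof (intro ballI impI)
        fix i j assume ij: "i \<in> p" "j \<in> p" "i \<noteq> j"
        obtain x K y L where xy: "i = (x,K)" "j = (y,L)" by (cases i, cases j)
        then have "interior K \<inter> interior L = {}"
          using ij p by (metis tagged_division_ofD(5))
        then show "{Inf (snd i)<..<Sup (snd i)} \<inter> {Inf (snd j)<..<Sup (snd j)} = {}"
          using K[of x K] K[of y L] ij(1,2) xy
          by (metis interior_atLeastAtMost_real snd_conv)
      qed
      \<comment> \<open>Fineness puts every cell tagged in \<open>N\<close> inside \<open>U\<close>,
        so the total length of these cells is below the threshold of absolute continuity.\<close>
      have "(\<Sum>i\<in>pN. Sup (snd i) - Inf (snd i)) \<le> measure lebesgue U"
      proof (rule sum_length_le_measure)
        show "disjoint_family_on (\<lambda>i. {Inf (snd i)<..<Sup (snd i)}) pN"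
          using disj pN(1) by (rule disjoint_family_on_mono[rotated])
        show "{Inf (snd i)<..<Sup (snd i)} \<subseteq> U" if "i \<in> pN" for i
        proof -
          obtain x L where i: "i = (x,L)" by force
          then have "(x,L) \<in> p" "x \<in> N" using that by (auto simp: pN_def)
          then have "L \<subseteq> U" using fineD[OF fine, of x L] by (simp add: \<gamma>_def)
          then show ?thesis using K[of x L] that i by (auto simp: pN_def)
        qed
        show "Inf (snd i) \<le> Sup (snd i)" if "i \<in> pN" for i
          using K[of "fst i" "snd i"] that pN by auto
      qed (use pN Um in auto)
      then have small: "(\<Sum>i\<in>pN. cmod (f (Sup (snd i)) - f (Inf (snd i)))) < e / 2"
      proof (intro \<delta>)
        show "\<forall>i\<in>pN. a \<le> Inf (snd i) \<and> Inf (snd i) \<le> Sup (snd i) \<and> Sup (snd i) \<le> b"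
          using K pN by fastforce
        show "disjoint_family_on (\<lambda>i. {Inf (snd i)<..<Sup (snd i)}) pN"
          using disj pN(1) by (rule disjoint_family_on_mono[rotated])
      qed (use Um pN in auto)
      have "norm (measure lborel K *\<^sub>R h x - (f (Sup K) - f (Inf K)))
          \<le> (if x \<in> N then cmod (f (Sup K) - f (Inf K)) else 0) + e' * (Sup K - Inf K)"
        if xK: "(x,K) \<in> p" for x K
      proof -
        obtain u v where uv: "K = {u..v}" "a \<le> u" "u \<le> x" "x \<le> v" "v \<le> b" "Inf K = u" "Sup K = v"
          using K[OF xK] by auto
        show ?thesis
        proof (cases "x \<in> N")
          case True
          have "0 \<le> e' * (v - u)" using uv e' by simp
          then show ?thesis using uv True by (simp add: h_def norm_minus_commute)
        next
          case False
          have "K \<subseteq> ball x (d x)" using fineD[OF fine xK] False by (simp add: \<gamma>_def)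
          moreover have "u \<in> K" "v \<in> K" using uv by auto
          ultimately have "u \<in> ball x (d x)" "v \<in> ball x (d x)" by blast+
          then have le: "norm (f u - f x - (u - x) *\<^sub>R h x) \<le> e' * norm (u - x)"
            "norm (f v - f x - (v - x) *\<^sub>R h x) \<le> e' * norm (v - x)"
            using d(2)[of x u] d(2)[of x v] uv False by (auto simp: dist_real_def)
          \<comment> \<open>The tag lies between \<open>u\<close> and \<open>v\<close>: comparing
            both endpoints with it costs \<open>e' * (x - u)\<close> and
            \<open>e' * (v - x)\<close>, which add up to \<open>e'\<close> times the length of the
            cell.\<close>
          have "norm ((v - u) *\<^sub>R h x - (f v - f u))
              = norm ((f u - f x - (u - x) *\<^sub>R h x) - (f v - f x - (v - x) *\<^sub>R h x))"
            by (simp add: algebra_simps)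
          also have "\<dots> \<le> e' * norm (u - x) + e' * norm (v - x)"
            using le by (intro norm_triangle_le_diff) linarith
          also have "\<dots> = e' * (v - u)" using uv by (simp add: algebra_simps)
          finally show ?thesis using uv False by simp
        qed
      qed
      then have "norm (\<Sum>(x,K)\<in>p. measure lborel K *\<^sub>R h x - (f (Sup K) - f (Inf K)))
          \<le> (\<Sum>(x,K)\<in>p. (if x \<in> N then cmod (f (Sup K) - f (Inf K)) else 0) + e' * (Sup K - Inf K))"
        by (intro sum_norm_le) auto
      also have "\<dots> = (\<Sum>(x,K)\<in>p. (if x \<in> N then cmod (f (Sup K) - f (Inf K)) else 0)) + e' * (b - a)"
        by (simp add: split_def sum.distrib sub(2) sum_distrib_left)
      also have "(\<Sum>(x,K)\<in>p. (if x \<in> N then cmod (f (Sup K) - f (Inf K)) else 0))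
          = (\<Sum>i\<in>pN. cmod (f (Sup (snd i)) - f (Inf (snd i))))"
        using fin by (intro sum.mono_neutral_cong_right) (auto simp: pN_def split: if_splits)
      also have "\<dots> + e' * (b - a) < e" using small e'(2) by linarith
      finally show ?thesis by (simp add: sub(1) split_def sum_subtractf)
    qed
    show "\<exists>\<gamma>. gauge \<gamma> \<and> (\<forall>p. p tagged_division_of {a..b} \<and> \<gamma> fine p \<longrightarrow>
        norm ((\<Sum>(x,K)\<in>p. measure lborel K *\<^sub>R h x) - (f b - f a)) < e)"
      by (intro exI[of _ \<gamma>] conjI allI impI, rule \<open>gauge \<gamma>\<close>, elim conjE, rule close)
  qed
  then show ?thesis
    by (rule has_integral_spike[OF N, rotated]) (simp add: h_def)
qed


text \<open>A comparison principle behind the closure properties below: each of them only has to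
  estimate one increment. Two majorants are provided because a product needs both factors.\<close>

lemma ac_on_le_sum:
  assumes g: "ac_on a b g" and h: "ac_on a b h" and "0 < M"
    and le: "\<And>u v. \<lbrakk>a \<le> u; u \<le> v; v \<le> b\<rbrakk>
      \<Longrightarrow> cmod (f v - f u) \<le> M * (cmod (g v - g u) + cmod (h v - h u))"
  shows "ac_on a b f"
  unfolding ac_on_def
proof (intro allI impI)
  fix \<epsilon> :: real assume "0 < \<epsilon>"
  then have pos: "0 < \<epsilon> / (2 * M)" using \<open>0 < M\<close> by simp
  obtain \<delta>1 where \<delta>1: "0 < \<delta>1" "\<forall>S. finite S \<and> (\<forall>(u,v)\<in>S. a \<le> u \<and> u \<le> v \<and> v \<le> b)
        \<and> disjoint_family_on (\<lambda>(u,v). {u<..<v}) S \<and> (\<Sum>(u,v)\<in>S. v - u) < \<delta>1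
        \<longrightarrow> (\<Sum>(u,v)\<in>S. cmod (g v - g u)) < \<epsilon> / (2 * M)"
    using g pos unfolding ac_on_def by blast
  obtain \<delta>2 where \<delta>2: "0 < \<delta>2" "\<forall>S. finite S \<and> (\<forall>(u,v)\<in>S. a \<le> u \<and> u \<le> v \<and> v \<le> b)
        \<and> disjoint_family_on (\<lambda>(u,v). {u<..<v}) S \<and> (\<Sum>(u,v)\<in>S. v - u) < \<delta>2
        \<longrightarrow> (\<Sum>(u,v)\<in>S. cmod (h v - h u)) < \<epsilon> / (2 * M)"
    using h pos unfolding ac_on_def by blast
  have "(\<Sum>(u,v)\<in>S. cmod (f v - f u)) < \<epsilon>"
    if S: "finite S \<and> (\<forall>(u,v)\<in>S. a \<le> u \<and> u \<le> v \<and> v \<le> b)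
        \<and> disjoint_family_on (\<lambda>(u,v). {u<..<v}) S \<and> (\<Sum>(u,v)\<in>S. v - u) < min \<delta>1 \<delta>2" for S
  proof -
    have "(\<Sum>(u,v)\<in>S. cmod (f v - f u))
        \<le> (\<Sum>(u,v)\<in>S. M * (cmod (g v - g u) + cmod (h v - h u)))"
      using S le by (intro sum_mono) fastforce
    also have "\<dots> = M * ((\<Sum>(u,v)\<in>S. cmod (g v - g u)) + (\<Sum>(u,v)\<in>S. cmod (h v - h u)))"
      by (simp add: split_def sum_distrib_left sum.distrib algebra_simps)
    also have "\<dots> < M * (\<epsilon> / (2 * M) + \<epsilon> / (2 * M))"
      using \<delta>1(2) \<delta>2(2) S \<open>0 < M\<close> by (intro mult_strict_left_mono add_strict_mono) auto
    also have "\<dots> = \<epsilon>" using \<open>0 < M\<close> by simp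
    finally show ?thesis .
  qed
  then show "\<exists>\<delta>>0. \<forall>S. finite S \<and> (\<forall>(u,v)\<in>S. a \<le> u \<and> u \<le> v \<and> v \<le> b)
        \<and> disjoint_family_on (\<lambda>(u,v). {u<..<v}) S \<and> (\<Sum>(u,v)\<in>S. v - u) < \<delta>
        \<longrightarrow> (\<Sum>(u,v)\<in>S. cmod (f v - f u)) < \<epsilon>"
    using \<delta>1(1) \<delta>2(1) by (intro exI[of _ "min \<delta>1 \<delta>2"]) auto
qed

section \<open>Closure properties of absolute continuity\<close>

lemma ac_on_const: "ac_on a b (\<lambda>_. c)"
  unfolding ac_on_def by (auto simp: split_def intro: exI[of _ 1])

lemma ac_on_add: "ac_on a b f \<Longrightarrow> ac_on a b g \<Longrightarrow> ac_on a b (\<lambda>x. f x + g x)"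
  by (rule ac_on_le_sum[where M = 1 and g = f and h = g])
    (auto intro: order.trans[OF _ norm_triangle_ineq] simp: add_diff_add)

lemma ac_on_cnj: "ac_on a b f \<Longrightarrow> ac_on a b (\<lambda>x. cnj (f x))"
  by (rule ac_on_le_sum[where M = 1 and g = f and h = f])
    (auto simp flip: complex_cnj_diff)

lemma ac_on_imp_continuous_on:
  assumes "ac_on a b f"
  shows "continuous_on {a..b} f"
  unfolding continuous_on_iff
proof (intro ballI allI impI)
  fix x e :: real assume x: "x \<in> {a..b}" and "0 < e"
  then obtain \<delta> where \<delta>: "0 < \<delta>" "\<forall>S. finite S \<and> (\<forall>(u,v)\<in>S. a \<le> u \<and> u \<le> v \<and> v \<le> b)
        \<and> disjoint_family_on (\<lambda>(u,v). {u<..<v}) S \<and> (\<Sum>(u,v)\<in>S. v - u) < \<delta>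
        \<longrightarrow> (\<Sum>(u,v)\<in>S. cmod (f v - f u)) < e"
    using assms unfolding ac_on_def by blast
  have *: "cmod (f v - f u) < e" if "a \<le> u" "u \<le> v" "v \<le> b" "v - u < \<delta>" for u v
    using \<delta>(2)[rule_format, of "{(u,v)}"] that by (auto simp: disjoint_family_on_def)
  have "dist (f y) (f x) < e" if "y \<in> {a..b}" "dist y x < \<delta>" for y
    using *[of x y] *[of y x] x that by (cases "x \<le> y") (auto simp: dist_norm norm_minus_commute)
  then show "\<exists>d>0. \<forall>y\<in>{a..b}. dist y x < d \<longrightarrow> dist (f y) (f x) < e"
    using \<delta>(1) by blast
qed

lemma ac_on_imp_bounded:
  assumes "ac_on a b f"
  obtains M where "0 < M" "\<And>x. x \<in> {a..b} \<Longrightarrow> cmod (f x) \<le> M"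
proof -
  have "bounded (f ` {a..b})"
    using assms by (intro compact_imp_bounded compact_continuous_image ac_on_imp_continuous_on) auto
  then show thesis using that by (auto simp: bounded_pos)
qed

lemma ac_on_mult:
  assumes f: "ac_on a b f" and g: "ac_on a b g"
  shows "ac_on a b (\<lambda>x. f x * g x)"
proof -
  obtain M where M: "0 < M" "\<And>x. x \<in> {a..b} \<Longrightarrow> cmod (f x) \<le> M"
    using ac_on_imp_bounded[OF f] by blast
  obtain M' where M': "0 < M'" "\<And>x. x \<in> {a..b} \<Longrightarrow> cmod (g x) \<le> M'"
    using ac_on_imp_bounded[OF g] by blast
  show ?thesis
  proof (rule ac_on_le_sum[OF f g])
    fix u v assume "a \<le> u" "u \<le> v" "v \<le> b"
    then have b: "cmod (f v) \<le> M + M'" "cmod (g u) \<le> M + M'"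
      using M(2)[of v] M'(2)[of u] M(1) M'(1) by auto
    have "cmod (f v * g v - f u * g u) = cmod (g u * (f v - f u) + f v * (g v - g u))"
      by (simp add: algebra_simps)
    also have "\<dots> \<le> cmod (g u) * cmod (f v - f u) + cmod (f v) * cmod (g v - g u)"
      by (metis norm_mult norm_triangle_ineq)
    also have "\<dots> \<le> (M + M') * cmod (f v - f u) + (M + M') * cmod (g v - g u)"
      using b by (intro add_mono mult_right_mono) auto
    finally show "cmod (f v * g v - f u * g u) \<le> (M + M') * (cmod (f v - f u) + cmod (g v - g u))"
      by (simp add: algebra_simps)
  qed (use M M' in auto)
qed

lemma ac_on_cmult: "ac_on a b f \<Longrightarrow> ac_on a b (\<lambda>x. c * f x)"
  by (intro ac_on_mult ac_on_const)

lemma ac_on_sum: "(\<And>i. i \<in> I \<Longrightarrow> ac_on a b (f i)) \<Longrightarrow> ac_on a b (\<lambda>x. \<Sum>i\<in>I. f i x)"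
  by (induction I rule: infinite_finite_induct) (auto intro: ac_on_const ac_on_add)

section \<open>Indefinite integrals: absolute continuity and almost everywhere
  differentiability\<close>

lemma sum_integral_disjoint_le:
  fixes k :: "real \<Rightarrow> real"
  assumes k: "k integrable_on {a..b}" "\<And>x. x \<in> {a..b} \<Longrightarrow> 0 \<le> k x"
    and S: "finite S" "\<forall>(u,v)\<in>S. a \<le> u \<and> u \<le> v \<and> v \<le> b"
      "disjoint_family_on (\<lambda>(u,v). {u<..<v}) S"
  shows "(\<Sum>(u,v)\<in>S. integral {u..v} k) \<le> integral {a..b} k"
proof -
  \<comment> \<open>Neighbouring intervals may share an endpoint, so the indicators of the open
    intervals are used; then at most one summand is nonzero at each point.\<close>
  have int: "((\<lambda>x. indicator {u<..<v} x * k x) has_integral integral {u..v} k) {a..b}"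
    if "a \<le> u" "v \<le> b" for u v
  proof -
    have "k integrable_on {u..v}"
      using k(1) that by (meson atLeastatMost_subset_iff integrable_on_subinterval)
    then have "(k has_integral integral {u..v} k) {u<..<v}"
      using has_integral_open_interval[of k _ u v] by (simp add: integrable_integral)
    moreover have "{u<..<v} \<subseteq> {a..b}" using that by auto
    ultimately have "((\<lambda>x. if x \<in> {u<..<v} then k x else 0) has_integral integral {u..v} k) {a..b}"
      by (subst has_integral_restrict)
    then show ?thesis by (rule has_integral_eq[rotated]) (auto simp: indicator_def)
  qed
  have "((\<lambda>x. \<Sum>(u,v)\<in>S. indicator {u<..<v} x * k x) has_integral
      (\<Sum>(u,v)\<in>S. integral {u..v} k)) {a..b}"
    using S(1) by (rule has_integral_sum) (use S(2) int in auto)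
  moreover have "(k has_integral integral {a..b} k) {a..b}"
    using k(1) by (rule integrable_integral)
  ultimately show ?thesis
  proof (rule has_integral_le)
    fix x assume x: "x \<in> {a..b}"
    show "(\<Sum>(u,v)\<in>S. indicator {u<..<v} x * k x) \<le> k x"
    proof (cases "\<exists>s\<in>S. x \<in> (case s of (u,v) \<Rightarrow> {u<..<v})")
      case True
      then obtain s where s: "s \<in> S" "x \<in> (case s of (u,v) \<Rightarrow> {u<..<v})" by blast
      have "indicator {u<..<v} x * k x = 0" if "(u,v) \<in> S - {s}" for u v
      proof -
        have "(\<lambda>(u,v). {u<..<v}) (u,v) \<inter> (\<lambda>(u,v). {u<..<v}) s = {}"
          using S(3) s(1) that unfolding disjoint_family_on_def by blast
        then show ?thesis using s(2) by (auto simp: indicator_def)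
      qed
      then have "(\<Sum>(u,v)\<in>S - {s}. indicator {u<..<v} x * k x) = 0"
        by (intro sum.neutral) (metis (no_types, lifting) case_prod_conv surj_pair)
      then have "(\<Sum>(u,v)\<in>S. indicator {u<..<v} x * k x) = (case s of (u,v) \<Rightarrow> indicator {u<..<v} x * k x)"
        using S(1) s(1) by (simp add: sum.remove)
      then show ?thesis using s(2) by (auto split: prod.splits)
    next
      case False
      then have "(\<Sum>(u,v)\<in>S. indicator {u<..<v} x * k x) = 0"
        by (intro sum.neutral) (auto simp: indicator_def)
      then show ?thesis using k(2)[OF x] by simp
    qed
  qed
qed

text \<open>The integrand is split into its truncation at height n, which is bounded, and a remainder of
  small integral.\<close>
lemma ac_on_indefinite_integral:
  assumes g: "g absolutely_integrable_on {a..b}"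
    and F: "\<And>u v. \<lbrakk>a \<le> u; u \<le> v; v \<le> b\<rbrakk> \<Longrightarrow> F v - F u = integral {u..v} g"
  shows "ac_on a b F"
  unfolding ac_on_def
proof (intro allI impI)
  fix \<epsilon> :: real assume "0 < \<epsilon>"
  define h where "h x = norm (g x)" for x
  define t where "t n x = min (h x) (real n)" for n x
  have h: "h integrable_on {a..b}"
    using g by (simp add: h_def[abs_def] absolutely_integrable_on_def)
  have ha: "h absolutely_integrable_on {a..b}"
    using h by (intro nonnegative_absolutely_integrable_1) (auto simp: h_def)
  have t_le: "t n x \<le> h x" "t n x \<le> real n" for n x
    by (simp_all add: t_def)
  have t: "t n integrable_on {a..b}" for n
  proof -
    have "(\<lambda>x. min (h x) (real n)) absolutely_integrable_on {a..b}"
      by (rule absolutely_integrable_min_1[OF ha]) auto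
    then show ?thesis by (simp add: t_def[abs_def] absolutely_integrable_on_def)
  qed
  have "(\<lambda>n. integral {a..b} (t n)) \<longlonglongrightarrow> integral {a..b} h"
  proof (rule dominated_convergence(2)[OF t h])
    show "norm (t n x) \<le> h x" for n x by (auto simp: t_def h_def)
    show "(\<lambda>n. t n x) \<longlonglongrightarrow> h x" for x
    proof (rule tendsto_eventually)
      obtain N where "h x \<le> real N" using real_arch_simple by blast
      then show "\<forall>\<^sub>F n in sequentially. t n x = h x"
        by (intro eventually_sequentiallyI[of N]) (auto simp: t_def)
    qed
  qed
  then obtain n where n: "dist (integral {a..b} (t n)) (integral {a..b} h) < \<epsilon> / 2"
    using \<open>0 < \<epsilon>\<close> by (metis (no_types, lifting) eventually_sequentially half_gt_zero le_refl tendstoD)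
  have int_diff: "integral {a..b} (\<lambda>x. h x - t n x) < \<epsilon> / 2"
    using n abs_ge_minus_self[of "integral {a..b} (t n) - integral {a..b} h"]
    unfolding dist_real_def integral_diff[OF h t] by linarith
  \<comment> \<open>The truncation contributes at most \<open>n\<close> times the total length and
    the remainder less than half of the tolerance. The factor \<open>real n + 1\<close> stands in
    for \<open>n\<close>, which may be zero.\<close>
  have "(\<Sum>(u,v)\<in>S. cmod (F v - F u)) < \<epsilon>"
    if S: "finite S" "\<forall>(u,v)\<in>S. a \<le> u \<and> u \<le> v \<and> v \<le> b"
        "disjoint_family_on (\<lambda>(u,v). {u<..<v}) S" "(\<Sum>(u,v)\<in>S. v - u) < \<epsilon> / (2 * (real n + 1))" for S
  proof -
    have "cmod (F v - F u) \<le> (real n + 1) * (v - u) + integral {u..v} (\<lambda>x. h x - t n x)"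
      if "(u,v) \<in> S" for u v
    proof -
      have uv: "a \<le> u" "u \<le> v" "v \<le> b" using S(2) that by auto
      have sub: "{u..v} \<subseteq> {a..b}" using uv by auto
      have int: "h integrable_on {u..v}" "t n integrable_on {u..v}"
        using h t sub by (meson integrable_on_subinterval)+
      have "g integrable_on {u..v}"
        using g sub by (meson absolutely_integrable_on_def integrable_on_subinterval)
      then have "cmod (F v - F u) \<le> integral {u..v} h"
        using int(1) uv by (simp add: F integral_norm_bound_integral h_def)
      also have "\<dots> \<le> integral {u..v} (\<lambda>x. (real n + 1) + (h x - t n x))"
        using int by (intro integral_le integrable_add integrable_diff)
            (use t_le(2)[of n] in \<open>auto intro: add_increasing order.trans[OF t_le(2)] simp: algebra_simps\<close>)
      also have "\<dots> = (real n + 1) * (v - u) + integral {u..v} (\<lambda>x. h x - t n x)"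
        using int uv by (subst integral_add) (auto intro!: integrable_diff)
      finally show ?thesis .
    qed
    then have "(\<Sum>(u,v)\<in>S. cmod (F v - F u))
        \<le> (\<Sum>(u,v)\<in>S. (real n + 1) * (v - u) + integral {u..v} (\<lambda>x. h x - t n x))"
      by (intro sum_mono) auto
    also have "\<dots> = (real n + 1) * (\<Sum>(u,v)\<in>S. v - u) + (\<Sum>(u,v)\<in>S. integral {u..v} (\<lambda>x. h x - t n x))"
      by (simp add: split_def sum.distrib sum_distrib_left)
    also have "\<dots> < (real n + 1) * (\<epsilon> / (2 * (real n + 1))) + \<epsilon> / 2"
    proof (rule add_less_le_mono)
      show "(real n + 1) * (\<Sum>(u,v)\<in>S. v - u) < (real n + 1) * (\<epsilon> / (2 * (real n + 1)))"
        using S(4) by (intro mult_strict_left_mono) auto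
      have "(\<Sum>(u,v)\<in>S. integral {u..v} (\<lambda>x. h x - t n x)) \<le> integral {a..b} (\<lambda>x. h x - t n x)"
        using S h t by (intro sum_integral_disjoint_le integrable_diff) (auto simp: t_le)
      then show "(\<Sum>(u,v)\<in>S. integral {u..v} (\<lambda>x. h x - t n x)) \<le> \<epsilon> / 2"
        using int_diff by simp
    qed
    also have "\<dots> = \<epsilon>" by (simp add: field_simps)
    finally show ?thesis .
  qed
  moreover have "0 < \<epsilon> / (2 * (real n + 1))" using \<open>0 < \<epsilon>\<close> by simp
  ultimately show "\<exists>\<delta>>0. \<forall>S. finite S \<and> (\<forall>(u,v)\<in>S. a \<le> u \<and> u \<le> v \<and> v \<le> b)
        \<and> disjoint_family_on (\<lambda>(u,v). {u<..<v}) S \<and> (\<Sum>(u,v)\<in>S. v - u) < \<delta>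
        \<longrightarrow> (\<Sum>(u,v)\<in>S. cmod (F v - F u)) < \<epsilon>"
    by blast
qed

text \<open>Henstock's lemma bounds the total length of any disjoint family of small intervals on which
  the difference quotient is bad; by Vitali, such families cover almost all bad points.\<close>
theorem AE_has_vector_derivative_integral:
  fixes f :: "real \<Rightarrow> 'a::euclidean_space"
  assumes f: "f integrable_on {a..b}"
    and F: "\<And>u v. \<lbrakk>a \<le> u; u \<le> v; v \<le> b\<rbrakk> \<Longrightarrow> F v - F u = integral {u..v} f"
  shows "AE x in lebesgue_on {a..b}. (F has_vector_derivative f x) (at x)"
proof -
  \<comment> \<open>\<open>bad k x y\<close> says that the difference quotient between
    \<open>x\<close> and \<open>y\<close> misses \<open>f x\<close> by more than
    \<open>1 / (k + 1)\<close>. Differentiability with derivative \<open>f x\<close> fails at an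
    interior point exactly if the point lies in some \<open>E k\<close>.\<close>
  define bad where "bad k x y \<longleftrightarrow> y \<noteq> x \<and> a \<le> y \<and> y \<le> b \<and>
      norm (y - x) < (real k + 1) * norm (F y - F x - (y - x) *\<^sub>R f x)" for k x y
  define E where "E k = {x\<in>{a<..<b}. \<forall>d>0. \<exists>y. \<bar>y - x\<bar> < d \<and> bad k x y}" for k
  have neg: "negligible (E k)" for k
    unfolding negligible_outer_le
  proof (intro allI impI)
    fix e :: real assume "0 < e"
    have fab: "f integrable_on cbox a b" using f by simp
    \<comment> \<open>Passing from badness to the Henstock error costs a factor
      \<open>k + 1\<close>, which is divided out in advance.\<close>
    obtain \<gamma> where "gauge \<gamma>" and \<gamma>: "\<And>p. \<lbrakk>p tagged_partial_division_of cbox a b; \<gamma> fine p\<rbrakk> \<Longrightarrow>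
        (\<Sum>(x,K)\<in>p. norm (measure lborel K *\<^sub>R f x - integral K f)) < e / (real k + 1)"
      using Henstock_lemma[OF fab, of "e / (real k + 1)"] \<open>0 < e\<close> by (auto simp: zero_less_divide_iff)
    define K where "K = {(x,y). x \<in> E k \<and> bad k x y \<and> closed_segment x y \<subseteq> \<gamma> x}"
    \<comment> \<open>The covering theorem wants balls, so the segment from \<open>x\<close> to
      \<open>y\<close> is written as the ball around its midpoint; the point \<open>x\<close> to be
      covered is an endpoint of it.\<close>
    define c where "c = (\<lambda>(x,y). (x + y) / 2 :: real)"
    define r where "r = (\<lambda>(x,y). \<bar>y - x\<bar> / 2 :: real)"
    have ball: "cball (c i) (r i) = closed_segment (fst i) (snd i)" for i
      by (cases i) (auto simp: c_def r_def cball_eq_atLeastAtMost closed_segment_eq_real_ivl field_simps abs_if)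
    obtain C where C: "countable C" "C \<subseteq> K"
      "pairwise (\<lambda>i j. disjnt (cball (c i) (r i)) (cball (c j) (r j))) C"
      "negligible (E k - (\<Union>i\<in>C. cball (c i) (r i)))"
    proof (rule Vitali_covering_theorem_cballs[of K r "E k" c])
      show "0 < r i" if "i \<in> K" for i using that by (auto simp: K_def r_def bad_def)
      fix x d :: real assume x: "x \<in> E k" and "0 < d"
      obtain s where s: "0 < s" "ball x s \<subseteq> \<gamma> x"
        using \<open>gauge \<gamma>\<close> by (meson gauge_def open_contains_ball)
      obtain y where y: "\<bar>y - x\<bar> < min s d" "bad k x y"
        using x s(1) \<open>0 < d\<close> unfolding E_def mem_Collect_eq by (elim conjE allE[of _ "min s d"]) auto
      have "closed_segment x y \<subseteq> ball x s"
        using y(1) by (auto simp: closed_segment_eq_real_ivl dist_real_def split: if_splits)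
      then have "(x,y) \<in> K" using x y s by (auto simp: K_def)
      moreover have "r (x,y) < d" using y(1) by (auto simp: r_def)
      moreover have "x \<in> cball (c (x,y)) (r (x,y))" by (simp add: ball)
      ultimately show "\<exists>i. i \<in> K \<and> x \<in> cball (c i) (r i) \<and> r i < d" by blast
    qed blast
    \<comment> \<open>Henstock's lemma speaks of finite partial divisions. A bound that is uniform
      over finite subfamilies carries over to the measure of the countable union.\<close>
    have bound: "measure lebesgue (\<Union>i\<in>I. cball (c i) (r i)) \<le> e" if I: "I \<subseteq> C" "finite I" for I
    proof -
      define p where "p = (\<lambda>(x,y). (x, closed_segment x y)) ` I"
      have seg: "closed_segment x y \<subseteq> {a..b}" "x \<in> {a<..<b}" "a \<le> y" "y \<le> b" if "(x,y) \<in> I" for x y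
      proof -
        show "x \<in> {a<..<b}" "a \<le> y" "y \<le> b"
          using that I C(2) by (auto simp: K_def E_def bad_def)
        then show "closed_segment x y \<subseteq> {a..b}"
          by (auto simp: closed_segment_eq_real_ivl split: if_splits)
      qed
      have dis: "closed_segment x y \<inter> closed_segment x' y' = {}"
        if "(x,y) \<in> I" "(x',y') \<in> I" "(x,y) \<noteq> (x',y')" for x y x' y'
      proof -
        have "disjnt (cball (c (x,y)) (r (x,y))) (cball (c (x',y')) (r (x',y')))"
          using C(3) that I by (meson pairwiseD subsetD)
        then show ?thesis by (simp add: ball disjnt_def)
      qed
      have inj: "inj_on (\<lambda>(x,y). (x, closed_segment x y)) I"
      proof (rule inj_onI, clarsimp)
        fix x y y' assume "(x,y) \<in> I" "(x,y') \<in> I"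
        then show "y = y'" using dis[of x y x y'] by (auto simp: disjoint_iff)
      qed
      have "p tagged_partial_division_of cbox a b"
        unfolding tagged_partial_division_of_def
      proof (intro conjI allI impI)
        show "finite p" using I by (simp add: p_def)
        fix x L assume "(x,L) \<in> p"
        then obtain y where y: "(x,y) \<in> I" "L = closed_segment x y" by (auto simp: p_def)
        show "x \<in> L" "L \<subseteq> cbox a b" using y seg by auto
        show "\<exists>a b. L = cbox a b"
          using y(2) by (auto simp: closed_segment_eq_real_ivl)
      next
        fix x L x' L' assume *: "(x,L) \<in> p \<and> (x',L') \<in> p \<and> (x,L) \<noteq> (x',L')"
        have "\<exists>y. (x,y) \<in> I \<and> L = closed_segment x y" if "(x,L) \<in> p" for x L
          using that by (auto simp: p_def)
        then obtain y y' where y: "(x,y) \<in> I" "L = closed_segment x y"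
            "(x',y') \<in> I" "L' = closed_segment x' y'"
          using * by meson
        then have "(x,y) \<noteq> (x',y')" using * by blast
        then have "L \<inter> L' = {}" using dis[OF y(1,3)] y by simp
        then show "interior L \<inter> interior L' = {}" using interior_subset by blast
      qed
      moreover have "\<gamma> fine p" using I C(2) by (auto simp: fine_def p_def K_def)
      ultimately have less: "(\<Sum>(x,L)\<in>p. norm (measure lborel L *\<^sub>R f x - integral L f)) < e / (real k + 1)"
        by (rule \<gamma>)
      have le: "\<bar>y - x\<bar> \<le> (real k + 1) *
          norm (measure lborel (closed_segment x y) *\<^sub>R f x - integral (closed_segment x y) f)"
        if "(x,y) \<in> I" for x y
      proof -
        have b: "\<bar>y - x\<bar> < (real k + 1) * norm (F y - F x - (y - x) *\<^sub>R f x)"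
          using that I C(2) by (auto simp: K_def bad_def)
        show ?thesis
        proof (cases "x \<le> y")
          case True
          then have "F y - F x = integral {x..y} f" using seg[OF that] by (intro F) auto
          then show ?thesis using b True
            by (simp add: closed_segment_eq_real_ivl norm_minus_commute)
        next
          case False
          then have "F x - F y = integral {y..x} f" using seg[OF that] by (intro F) auto
          then have "F y - F x - (y - x) *\<^sub>R f x = (x - y) *\<^sub>R f x - integral {y..x} f"
            by (simp add: algebra_simps)
          then show ?thesis using b False by (simp add: closed_segment_eq_real_ivl)
        qed
      qed
      have "measure lebesgue (\<Union>i\<in>I. cball (c i) (r i)) \<le> (\<Sum>i\<in>I. measure lebesgue (cball (c i) (r i)))"
        using I by (intro measure_UNION_le) auto
      also have "\<dots> = (\<Sum>(x,y)\<in>I. \<bar>y - x\<bar>)"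
        unfolding ball by (intro sum.cong refl) (auto simp: closed_segment_eq_real_ivl)
      also have "\<dots> \<le> (\<Sum>(x,y)\<in>I. (real k + 1) *
          norm (measure lborel (closed_segment x y) *\<^sub>R f x - integral (closed_segment x y) f))"
        using le by (intro sum_mono) auto
      also have "\<dots> = (real k + 1) * (\<Sum>(x,L)\<in>p. norm (measure lborel L *\<^sub>R f x - integral L f))"
        unfolding p_def sum.reindex[OF inj] by (simp add: split_def sum_distrib_left)
      also have "\<dots> \<le> e"
        using less by (simp add: field_simps)
      finally show ?thesis .
    qed
    let ?T = "(E k - (\<Union>i\<in>C. cball (c i) (r i))) \<union> (\<Union>i\<in>C. cball (c i) (r i))"
    have U: "(\<Union>i\<in>C. cball (c i) (r i)) \<in> lmeasurable"
      by (rule fmeasurable_UN_bound[OF C(1)]) (auto intro: bound)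
    have "measure lebesgue (\<Union>i\<in>C. cball (c i) (r i)) \<le> e"
      by (rule measure_UN_bound[OF C(1)]) (auto intro: bound)
    then have "measure lebesgue ?T \<le> e"
      using measure_Un_le[of "E k - (\<Union>i\<in>C. cball (c i) (r i))" lebesgue "\<Union>i\<in>C. cball (c i) (r i)"]
        negligible_imp_measure0[OF C(4)] negligible_imp_sets[OF C(4)] fmeasurableD[OF U] by linarith
    moreover have "?T \<in> lmeasurable"
      using negligible_imp_measurable[OF C(4)] U by blast
    ultimately show "\<exists>T. E k \<subseteq> T \<and> T \<in> lmeasurable \<and> measure lebesgue T \<le> e"
      by (intro exI[of _ ?T]) blast
  qed
  \<comment> \<open>The derivative is two-sided and \<open>F\<close> is arbitrary outside the
    interval, hence the endpoints join the exceptional set; \<open>d'\<close> keeps the comparison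
    points inside.\<close>
  have "(F has_vector_derivative f x) (at x)" if x: "x \<in> {a..b} - ({a,b} \<union> (\<Union>k. E k))" for x
    unfolding has_vector_derivative_def has_derivative_within_alt
  proof (intro conjI allI impI)
    fix e :: real assume "0 < e"
    obtain k where k: "inverse (real (Suc k)) < e" using reals_Archimedean[OF \<open>0 < e\<close>] by blast
    have "x \<notin> E k" "x \<in> {a<..<b}" using x by auto
    then obtain d where d: "0 < d" "\<And>y. \<bar>y - x\<bar> < d \<Longrightarrow> \<not> bad k x y"
      unfolding E_def by blast
    define d' where "d' = min d (min (x - a) (b - x))"
    have "norm (F y - F x - (y - x) *\<^sub>R f x) \<le> e * norm (y - x)" if "norm (y - x) < d'" for y
    proof (cases "y = x")
      case False
      have "\<not> bad k x y" using that by (intro d(2)) (auto simp: d'_def)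
      moreover have "a \<le> y" "y \<le> b" using that by (auto simp: d'_def)
      ultimately have "real (Suc k) * norm (F y - F x - (y - x) *\<^sub>R f x) \<le> norm (y - x)"
        using False by (auto simp: bad_def not_less add.commute)
      then have "norm (F y - F x - (y - x) *\<^sub>R f x) \<le> inverse (real (Suc k)) * norm (y - x)"
        by (simp add: field_simps)
      also have "\<dots> \<le> e * norm (y - x)" using k by (intro mult_right_mono) auto
      finally show ?thesis .
    qed simp
    moreover have "0 < d'" using d(1) \<open>x \<in> {a<..<b}\<close> by (simp add: d'_def)
    ultimately show "\<exists>d>0. \<forall>y\<in>UNIV. norm (y - x) < d \<longrightarrow>
        norm (F y - F x - (y - x) *\<^sub>R f x) \<le> e * norm (y - x)"
      by blast
  qed (rule bounded_linear_scaleR_left)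
  moreover have "negligible ({a,b} \<union> (\<Union>k. E k))"
    using neg by (intro negligible_Un negligible_Union_nat) auto
  ultimately show ?thesis
    unfolding AE_lebesgue_on_iff_negligible[OF lmeasurable_cbox[THEN fmeasurableD, of a b, unfolded cbox_interval]]
    by blast
qed

section \<open>Linear systems with integrable coefficients\<close>

lemma absolutely_integrable_mult_continuous:
  fixes g f :: "real \<Rightarrow> complex"
  assumes "g absolutely_integrable_on {a..b}" and f: "continuous_on {a..b} f"
  shows "(\<lambda>x. g x * f x) absolutely_integrable_on {a..b}"
proof -
  have "bilinear (\<lambda>(x::complex) y. y * x)"
    by (auto simp: bilinear_def linear_iff algebra_simps)
  moreover have "f \<in> borel_measurable (lebesgue_on {a..b})"
    using f by (rule continuous_imp_measurable_on_sets_lebesgue) auto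
  moreover have "bounded (f ` {a..b})"
    using f by (intro compact_imp_bounded compact_continuous_image) auto
  ultimately show ?thesis
    using assms(1) absolutely_integrable_bounded_measurable_product[of "\<lambda>x y. y * x" f "{a..b}" g] by auto
qed

lemma integral_diff_Icc:
  fixes g :: "real \<Rightarrow> 'a::banach"
  assumes "g integrable_on {a..b}" "a \<le> u" "u \<le> v" "v \<le> b"
  shows "integral {a..v} g - integral {a..u} g = integral {u..v} g"
proof -
  have "g integrable_on {a..v}"
    using assms by (meson atLeastatMost_subset_iff integrable_on_subinterval order_refl)
  then show ?thesis
    using Henstock_Kurzweil_Integration.integral_combine[of a u v g] assms by (simp add: algebra_simps)
qed

text \<open>This is where the factorial in the Picard estimate comes from. The integrand is the
  derivative of \<open>F ^ Suc n / (n + 1)\<close> almost everywhere, and powers of \<open>F\<close>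
  stay absolutely continuous, so the fundamental theorem applies. The detour through complex values
  in \<open>G\<close> is due to the type of \<open>ac_on\<close>.\<close>

lemma has_integral_mult_power_integral:
  fixes q :: "real \<Rightarrow> real"
  assumes ab: "a \<le> b" and q: "q absolutely_integrable_on {a..b}"
  defines "F \<equiv> \<lambda>x. integral {a..x} q"
  shows "((\<lambda>t. q t * F t ^ n) has_integral F b ^ Suc n / (real n + 1)) {a..b}"
proof -
  have qi: "q integrable_on {a..b}" using q by (simp add: absolutely_integrable_on_def)
  have diff: "F v - F u = integral {u..v} q" if "a \<le> u" "u \<le> v" "v \<le> b" for u v
    using integral_diff_Icc[OF qi that] by (simp add: F_def)
  define G where "G x = complex_of_real (F x)" for x
  have "ac_on a b G"
  proof (rule ac_on_indefinite_integral)
    show "(\<lambda>x. complex_of_real (q x)) absolutely_integrable_on {a..b}"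
      using absolutely_integrable_linear[OF q bounded_linear_of_real] by (simp add: o_def)
    fix u v assume uv: "a \<le> u" "u \<le> v" "v \<le> b"
    have "q integrable_on {u..v}"
      using qi uv by (meson atLeastatMost_subset_iff integrable_on_subinterval)
    then show "G v - G u = integral {u..v} (\<lambda>x. complex_of_real (q x))"
      using diff[OF uv] integral_linear[OF _ bounded_linear_of_real[where 'a = complex], of q "{u..v}"]
      by (simp add: G_def o_def flip: of_real_diff)
  qed
  then have ac: "ac_on a b (\<lambda>x. G x ^ Suc n)"
    by (induction n) (auto intro: ac_on_mult)
  have "AE x in lebesgue_on {a..b}. (F has_vector_derivative q x) (at x)"
    using AE_has_vector_derivative_integral[OF qi diff] .
  then have "AE x in lebesgue_on {a..b}. ((\<lambda>x. G x ^ Suc n) has_vector_derivative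
      complex_of_real ((real n + 1) * (q x * F x ^ n))) (at x)"
  proof (rule eventually_mono)
    fix x assume "(F has_vector_derivative q x) (at x)"
    then have "(F has_real_derivative q x) (at x)"
      by (simp add: has_real_derivative_iff_has_vector_derivative)
    from DERIV_power[OF this, of "Suc n"]
    have "((\<lambda>x. F x ^ Suc n) has_real_derivative (real n + 1) * (q x * F x ^ n)) (at x)"
      by (simp add: algebra_simps)
    then show "((\<lambda>x. G x ^ Suc n) has_vector_derivative
        complex_of_real ((real n + 1) * (q x * F x ^ n))) (at x)"
      using has_vector_derivative_of_real unfolding G_def of_real_power[symmetric]
      by blast
  qed
  from ac_on_has_integral[OF ab ac this]
  have "((\<lambda>x. complex_of_real ((real n + 1) * (q x * F x ^ n))) has_integral
      complex_of_real (F b ^ Suc n)) {a..b}"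
    by (simp add: G_def F_def)
  from has_integral_linear[OF this bounded_linear_Re]
  have "((\<lambda>x. (real n + 1) * (q x * F x ^ n)) has_integral F b ^ Suc n) {a..b}"
    by (simp add: o_def del: of_real_mult of_real_power)
  from has_integral_mult_right[OF this, of "1 / (real n + 1)"]
  show ?thesis by (simp del: power_Suc)
qed

text \<open>Index \<open>n\<close> counts the terms of the Neumann series of the Volterra operator;
  the successive approximations of the solution are the partial sums over \<open>n\<close>.\<close>

fun picard :: "nat \<Rightarrow> real \<Rightarrow> (nat \<Rightarrow> nat \<Rightarrow> real \<Rightarrow> complex) \<Rightarrow> (nat \<Rightarrow> real \<Rightarrow> complex)
    \<Rightarrow> nat \<Rightarrow> nat \<Rightarrow> real \<Rightarrow> complex" where
  "picard m a A h 0 j x = h j x"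
| "picard m a A h (Suc n) j x = integral {a..x} (\<lambda>t. \<Sum>k<m. A j k t * picard m a A h n k t)"

section \<open>Convergence of the Picard series\<close>

context
  fixes m :: nat and a b :: real and A :: "nat \<Rightarrow> nat \<Rightarrow> real \<Rightarrow> complex"
  assumes ab: "a \<le> b"
    and A: "\<And>j k. j < m \<Longrightarrow> k < m \<Longrightarrow> A j k absolutely_integrable_on {a..b}"
begin

lemma absolutely_integrable_system:
  assumes "j < m" "\<And>k. k < m \<Longrightarrow> continuous_on {a..b} (Y k)"
  shows "(\<lambda>t. \<Sum>k<m. A j k t * Y k t) absolutely_integrable_on {a..b}"
  using assms A by (intro absolutely_integrable_sum absolutely_integrable_mult_continuous) auto

lemma continuous_on_picard:
  assumes "\<And>j. j < m \<Longrightarrow> continuous_on {a..b} (h j)" and "j < m"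
  shows "continuous_on {a..b} (picard m a A h n j)"
  using assms(2)
proof (induction n arbitrary: j)
  case 0
  then show ?case using assms(1) by simp
next
  case (Suc n)
  have "(\<lambda>t. \<Sum>k<m. A j k t * picard m a A h n k t) integrable_on {a..b}"
    using absolutely_integrable_system[of j "picard m a A h n"] Suc
    by (simp add: absolutely_integrable_on_def)
  from indefinite_integral_continuous_1[OF this] show ?case by simp
qed

text \<open>For bounded coefficients one would get powers of \<open>x - a\<close>; here the
  primitive of \<open>q\<close> takes that role. Summing the norms of all entries into
  \<open>q\<close> lets one function control every component.\<close>

lemma picard_bound:
  assumes h: "\<And>j. j < m \<Longrightarrow> continuous_on {a..b} (h j)"
    and C: "\<And>j x. j < m \<Longrightarrow> x \<in> {a..b} \<Longrightarrow> cmod (h j x) \<le> C"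
    and "j < m" "x \<in> {a..b}"
  defines "q \<equiv> \<lambda>t. \<Sum>j<m. \<Sum>k<m. cmod (A j k t)"
  shows "cmod (picard m a A h n j x) \<le> C * integral {a..x} q ^ n / fact n"
  using assms(3,4)
proof (induction n arbitrary: j x)
  case 0
  then show ?case using C by simp
next
  case (Suc n)
  have q: "q absolutely_integrable_on {a..b}"
    unfolding q_def using A by (intro absolutely_integrable_sum absolutely_integrable_norm[unfolded o_def]) auto
  have sub: "{a..x} \<subseteq> {a..b}" using Suc.prems by auto
  have ax: "a \<le> x" using Suc.prems by auto
  define F where "F x = integral {a..x} q" for x
  have I: "((\<lambda>t. q t * F t ^ n) has_integral F x ^ Suc n / (real n + 1)) {a..x}"
    unfolding F_def
    using has_integral_mult_power_integral[OF ax] absolutely_integrable_on_subinterval[OF q sub] by blast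
  from has_integral_mult_right[OF this, of "C / fact n"]
  have I': "((\<lambda>t. q t * (C * F t ^ n / fact n)) has_integral C * F x ^ Suc n / fact (Suc n)) {a..x}"
    by (simp add: field_simps)
  have "(\<lambda>t. \<Sum>k<m. A j k t * picard m a A h n k t) absolutely_integrable_on {a..b}"
    using Suc.prems h by (intro absolutely_integrable_system continuous_on_picard) auto
  then have S: "(\<lambda>t. \<Sum>k<m. A j k t * picard m a A h n k t) integrable_on {a..x}"
    using sub absolutely_integrable_on_subinterval set_lebesgue_integral_eq_integral(1) by blast
  have "cmod (integral {a..x} (\<lambda>t. \<Sum>k<m. A j k t * picard m a A h n k t))
      \<le> integral {a..x} (\<lambda>t. q t * (C * F t ^ n / fact n))"
  proof (rule integral_norm_bound_integral[OF S])
    show "(\<lambda>t. q t * (C * F t ^ n / fact n)) integrable_on {a..x}"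
      using I' by blast
    fix t assume t: "t \<in> {a..x}"
    have bd: "cmod (picard m a A h n k t) \<le> C * F t ^ n / fact n" if "k < m" for k
      using Suc.IH[OF that, of t] t sub by (auto simp: F_def)
    \<comment> \<open>The sign is read off from the norm that this bound dominates, for the
      component \<open>j\<close>.\<close>
    have nn: "0 \<le> C * F t ^ n / fact n"
      using bd[OF \<open>j < m\<close>] norm_ge_zero order.trans by blast
    have "cmod (\<Sum>k<m. A j k t * picard m a A h n k t)
        \<le> (\<Sum>k<m. cmod (A j k t) * (C * F t ^ n / fact n))"
      using bd by (intro sum_norm_le) (auto simp: norm_mult simp del: times_divide_eq_right intro!: mult_left_mono)
    also have "\<dots> = (\<Sum>k<m. cmod (A j k t)) * (C * F t ^ n / fact n)"
      by (rule sum_distrib_right[symmetric])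
    also have "\<dots> \<le> q t * (C * F t ^ n / fact n)"
    proof (rule mult_right_mono[OF _ nn])
      show "(\<Sum>k<m. cmod (A j k t)) \<le> q t"
        unfolding q_def using \<open>j < m\<close>
        by (intro member_le_sum[of j "{..<m}" "\<lambda>j. \<Sum>k<m. cmod (A j k t)"]) (auto intro: sum_nonneg)
    qed
    finally show "cmod (\<Sum>k<m. A j k t * picard m a A h n k t) \<le> q t * (C * F t ^ n / fact n)" .
  qed
  also have "\<dots> = C * F x ^ Suc n / fact (Suc n)"
    using I' by (rule integral_unique)
  finally show ?case by (simp add: F_def)
qed

text \<open>The factorial bound gives a summable majorant, so the series converges uniformly and its
  sum is continuous. The integral operator shifts the series by one index, which is the equation for
  the partial sums; it remains to pass to the limit under the integral.\<close>

lemma integral_equation_solvable: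
  assumes h: "\<And>j. j < m \<Longrightarrow> continuous_on {a..b} (h j)"
  obtains Y where "\<And>j. j < m \<Longrightarrow> continuous_on {a..b} (Y j)"
    and "\<And>j x. j < m \<Longrightarrow> x \<in> {a..b} \<Longrightarrow>
      Y j x = h j x + integral {a..x} (\<lambda>t. \<Sum>k<m. A j k t * Y k t)"
proof -
  let ?P = "picard m a A h"
  define q where "q t = (\<Sum>j<m. \<Sum>k<m. cmod (A j k t))" for t
  have "\<exists>C. \<forall>x\<in>{a..b}. cmod (h j x) \<le> C" if "j < m" for j
    using compact_imp_bounded[OF compact_continuous_image[OF h[OF that]]] by (auto simp: bounded_iff)
  then obtain C0 where C0: "\<And>j x. j < m \<Longrightarrow> x \<in> {a..b} \<Longrightarrow> cmod (h j x) \<le> C0 j"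
    by metis
  define C where "C = (\<Sum>j<m. \<bar>C0 j\<bar>)"
  have C: "cmod (h j x) \<le> C" if "j < m" "x \<in> {a..b}" for j x
  proof -
    have "C0 j \<le> \<bar>C0 j\<bar>" by simp
    also have "\<dots> \<le> C" unfolding C_def using \<open>j < m\<close> by (intro member_le_sum) auto
    finally show ?thesis using C0[OF that] by simp
  qed
  have qa: "q absolutely_integrable_on {a..b}"
    unfolding q_def using A by (intro absolutely_integrable_sum absolutely_integrable_norm[unfolded o_def]) auto
  then have q: "q integrable_on {a..b}" by (simp add: absolutely_integrable_on_def)
  have "0 \<le> q t" for t by (auto simp: q_def intro!: sum_nonneg)
  define M where "M n = \<bar>C\<bar> * (integral {a..b} q ^ n / fact n)" for n
  have M: "summable M"
    unfolding M_def using summable_exp[of "integral {a..b} q"]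
    by (intro summable_mult) (simp add: field_simps)
  have M0: "0 \<le> M n" for n
    using integral_nonneg[OF q] \<open>\<And>t. 0 \<le> q t\<close> by (simp add: M_def)
  have PM: "cmod (?P n j x) \<le> M n" if "j < m" "x \<in> {a..b}" for n j x
  proof -
    have qx: "q integrable_on {a..x}"
      using q that by (auto intro: integrable_on_subinterval)
    have "cmod (?P n j x) \<le> C * integral {a..x} q ^ n / fact n"
      using picard_bound[OF h C that] by (simp add: q_def[abs_def])
    also have "\<dots> \<le> \<bar>C\<bar> * (integral {a..x} q ^ n / fact n)"
      using integral_nonneg[OF qx] \<open>\<And>t. 0 \<le> q t\<close>
      by (auto intro!: mult_right_mono divide_right_mono)
    also have "\<dots> \<le> M n"
      unfolding M_def using integral_nonneg[OF qx] \<open>\<And>t. 0 \<le> q t\<close> that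
      by (intro mult_left_mono divide_right_mono power_mono integral_subset_le qx q) auto
    finally show ?thesis .
  qed
  define Y where "Y j x = (\<Sum>n. ?P n j x)" for j x
  have ulim: "uniform_limit {a..b} (\<lambda>N x. \<Sum>n<N. ?P n j x) (Y j) sequentially" if "j < m" for j
    unfolding Y_def by (rule Weierstrass_m_test[OF _ M]) (use PM that in auto)
  have contP: "continuous_on {a..b} (?P n j)" if "j < m" for n j
    using continuous_on_picard[of h] h that by blast
  have contY: "continuous_on {a..b} (Y j)" if "j < m" for j
    by (rule uniform_limit_theorem[OF _ ulim[OF that]])
      (auto intro!: always_eventually continuous_on_sum contP that)
  have lim: "(\<lambda>N. \<Sum>n<N. ?P n j x) \<longlonglongrightarrow> Y j x" if "j < m" "x \<in> {a..b}" for j x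
    using tendsto_uniform_limitI[OF ulim] that by blast
  have "Y j x = h j x + integral {a..x} (\<lambda>t. \<Sum>k<m. A j k t * Y k t)" if j: "j < m" and x: "x \<in> {a..b}" for j x
  proof (rule LIMSEQ_unique)
    show "(\<lambda>N. \<Sum>n<Suc N. ?P n j x) \<longlonglongrightarrow> Y j x"
      using lim[OF j x] by (rule LIMSEQ_Suc)
    have sub: "{a..x} \<subseteq> {a..b}" using x by auto
    have intn: "(\<lambda>t. \<Sum>k<m. A j k t * Z k t) integrable_on {a..x}"
      if "\<And>k. k < m \<Longrightarrow> continuous_on {a..b} (Z k)" for Z
      using absolutely_integrable_system[of j Z, OF j] that sub
        absolutely_integrable_on_subinterval set_lebesgue_integral_eq_integral(1) by blast
    have eq: "(\<Sum>n<Suc N. ?P n j x) = h j x + integral {a..x} (\<lambda>t. \<Sum>k<m. A j k t * (\<Sum>n<N. ?P n k t))" for N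
    proof -
      have "(\<Sum>n<Suc N. ?P n j x) = h j x + (\<Sum>n<N. ?P (Suc n) j x)"
        by (subst sum.lessThan_Suc_shift) simp
      also have "(\<Sum>n<N. ?P (Suc n) j x) = integral {a..x} (\<lambda>t. \<Sum>n<N. \<Sum>k<m. A j k t * ?P n k t)"
        using contP by (subst integral_sum) (auto intro: intn)
      also have "(\<lambda>t. \<Sum>n<N. \<Sum>k<m. A j k t * ?P n k t) = (\<lambda>t. \<Sum>k<m. A j k t * (\<Sum>n<N. ?P n k t))"
        by (subst sum.swap) (simp add: sum_distrib_left)
      finally show ?thesis .
    qed
    \<comment> \<open>The coefficients may be unbounded, but all partial sums stay below
      \<open>suminf M\<close>, so \<open>q\<close> times this constant is an integrable
      majorant.\<close>
    have "(\<lambda>N. integral {a..x} (\<lambda>t. \<Sum>k<m. A j k t * (\<Sum>n<N. ?P n k t)))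
        \<longlonglongrightarrow> integral {a..x} (\<lambda>t. \<Sum>k<m. A j k t * Y k t)"
    proof (rule dominated_convergence(2))
      show "(\<lambda>t. \<Sum>k<m. A j k t * (\<Sum>n<N. ?P n k t)) integrable_on {a..x}" for N
        using contP by (intro intn continuous_on_sum) auto
      show "(\<lambda>t. q t * suminf M) integrable_on {a..x}"
        using q sub integrable_on_subinterval integrable_on_mult_left by blast
      show "(\<lambda>N. \<Sum>k<m. A j k t * (\<Sum>n<N. ?P n k t)) \<longlonglongrightarrow> (\<Sum>k<m. A j k t * Y k t)" if "t \<in> {a..x}" for t
        using lim that sub by (intro tendsto_sum tendsto_mult tendsto_const) auto
      show "cmod (\<Sum>k<m. A j k t * (\<Sum>n<N. ?P n k t)) \<le> q t * suminf M" if "t \<in> {a..x}" for N t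
      proof -
        have "cmod (\<Sum>n<N. ?P n k t) \<le> suminf M" if "k < m" for k
        proof -
          have "cmod (\<Sum>n<N. ?P n k t) \<le> (\<Sum>n<N. M n)"
            using PM[OF that] \<open>t \<in> {a..x}\<close> sub by (intro sum_norm_le) auto
          also have "\<dots> \<le> suminf M" using M M0 by (intro sum_le_suminf) auto
          finally show ?thesis .
        qed
        then have "cmod (\<Sum>k<m. A j k t * (\<Sum>n<N. ?P n k t)) \<le> (\<Sum>k<m. cmod (A j k t) * suminf M)"
          by (intro sum_norm_le) (auto simp: norm_mult intro: mult_left_mono)
        also have "\<dots> = (\<Sum>k<m. cmod (A j k t)) * suminf M"
          by (rule sum_distrib_right[symmetric])
        also have "\<dots> \<le> q t * suminf M"
        proof (rule mult_right_mono)
          show "(\<Sum>k<m. cmod (A j k t)) \<le> q t"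
            unfolding q_def using j
            by (intro member_le_sum[of j "{..<m}" "\<lambda>j. \<Sum>k<m. cmod (A j k t)"]) (auto intro: sum_nonneg)
        qed (use M M0 in \<open>auto intro: suminf_nonneg\<close>)
        finally show ?thesis .
      qed
    qed
    then show "(\<lambda>N. \<Sum>n<Suc N. ?P n j x) \<longlonglongrightarrow>
        h j x + integral {a..x} (\<lambda>t. \<Sum>k<m. A j k t * Y k t)"
      unfolding eq by (intro tendsto_add tendsto_const)
  qed
  then show thesis using that contY by blast
qed

text \<open>Initial value and inhomogeneity are absorbed into the term \<open>h\<close> that starts
  the iteration. The result is phrased with increments because this is what the two theorems on
  indefinite integrals take as input.\<close>

lemma linear_system_solvable_left:
  assumes f: "\<And>j. j < m \<Longrightarrow> f j absolutely_integrable_on {a..b}"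
  obtains Y where "\<And>j. j < m \<Longrightarrow> continuous_on {a..b} (Y j)"
    and "\<And>j. j < m \<Longrightarrow> Y j a = c j"
    and "\<And>j u v. j < m \<Longrightarrow> a \<le> u \<Longrightarrow> u \<le> v \<Longrightarrow> v \<le> b \<Longrightarrow>
      Y j v - Y j u = integral {u..v} (\<lambda>t. (\<Sum>k<m. A j k t * Y k t) + f j t)"
proof -
  have fi: "f j integrable_on {a..b}" if "j < m" for j
    using f[OF that] by (simp add: absolutely_integrable_on_def)
  have h: "continuous_on {a..b} (\<lambda>x. c j + integral {a..x} (f j))" if "j < m" for j
    using fi[OF that] by (intro continuous_intros indefinite_integral_continuous_1)
  obtain Y where Y: "\<And>j. j < m \<Longrightarrow> continuous_on {a..b} (Y j)"
    and eq: "\<And>j x. j < m \<Longrightarrow> x \<in> {a..b} \<Longrightarrow>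
      Y j x = c j + integral {a..x} (f j) + integral {a..x} (\<lambda>t. \<Sum>k<m. A j k t * Y k t)"
    using integral_equation_solvable[of "\<lambda>j x. c j + integral {a..x} (f j)", OF h] by blast
  have "Y j v - Y j u = integral {u..v} (\<lambda>t. (\<Sum>k<m. A j k t * Y k t) + f j t)"
    if "j < m" "a \<le> u" "u \<le> v" "v \<le> b" for j u v
  proof -
    have AY: "(\<lambda>t. \<Sum>k<m. A j k t * Y k t) integrable_on {a..b}"
      using absolutely_integrable_system[of j Y] Y \<open>j < m\<close> by (simp add: absolutely_integrable_on_def)
    have sub: "{u..v} \<subseteq> {a..b}" using that by auto
    have "Y j v - Y j u = integral {u..v} (f j) + integral {u..v} (\<lambda>t. \<Sum>k<m. A j k t * Y k t)"
      using eq[of j u] eq[of j v] that integral_diff_Icc[OF AY that(2-)] integral_diff_Icc[OF fi that(2-)]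
      by (simp add: algebra_simps)
    also have "\<dots> = integral {u..v} (\<lambda>t. (\<Sum>k<m. A j k t * Y k t) + f j t)"
      using integrable_on_subinterval[OF AY sub] integrable_on_subinterval[OF fi[OF \<open>j < m\<close>] sub]
      by (subst integral_add) auto
    finally show ?thesis .
  qed
  moreover have "Y j a = c j" if "j < m" for j using eq[OF that, of a] ab by simp
  ultimately show thesis using that Y by blast
qed

end

text \<open>Reflecting the interval exchanges its endpoints and reverses the sign of the right-hand
  side. Data at \<open>b\<close> are wanted for the kernel basis.\<close>

lemma linear_system_solvable_right:
  fixes a b :: real and A :: "nat \<Rightarrow> nat \<Rightarrow> real \<Rightarrow> complex"
  assumes ab: "a \<le> b"
    and A: "\<And>j k. j < m \<Longrightarrow> k < m \<Longrightarrow> A j k absolutely_integrable_on {a..b}"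
    and f: "\<And>j. j < m \<Longrightarrow> f j absolutely_integrable_on {a..b}"
  obtains Y where "\<And>j. j < m \<Longrightarrow> continuous_on {a..b} (Y j)"
    and "\<And>j. j < m \<Longrightarrow> Y j b = c j"
    and "\<And>j u v. j < m \<Longrightarrow> a \<le> u \<Longrightarrow> u \<le> v \<Longrightarrow> v \<le> b \<Longrightarrow>
      Y j v - Y j u = integral {u..v} (\<lambda>t. (\<Sum>k<m. A j k t * Y k t) + f j t)"
proof -
  have A': "(\<lambda>t. - A j k (- t)) absolutely_integrable_on {-b..-a}" if "j < m" "k < m" for j k
    using set_integrable_mult_right[of "-1" lebesgue "{a..b}" "A j k"] A[OF that]
      absolutely_integrable_reflect_real[where f = "\<lambda>t. - A j k t" and a = a and b = b] by simp
  have f': "(\<lambda>t. - f j (- t)) absolutely_integrable_on {-b..-a}" if "j < m" for j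
    using set_integrable_mult_right[of "-1" lebesgue "{a..b}" "f j"] f[OF that]
      absolutely_integrable_reflect_real[where f = "\<lambda>t. - f j t" and a = a and b = b] by simp
  obtain Y where Y: "\<And>j. j < m \<Longrightarrow> continuous_on {-b..-a} (Y j)" "\<And>j. j < m \<Longrightarrow> Y j (-b) = c j"
    and eq: "\<And>j u v. j < m \<Longrightarrow> -b \<le> u \<Longrightarrow> u \<le> v \<Longrightarrow> v \<le> -a \<Longrightarrow>
      Y j v - Y j u = integral {u..v} (\<lambda>t. (\<Sum>k<m. - A j k (- t) * Y k t) + - f j (- t))"
    using linear_system_solvable_left[of "-b" "-a" m "\<lambda>j k t. - A j k (- t)" "\<lambda>j t. - f j (- t)" c,
        OF _ A' f'] ab by auto
  define Z where "Z j x = Y j (- x)" for j x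
  show thesis
  proof
    fix j assume j: "j < m"
    show "continuous_on {a..b} (Z j)"
      unfolding Z_def using continuous_on_compose[of "{a..b}" uminus "Y j"] Y(1)[OF j]
      by (simp add: continuous_on_minus o_def)
    show "Z j b = c j" using Y(2)[OF j] by (simp add: Z_def)
    fix u v assume uv: "a \<le> u" "u \<le> v" "v \<le> b"
    have "Z j v - Z j u = - (Y j (-u) - Y j (-v))" by (simp add: Z_def)
    also have "\<dots> = - integral {-v..-u} (\<lambda>t. (\<Sum>k<m. - A j k (- t) * Y k t) + - f j (- t))"
      using j uv by (subst eq) auto
    also have "\<dots> = integral {-v..-u} (\<lambda>t. (\<Sum>k<m. A j k (- t) * Z k (- t)) + f j (- t))"
      by (simp add: Z_def sum_negf add.commute flip: integral_neg)
    also have "\<dots> = integral {u..v} (\<lambda>t. (\<Sum>k<m. A j k t * Z k t) + f j t)"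
      using Henstock_Kurzweil_Integration.integral_reflect_real[where f = "\<lambda>t. (\<Sum>k<m. A j k t * Z k t) + f j t" and a = u and b = v] by simp
    finally show "Z j v - Z j u = integral {u..v} (\<lambda>t. (\<Sum>k<m. A j k t * Z k t) + f j t)" .
  qed
qed

section \<open>Semi-inner product spaces and square integrable functions\<close>

text \<open>The form may be degenerate: square integrable functions are not identified almost
  everywhere, and vectors of C^m are functions on \<open>nat\<close> whose values from index
  \<open>m\<close> on do not count. The locale serves both cases.\<close>

locale semi_inner_space =
  fixes V :: "('x \<Rightarrow> complex) set" and ip :: "('x \<Rightarrow> complex) \<Rightarrow> ('x \<Rightarrow> complex) \<Rightarrow> complex"
  assumes zero_mem: "(\<lambda>_. 0) \<in> V"
    and add_mem: "f \<in> V \<Longrightarrow> g \<in> V \<Longrightarrow> (\<lambda>x. f x + g x) \<in> V"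
    and scale_mem: "f \<in> V \<Longrightarrow> (\<lambda>x. c * f x) \<in> V"
    and ip_add: "f \<in> V \<Longrightarrow> g \<in> V \<Longrightarrow> h \<in> V \<Longrightarrow> ip (\<lambda>x. f x + g x) h = ip f h + ip g h"
    and ip_scale: "f \<in> V \<Longrightarrow> g \<in> V \<Longrightarrow> ip (\<lambda>x. c * f x) g = c * ip f g"
    and ip_cnj: "f \<in> V \<Longrightarrow> g \<in> V \<Longrightarrow> ip g f = cnj (ip f g)"
    and ip_nonneg: "f \<in> V \<Longrightarrow> 0 \<le> Re (ip f f)"
begin

lemma diff_mem:
  assumes "f \<in> V" "g \<in> V" shows "(\<lambda>x. f x - g x) \<in> V"
  using add_mem[OF assms(1) scale_mem[OF assms(2), of "-1"]] by simp

lemma ip_diff: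
  assumes "f \<in> V" "g \<in> V" "h \<in> V"
  shows "ip (\<lambda>x. f x - g x) h = ip f h - ip g h"
  using ip_add[OF assms(1) scale_mem[OF assms(2), of "-1"] assms(3)] ip_scale[OF assms(2,3), of "-1"]
  by simp

lemma ip_add_right:
  assumes "f \<in> V" "g \<in> V" "h \<in> V"
  shows "ip h (\<lambda>x. f x + g x) = ip h f + ip h g"
  using ip_cnj[OF add_mem[OF assms(1,2)] assms(3)] ip_cnj[OF assms(1,3)] ip_cnj[OF assms(2,3)] assms
  by (simp add: ip_add)

lemma ip_diff_right:
  assumes "f \<in> V" "g \<in> V" "h \<in> V"
  shows "ip h (\<lambda>x. f x - g x) = ip h f - ip h g"
  using ip_cnj[OF diff_mem[OF assms(1,2)] assms(3)] ip_cnj[OF assms(1,3)] ip_cnj[OF assms(2,3)] assms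
  by (simp add: ip_diff)

lemma ip_scale_right:
  assumes "f \<in> V" "g \<in> V"
  shows "ip f (\<lambda>x. c * g x) = cnj c * ip f g"
  using ip_cnj[OF scale_mem[OF assms(2)] assms(1), of c] ip_cnj[OF assms(2,1)] assms
  by (simp add: ip_scale)

lemma sum_mem: "(\<And>i. i \<in> I \<Longrightarrow> z i \<in> V) \<Longrightarrow> (\<lambda>x. \<Sum>i\<in>I. c i * z i x) \<in> V"
  by (induction I rule: infinite_finite_induct) (auto intro!: zero_mem add_mem scale_mem)

lemma ip_zero: "g \<in> V \<Longrightarrow> ip (\<lambda>_. 0) g = 0"
  using ip_scale[OF zero_mem, of g 0] by simp

lemma ip_sum:
  assumes "\<And>i. i \<in> I \<Longrightarrow> z i \<in> V" "g \<in> V"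
  shows "ip (\<lambda>x. \<Sum>i\<in>I. c i * z i x) g = (\<Sum>i\<in>I. c i * ip (z i) g)"
  using assms(1)
proof (induction I rule: infinite_finite_induct)
  case (insert k I)
  then show ?case
    using assms(2) by (simp add: ip_add scale_mem sum_mem ip_scale)
qed (use assms in \<open>auto simp: ip_zero\<close>)

lemma ip_sum_right:
  assumes "\<And>i. i \<in> I \<Longrightarrow> z i \<in> V" "g \<in> V"
  shows "ip g (\<lambda>x. \<Sum>i\<in>I. c i * z i x) = (\<Sum>i\<in>I. cnj (c i) * ip g (z i))"
proof -
  have "ip g (\<lambda>x. \<Sum>i\<in>I. c i * z i x) = cnj (\<Sum>i\<in>I. c i * ip (z i) g)"
    using ip_cnj[OF sum_mem[of I z c, OF assms(1)] assms(2)] ip_sum[of I z g c, OF assms] by simp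
  also have "\<dots> = (\<Sum>i\<in>I. cnj (c i) * ip g (z i))"
    using assms ip_cnj[of _ g] by (simp add: cnj_sum cong: sum.cong)
  finally show ?thesis .
qed

lemma ip_diff_scale_self:
  assumes "f \<in> V" "g \<in> V"
  shows "Re (ip (\<lambda>x. f x - c * g x) (\<lambda>x. f x - c * g x))
    = Re (ip f f) - 2 * Re (cnj c * ip f g) + (cmod c)\<^sup>2 * Re (ip g g)"
proof -
  have "ip (\<lambda>x. f x - c * g x) (\<lambda>x. f x - c * g x)
      = ip f f - cnj c * ip f g - c * cnj (ip f g) + c * cnj c * ip g g"
    using assms ip_cnj[OF assms]
    by (simp add: ip_diff ip_diff_right ip_scale ip_scale_right scale_mem diff_mem algebra_simps)
  also have "Re \<dots> = Re (ip f f) - 2 * Re (cnj c * ip f g) + (cmod c)\<^sup>2 * Re (ip g g)"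
    by (simp add: cmod_power2) (simp add: power2_eq_square algebra_simps)
  finally show ?thesis .
qed

text \<open>The variational argument for a minimal distance, with a tolerance: compare with
  \<open>c = t * ip f g\<close> and choose \<open>t = 1 / Re (ip g g)\<close>. A small tolerance
  shows that a nearly minimal vector is nearly orthogonal to \<open>g\<close>; with the tolerance
  \<open>Re (ip f f)\<close> the hypothesis is plain nonnegativity and the conclusion is the
  Cauchy-Schwarz inequality.\<close>

lemma almost_orthogonal:
  assumes f: "f \<in> V" and g: "g \<in> V"
    and min: "\<And>c. Re (ip f f) - \<eta> \<le> Re (ip (\<lambda>x. f x - c * g x) (\<lambda>x. f x - c * g x))"
  shows "(cmod (ip f g))\<^sup>2 \<le> \<eta> * Re (ip g g)"
proof -
  have ineq: "2 * t * (cmod (ip f g))\<^sup>2 \<le> \<eta> + t\<^sup>2 * (cmod (ip f g))\<^sup>2 * Re (ip g g)" for t :: real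
  proof -
    have "Re (cnj (of_real t * ip f g) * ip f g) = t * (cmod (ip f g))\<^sup>2"
      by (simp add: cmod_power2) (simp add: power2_eq_square algebra_simps)
    moreover have "(cmod (of_real t * ip f g))\<^sup>2 = t\<^sup>2 * (cmod (ip f g))\<^sup>2"
      by (simp add: norm_mult power_mult_distrib)
    ultimately show ?thesis
      using min[of "of_real t * ip f g"] ip_diff_scale_self[OF f g, of "of_real t * ip f g"] by simp
  qed
  show ?thesis
  proof (cases "Re (ip g g) = 0")
    case True
    then have *: "2 * t * (cmod (ip f g))\<^sup>2 \<le> \<eta>" for t :: real using ineq[of t] by simp
    have "(cmod (ip f g))\<^sup>2 = 0"
    proof (rule ccontr)
      assume "(cmod (ip f g))\<^sup>2 \<noteq> 0"
      \<comment> \<open>A degenerate \<open>g\<close> leaves an inequality linear in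
        \<open>t\<close>, refuted by a large \<open>t\<close>; the instance \<open>t = 0\<close>
        gives the sign of the tolerance.\<close>
      then have "2 * (\<eta> + 1) \<le> \<eta>" using *[of "(\<eta> + 1) / (cmod (ip f g))\<^sup>2"] by simp
      then show False using *[of 0] by simp
    qed
    then show ?thesis using True by simp
  next
    case False
    then have pos: "0 < Re (ip g g)" using ip_nonneg[OF g] by simp
    show ?thesis using ineq[of "1 / Re (ip g g)"] pos by (simp add: field_simps power2_eq_square)
  qed
qed

lemma Cauchy_Schwarz:
  assumes "f \<in> V" "g \<in> V"
  shows "(cmod (ip f g))\<^sup>2 \<le> Re (ip f f) * Re (ip g g)"
  using assms by (intro almost_orthogonal) (auto intro!: ip_nonneg diff_mem scale_mem)

text \<open>Gram-Schmidt; vectors of zero length cause no trouble, since they are orthogonal to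
  everything (and division by zero gives the coefficient 0).\<close>
lemma ex_orthogonal_residual:
  assumes "finite I" "\<And>i. i \<in> I \<Longrightarrow> z i \<in> V" "w \<in> V"
  shows "\<exists>c. \<forall>i\<in>I. ip (\<lambda>x. w x - (\<Sum>j\<in>I. c j * z j x)) (z i) = 0"
  using assms
proof (induction I arbitrary: w rule: finite_induct)
  case empty
  then show ?case by simp
next
  case (insert k I)
  obtain d where d: "\<And>i. i \<in> I \<Longrightarrow> ip (\<lambda>x. z k x - (\<Sum>j\<in>I. d j * z j x)) (z i) = 0"
    using insert.IH[of "z k"] insert.prems by blast
  obtain e where e: "\<And>i. i \<in> I \<Longrightarrow> ip (\<lambda>x. w x - (\<Sum>j\<in>I. e j * z j x)) (z i) = 0"
    using insert.IH[of w] insert.prems by blast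
  define r where "r x = z k x - (\<Sum>j\<in>I. d j * z j x)" for x
  define s where "s x = w x - (\<Sum>j\<in>I. e j * z j x)" for x
  have zV: "z k \<in> V" "\<And>i. i \<in> I \<Longrightarrow> z i \<in> V" using insert.prems by auto
  have V: "r \<in> V" "s \<in> V"
    unfolding r_def[abs_def] s_def[abs_def] using zV insert.prems by (intro diff_mem sum_mem; simp)+
  have r: "ip r (z i) = 0" and s: "ip s (z i) = 0" if "i \<in> I" for i
    using d[OF that] e[OF that] by (simp_all add: r_def[abs_def] s_def[abs_def])
  define t where "t = ip s r / ip r r"
  have "ip (\<lambda>x. s x - t * r x) r = ip s r - t * ip r r"
    using V by (simp add: ip_diff ip_scale scale_mem)
  also have "\<dots> = 0"
    using Cauchy_Schwarz[OF V(2,1)] by (cases "ip r r = 0") (simp_all add: t_def)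
  finally have st: "ip (\<lambda>x. s x - t * r x) r = 0" .
  have sI: "ip (\<lambda>x. s x - t * r x) (z i) = 0" if "i \<in> I" for i
    using V r[OF that] s[OF that] zV that by (simp add: ip_diff ip_scale scale_mem)
  have stV: "(\<lambda>x. s x - t * r x) \<in> V" using V by (intro diff_mem scale_mem)
  have "ip (\<lambda>x. s x - t * r x) (z k) = ip (\<lambda>x. s x - t * r x) (\<lambda>x. r x + (\<Sum>j\<in>I. d j * z j x))"
    by (simp add: r_def)
  also have "\<dots> = 0"
    using stV V zV st sI by (simp add: ip_add_right sum_mem ip_sum_right)
  finally have sk: "ip (\<lambda>x. s x - t * r x) (z k) = 0" .
  define c where "c j = (if j = k then t else e j - t * d j)" for j
  have "w x - (\<Sum>j\<in>insert k I. c j * z j x) = s x - t * r x" for x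
  proof -
    have "(\<Sum>j\<in>I. c j * z j x) = (\<Sum>j\<in>I. (e j - t * d j) * z j x)"
      using insert.hyps by (intro sum.cong) (auto simp: c_def)
    also have "\<dots> = (\<Sum>j\<in>I. e j * z j x) - t * (\<Sum>j\<in>I. d j * z j x)"
      by (simp add: left_diff_distrib sum_subtractf sum_distrib_left mult.assoc)
    finally have "(\<Sum>j\<in>insert k I. c j * z j x) = t * z k x + ((\<Sum>j\<in>I. e j * z j x) - t * (\<Sum>j\<in>I. d j * z j x))"
      using insert.hyps by (simp add: c_def)
    then show ?thesis by (simp add: r_def s_def algebra_simps)
  qed
  then show ?case using sI sk by (intro exI[of _ c]) auto
qed

text \<open>Invertibility of the Gram matrix, obtained through a dual family instead of a
  determinant. The part of \<open>z i\<close> orthogonal to the other vectors has coefficient 1 at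
  \<open>z i\<close>, so by independence its length is nonzero; hence its product with
  \<open>z i\<close> is nonzero while those with the others vanish.\<close>

lemma ex_prescribed_products:
  assumes fin: "finite I" and z: "\<And>i. i \<in> I \<Longrightarrow> z i \<in> V"
    and indep: "\<And>c i. ip (\<lambda>x. \<Sum>j\<in>I. c j * z j x) (\<lambda>x. \<Sum>j\<in>I. c j * z j x) = 0 \<Longrightarrow> i \<in> I \<Longrightarrow> c i = 0"
  shows "\<exists>c. \<forall>i\<in>I. ip (\<lambda>x. \<Sum>j\<in>I. c j * z j x) (z i) = \<tau> i"
proof -
  define P where "P i c \<longleftrightarrow> (\<forall>j\<in>I - {i}. ip (\<lambda>x. \<Sum>j\<in>I. c j * z j x) (z j) = 0)
      \<and> ip (\<lambda>x. \<Sum>j\<in>I. c j * z j x) (z i) \<noteq> 0" for i c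
  have "\<exists>c. P i c" if i: "i \<in> I" for i
  proof -
    obtain d where d: "\<And>j. j \<in> I - {i} \<Longrightarrow> ip (\<lambda>x. z i x - (\<Sum>l\<in>I - {i}. d l * z l x)) (z j) = 0"
      using ex_orthogonal_residual[of "I - {i}" z "z i"] fin z i by auto
    define c where "c j = (if j = i then 1 else - d j)" for j
    let ?r = "\<lambda>x. \<Sum>j\<in>I. c j * z j x"
    have r: "?r x = z i x - (\<Sum>l\<in>I - {i}. d l * z l x)" for x
      using fin i by (simp add: sum.remove c_def sum_negf)
    have rV: "?r \<in> V" using z by (rule sum_mem)
    have orth: "ip ?r (z j) = 0" if "j \<in> I - {i}" for j
      using d[OF that] by (simp add: r)
    have "ip ?r ?r \<noteq> 0" using indep[of c i] i by (auto simp: c_def)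
    moreover have "ip ?r ?r = ip ?r (z i)"
    proof -
      have "ip ?r ?r = (\<Sum>j\<in>I. cnj (c j) * ip ?r (z j))"
        using rV z by (intro ip_sum_right)
      also have "\<dots> = cnj (c i) * ip ?r (z i)"
        using fin i orth by (subst sum.remove[of _ i]) auto
      finally show ?thesis by (simp add: c_def)
    qed
    ultimately show ?thesis using orth by (auto simp: P_def)
  qed
  then obtain C where "\<forall>i\<in>I. P i (C i)" using bchoice[of I P] by blast
  then have C: "\<And>i j. i \<in> I \<Longrightarrow> j \<in> I - {i} \<Longrightarrow> ip (\<lambda>x. \<Sum>l\<in>I. C i l * z l x) (z j) = 0"
    and C': "\<And>i. i \<in> I \<Longrightarrow> ip (\<lambda>x. \<Sum>l\<in>I. C i l * z l x) (z i) \<noteq> 0"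
    unfolding P_def by blast+
  define e where "e i = \<tau> i / ip (\<lambda>x. \<Sum>l\<in>I. C i l * z l x) (z i)" for i
  define c where "c l = (\<Sum>i\<in>I. e i * C i l)" for l
  have "(\<Sum>l\<in>I. c l * z l x) = (\<Sum>i\<in>I. e i * (\<Sum>l\<in>I. C i l * z l x))" for x
  proof -
    have "(\<Sum>l\<in>I. c l * z l x) = (\<Sum>l\<in>I. \<Sum>i\<in>I. e i * (C i l * z l x))"
      by (simp add: c_def sum_distrib_right mult.assoc)
    also have "\<dots> = (\<Sum>i\<in>I. \<Sum>l\<in>I. e i * (C i l * z l x))" by (rule sum.swap)
    finally show ?thesis by (simp add: sum_distrib_left)
  qed
  moreover have "ip (\<lambda>x. \<Sum>i\<in>I. e i * (\<Sum>l\<in>I. C i l * z l x)) (z k) = \<tau> k" if "k \<in> I" for k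
  proof -
    have "ip (\<lambda>x. \<Sum>i\<in>I. e i * (\<Sum>l\<in>I. C i l * z l x)) (z k)
        = (\<Sum>i\<in>I. e i * ip (\<lambda>x. \<Sum>l\<in>I. C i l * z l x) (z k))"
      using z that by (intro ip_sum sum_mem) auto
    also have "\<dots> = (\<Sum>i\<in>I. if i = k then e k * ip (\<lambda>x. \<Sum>l\<in>I. C k l * z l x) (z k) else 0)"
      using that C by (intro sum.cong) auto
    also have "\<dots> = e k * ip (\<lambda>x. \<Sum>l\<in>I. C k l * z l x) (z k)"
      using fin that by simp
    finally show ?thesis using C'[OF that] by (simp add: e_def)
  qed
  ultimately show ?thesis by (intro exI[of _ c]) auto
qed

end

section \<open>The instances C^m and L_2, and completeness of L_2\<close>

definition vip :: "nat \<Rightarrow> (nat \<Rightarrow> complex) \<Rightarrow> (nat \<Rightarrow> complex) \<Rightarrow> complex" where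
  "vip m v w = (\<Sum>i<m. v i * cnj (w i))"

lemma vip_self: "vip m v v = of_real (\<Sum>i<m. (cmod (v i))\<^sup>2)"
  by (simp only: vip_def of_real_sum complex_norm_square)

interpretation vec: semi_inner_space UNIV "vip m" for m
proof
  fix f g h :: "nat \<Rightarrow> complex" and c
  show "vip m (\<lambda>x. f x + g x) h = vip m f h + vip m g h"
    by (simp add: vip_def sum.distrib algebra_simps)
  show "vip m (\<lambda>x. c * f x) g = c * vip m f g"
    by (simp add: vip_def sum_distrib_left mult.assoc)
  show "vip m g f = cnj (vip m f g)"
    by (simp add: vip_def mult.commute)
  show "0 \<le> Re (vip m f f)"
    unfolding vip_self by (simp add: sum_nonneg)
qed auto

lemma l2fun_scale: "l2fun a b f \<Longrightarrow> l2fun a b (\<lambda>x. c * f x)"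
  by (auto simp: l2fun_def norm_mult power_mult_distrib)

lemma l2fun_add:
  assumes "l2fun a b f" "l2fun a b g"
  shows "l2fun a b (\<lambda>x. f x + g x)"
proof -
  have [measurable]: "f \<in> borel_measurable (lebesgue_on {a..b})" "g \<in> borel_measurable (lebesgue_on {a..b})"
    using assms by (auto simp: l2fun_def)
  have "integrable (lebesgue_on {a..b}) (\<lambda>x. (cmod (f x + g x))\<^sup>2)"
  proof (rule Bochner_Integration.integrable_bound)
    show "integrable (lebesgue_on {a..b}) (\<lambda>x. 2 * (cmod (f x))\<^sup>2 + 2 * (cmod (g x))\<^sup>2)"
      using assms by (auto simp: l2fun_def)
    have "(cmod (f x + g x))\<^sup>2 \<le> 2 * (cmod (f x))\<^sup>2 + 2 * (cmod (g x))\<^sup>2" for x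
    proof -
      have "(cmod (f x + g x))\<^sup>2 \<le> (cmod (f x) + cmod (g x))\<^sup>2"
        by (intro power_mono norm_triangle_ineq) auto
      also have "\<dots> \<le> 2 * (cmod (f x))\<^sup>2 + 2 * (cmod (g x))\<^sup>2"
        using zero_le_power2[of "cmod (f x) - cmod (g x)"] by (simp add: power2_eq_square algebra_simps)
      finally show ?thesis .
    qed
    then show "AE x in lebesgue_on {a..b}. norm ((cmod (f x + g x))\<^sup>2)
        \<le> norm (2 * (cmod (f x))\<^sup>2 + 2 * (cmod (g x))\<^sup>2)"
      by (simp add: abs_of_nonneg)
  qed measurable
  then show ?thesis by (simp add: l2fun_def)
qed

lemma l2fun_integrable_mult_cnj:
  assumes "l2fun a b f" "l2fun a b g"
  shows "integrable (lebesgue_on {a..b}) (\<lambda>x. f x * cnj (g x))"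
proof -
  have [measurable]: "f \<in> borel_measurable (lebesgue_on {a..b})" "g \<in> borel_measurable (lebesgue_on {a..b})"
    using assms by (auto simp: l2fun_def)
  have [measurable]: "cnj \<in> borel_measurable borel"
    by (intro borel_measurable_continuous_onI continuous_on_cnj continuous_on_id)
  show ?thesis
  proof (rule Bochner_Integration.integrable_bound)
    show "integrable (lebesgue_on {a..b}) (\<lambda>x. (cmod (f x))\<^sup>2 + (cmod (g x))\<^sup>2)"
      using assms by (auto simp: l2fun_def)
    have "cmod (f x) * cmod (g x) \<le> (cmod (f x))\<^sup>2 + (cmod (g x))\<^sup>2" for x
      using sum_squares_bound[of "cmod (f x)" "cmod (g x)"]
        mult_nonneg_nonneg[OF norm_ge_zero norm_ge_zero, of "f x" "g x"] by linarith
    then show "AE x in lebesgue_on {a..b}. norm (f x * cnj (g x)) \<le> norm ((cmod (f x))\<^sup>2 + (cmod (g x))\<^sup>2)"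
      by (simp add: norm_mult abs_of_nonneg)
  qed measurable
qed

lemma l2inner_self: "l2inner a b f f = of_real (LINT x|lebesgue_on {a..b}. (cmod (f x))\<^sup>2)"
proof -
  have "(\<lambda>x. f x * cnj (f x)) = (\<lambda>x. of_real ((cmod (f x))\<^sup>2))"
    by (simp only: complex_norm_square)
  then show ?thesis unfolding l2inner_def by (simp only: integral_complex_of_real)
qed

interpretation l2: semi_inner_space "Collect (l2fun a b)" "l2inner a b" for a b
proof (unfold_locales, unfold mem_Collect_eq)
  fix f g h :: "real \<Rightarrow> complex" and c
  show "l2fun a b (\<lambda>_. 0)" by (simp add: l2fun_def)
  show "l2fun a b f \<Longrightarrow> l2fun a b g \<Longrightarrow> l2fun a b (\<lambda>x. f x + g x)" by (rule l2fun_add)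
  show "l2fun a b f \<Longrightarrow> l2fun a b (\<lambda>x. c * f x)" by (rule l2fun_scale)
  show "l2inner a b (\<lambda>x. f x + g x) h = l2inner a b f h + l2inner a b g h"
    if "l2fun a b f" "l2fun a b g" "l2fun a b h"
    using that by (simp add: l2inner_def distrib_right l2fun_integrable_mult_cnj)
  show "l2inner a b (\<lambda>x. c * f x) g = c * l2inner a b f g"
    by (simp add: l2inner_def mult.assoc)
  show "l2inner a b g f = cnj (l2inner a b f g)"
    by (simp add: l2inner_def mult.commute flip: Bochner_Integration.integral_cnj)
  show "0 \<le> Re (l2inner a b f f)"
    by (simp add: l2inner_self)
qed

lemmas l2fun_diff = l2.diff_mem[unfolded mem_Collect_eq]

lemma l2inner_cong_AE:
  assumes "l2fun a b f" "l2fun a b f'" "l2fun a b g" "l2fun a b g'" "aeq a b f f'" "aeq a b g g'"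
  shows "l2inner a b f g = l2inner a b f' g'"
  unfolding l2inner_def
proof (rule integral_cong_AE)
  show "(\<lambda>x. f x * cnj (g x)) \<in> borel_measurable (lebesgue_on {a..b})"
    "(\<lambda>x. f' x * cnj (g' x)) \<in> borel_measurable (lebesgue_on {a..b})"
    using assms(1-4) by (auto intro!: borel_measurable_integrable l2fun_integrable_mult_cnj)
  show "AE x in lebesgue_on {a..b}. f x * cnj (g x) = f' x * cnj (g' x)"
    using assms(5,6) unfolding aeq_def by eventually_elim simp
qed

lemma l2inner_self_eq_0_iff:
  assumes "l2fun a b f"
  shows "l2inner a b f f = 0 \<longleftrightarrow> aeq a b f (\<lambda>_. 0)"
proof -
  have "l2inner a b f f = 0 \<longleftrightarrow> (LINT x|lebesgue_on {a..b}. (cmod (f x))\<^sup>2) = 0"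
    by (simp add: l2inner_self)
  also have "\<dots> \<longleftrightarrow> (AE x in lebesgue_on {a..b}. (cmod (f x))\<^sup>2 = 0)"
    using assms by (intro integral_nonneg_eq_0_iff_AE) (auto simp: l2fun_def)
  finally show ?thesis by (simp add: aeq_def)
qed

lemma l2fun_integrable:
  assumes "l2fun a b f"
  shows "integrable (lebesgue_on {a..b}) f"
proof -
  have "l2fun a b (\<lambda>_. 1)"
    by (simp add: l2fun_def)
  from l2fun_integrable_mult_cnj[OF assms this] show ?thesis by simp
qed

text \<open>A weighted arithmetic-geometric mean inequality with a free parameter. It serves to turn
  an L_2 Cauchy sequence into an L_1 Cauchy sequence on the bounded interval.\<close>

lemma l2_L1_bound:
  assumes f: "l2fun a b f" and "a \<le> b" "0 < \<eta>"
  shows "(LINT x|lebesgue_on {a..b}. cmod (f x)) \<le> \<eta> * (b - a) + Re (l2inner a b f f) / \<eta>"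
proof -
  have "(LINT x|lebesgue_on {a..b}. cmod (f x)) \<le> (LINT x|lebesgue_on {a..b}. \<eta> + (cmod (f x))\<^sup>2 / \<eta>)"
  proof (rule integral_mono)
    show "integrable (lebesgue_on {a..b}) (\<lambda>x. cmod (f x))"
      using l2fun_integrable[OF f] by (rule integrable_norm)
    show "integrable (lebesgue_on {a..b}) (\<lambda>x. \<eta> + (cmod (f x))\<^sup>2 / \<eta>)"
      using f by (auto simp: l2fun_def)
    show "cmod (f x) \<le> \<eta> + (cmod (f x))\<^sup>2 / \<eta>" for x
    proof -
      have "\<eta> * cmod (f x) \<le> \<eta>\<^sup>2 + (cmod (f x))\<^sup>2"
        using sum_squares_bound[of \<eta> "cmod (f x)"] mult_nonneg_nonneg[of \<eta> "cmod (f x)"] \<open>0 < \<eta>\<close>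
          norm_ge_zero[of "f x"] by linarith
      then show ?thesis using \<open>0 < \<eta>\<close> by (simp add: field_simps power2_eq_square)
    qed
  qed
  also have "\<dots> = \<eta> * (b - a) + Re (l2inner a b f f) / \<eta>"
    using f \<open>a \<le> b\<close> by (subst Bochner_Integration.integral_add)
      (auto simp: l2fun_def l2inner_self measure_restrict_space)
  finally show ?thesis .
qed

text \<open>The Riesz-Fischer argument: the sequence is Cauchy in L_1, so a subsequence converges
  almost everywhere, and Fatou's lemma carries the L_2 bounds over to the limit. That
  \<open>p\<close> itself is square integrable follows by adding some \<open>s N\<close> to the
  difference \<open>p - s N\<close>.\<close>

lemma l2_complete:
  fixes s :: "nat \<Rightarrow> real \<Rightarrow> complex"
  assumes ab: "a \<le> b" and s: "\<And>n. l2fun a b (s n)"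
    and Cauchy: "\<And>e. 0 < e \<Longrightarrow> \<exists>N. \<forall>i\<ge>N. \<forall>j\<ge>N.
      Re (l2inner a b (\<lambda>x. s i x - s j x) (\<lambda>x. s i x - s j x)) < e"
  obtains p where "l2fun a b p"
    and "\<And>e. 0 < e \<Longrightarrow> \<exists>N. \<forall>i\<ge>N. Re (l2inner a b (\<lambda>x. p x - s i x) (\<lambda>x. p x - s i x)) \<le> e"
proof -
  have sm[measurable]: "s n \<in> borel_measurable (lebesgue_on {a..b})" for n
    using s by (simp add: l2fun_def)
  have L1: "\<exists>N. \<forall>i\<ge>N. \<forall>j\<ge>N. (LINT x|lebesgue_on {a..b}. cmod (s i x - s j x)) < e" if "0 < e" for e
  proof -
    \<comment> \<open>The parameter makes the length term less than \<open>e / 2\<close>; the L_2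
      tolerance \<open>\<eta> * (e / 2)\<close> then does the same for the other term.\<close>
    define \<eta> where "\<eta> = e / (2 * (b - a + 1))"
    have \<eta>: "0 < \<eta>" "\<eta> * (b - a) < e / 2" using ab that by (auto simp: \<eta>_def field_simps)
    obtain N where N: "\<And>i j. i \<ge> N \<Longrightarrow> j \<ge> N \<Longrightarrow>
        Re (l2inner a b (\<lambda>x. s i x - s j x) (\<lambda>x. s i x - s j x)) < \<eta> * (e / 2)"
      using Cauchy[OF mult_pos_pos[OF \<eta>(1) half_gt_zero[OF \<open>0 < e\<close>]]] by blast
    have "(LINT x|lebesgue_on {a..b}. cmod (s i x - s j x)) < e" if "i \<ge> N" "j \<ge> N" for i j
    proof -
      have "(LINT x|lebesgue_on {a..b}. cmod (s i x - s j x)) \<le> \<eta> * (b - a)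
          + Re (l2inner a b (\<lambda>x. s i x - s j x) (\<lambda>x. s i x - s j x)) / \<eta>"
        using ab \<eta> s by (intro l2_L1_bound l2fun_diff)
      also have "\<dots> < e / 2 + e / 2"
        using \<eta> N[OF that] by (intro add_strict_mono) (auto simp: field_simps)
      finally show ?thesis by simp
    qed
    then show ?thesis by blast
  qed
  obtain r where r: "strict_mono r" "AE x in lebesgue_on {a..b}. Cauchy (\<lambda>i. s (r i) x)"
    using cauchy_L1_AE_cauchy_subseq[of "lebesgue_on {a..b}" s, OF l2fun_integrable[OF s] L1] by blast
  define p where "p x = lim (\<lambda>i. s (r i) x)" for x
  have p[measurable]: "p \<in> borel_measurable (lebesgue_on {a..b})"
    unfolding p_def[abs_def] by measurable
  have lim: "AE x in lebesgue_on {a..b}. (\<lambda>i. s (r i) x) \<longlonglongrightarrow> p x"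
    using r(2) by eventually_elim (simp add: p_def Cauchy_convergent_iff convergent_LIMSEQ_iff)
  have bound: "l2fun a b (\<lambda>x. p x - s k x)
      \<and> Re (l2inner a b (\<lambda>x. p x - s k x) (\<lambda>x. p x - s k x)) \<le> e"
    if "0 < e" and N: "\<And>i j. i \<ge> N \<Longrightarrow> j \<ge> N \<Longrightarrow>
        Re (l2inner a b (\<lambda>x. s i x - s j x) (\<lambda>x. s i x - s j x)) < e" and "k \<ge> N" for e N k
  proof -
    let ?u = "\<lambda>i x. ennreal ((cmod (s (r i) x - s k x))\<^sup>2)"
    have le: "(\<integral>\<^sup>+x. ?u i x \<partial>lebesgue_on {a..b}) \<le> ennreal e" if "i \<ge> N" for i
    proof -
      have "r i \<ge> N" using that r(1) by (meson le_trans seq_suble)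
      have "(\<integral>\<^sup>+x. ?u i x \<partial>lebesgue_on {a..b})
          = ennreal (LINT x|lebesgue_on {a..b}. (cmod (s (r i) x - s k x))\<^sup>2)"
        using l2fun_diff[OF s s, of "r i" k] by (intro nn_integral_eq_integral) (auto simp: l2fun_def)
      also have "\<dots> \<le> ennreal e"
        using N[OF \<open>r i \<ge> N\<close> \<open>k \<ge> N\<close>] by (intro ennreal_leI) (simp add: l2inner_self)
      finally show ?thesis .
    qed
    have "(\<integral>\<^sup>+x. ennreal ((cmod (p x - s k x))\<^sup>2) \<partial>lebesgue_on {a..b})
        = (\<integral>\<^sup>+x. liminf (\<lambda>i. ?u i x) \<partial>lebesgue_on {a..b})"
    proof (rule nn_integral_cong_AE)
      show "AE x in lebesgue_on {a..b}. ennreal ((cmod (p x - s k x))\<^sup>2) = liminf (\<lambda>i. ?u i x)"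
        using lim
      proof eventually_elim
        case (elim x)
        then have "(\<lambda>i. ?u i x) \<longlonglongrightarrow> ennreal ((cmod (p x - s k x))\<^sup>2)"
          by (intro tendsto_ennrealI tendsto_intros)
        then show ?case by (intro lim_imp_Liminf[symmetric]) auto
      qed
    qed
    also have "\<dots> \<le> liminf (\<lambda>i. \<integral>\<^sup>+x. ?u i x \<partial>lebesgue_on {a..b})"
      by (rule nn_integral_liminf) measurable
    also have "\<dots> \<le> ennreal e"
      using le by (intro Liminf_le) (auto simp: eventually_sequentially)
    finally have nn: "(\<integral>\<^sup>+x. ennreal ((cmod (p x - s k x))\<^sup>2) \<partial>lebesgue_on {a..b}) \<le> ennreal e" .
    then have "integrable (lebesgue_on {a..b}) (\<lambda>x. (cmod (p x - s k x))\<^sup>2)"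
      by (intro integrableI_nonneg) (auto intro: order.strict_trans1)
    then have "l2fun a b (\<lambda>x. p x - s k x)" by (simp add: l2fun_def)
    moreover have "(LINT x|lebesgue_on {a..b}. (cmod (p x - s k x))\<^sup>2) \<le> e"
      using nn \<open>0 < e\<close> by (subst integral_eq_nn_integral) (auto intro: enn2real_leI)
    ultimately show ?thesis by (simp add: l2inner_self)
  qed
  show thesis
  proof
    obtain N where "\<And>i j. i \<ge> N \<Longrightarrow> j \<ge> N \<Longrightarrow>
        Re (l2inner a b (\<lambda>x. s i x - s j x) (\<lambda>x. s i x - s j x)) < 1"
      using Cauchy[of 1] by auto
    then have "l2fun a b (\<lambda>x. p x - s N x)" using bound[of 1 N N] by simp
    from l2fun_add[OF this s[of N]] show "l2fun a b p" by simp
    show "\<exists>N. \<forall>i\<ge>N. Re (l2inner a b (\<lambda>x. p x - s i x) (\<lambda>x. p x - s i x)) \<le> e" if "0 < e" for e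
      using Cauchy[OF that] bound[OF that] by meson
  qed
qed

text \<open>A minimizing sequence for the distance to S is Cauchy by the parallelogram law, and the
  difference between f and its limit is orthogonal to S.\<close>
lemma l2_dense_criterion:
  assumes ab: "a \<le> b" and S: "\<And>s. s \<in> S \<Longrightarrow> l2fun a b s" "S \<noteq> {}"
    and add: "\<And>s t. s \<in> S \<Longrightarrow> t \<in> S \<Longrightarrow> (\<lambda>x. s x + t x) \<in> S"
    and scale: "\<And>s c. s \<in> S \<Longrightarrow> (\<lambda>x. c * s x) \<in> S"
    and orth: "\<And>f. l2fun a b f \<Longrightarrow> (\<And>s. s \<in> S \<Longrightarrow> l2inner a b f s = 0) \<Longrightarrow> aeq a b f (\<lambda>_. 0)"
    and f: "l2fun a b f" and "0 < \<epsilon>"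
  shows "\<exists>s\<in>S. (LINT x|lebesgue_on {a..b}. (cmod (f x - s x))\<^sup>2) < \<epsilon>"
proof (rule ccontr)
  assume far: "\<not> ?thesis"
  define N where "N g = Re (l2inner a b g g)" for g
  have N_far: "\<epsilon> \<le> N (\<lambda>x. f x - s x)" if "s \<in> S" for s
    using far that by (auto simp: N_def l2inner_self not_less)
  have N_nonneg: "0 \<le> N g" for g by (simp add: N_def l2inner_self)
  define d where "d = (INF s\<in>S. N (\<lambda>x. f x - s x))"
  have bdd: "bdd_below ((\<lambda>s. N (\<lambda>x. f x - s x)) ` S)"
    using N_nonneg by (intro bdd_belowI[of _ 0]) auto
  have d_le: "d \<le> N (\<lambda>x. f x - s x)" if "s \<in> S" for s
    unfolding d_def using bdd that by (rule cINF_lower)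
  have "\<exists>s\<in>S. N (\<lambda>x. f x - s x) < d + inverse (real (Suc n))" for n
  proof -
    have "d < d + inverse (real (Suc n))" by simp
    then show ?thesis unfolding d_def using cINF_less_iff[OF S(2) bdd] by blast
  qed
  then obtain s where sS: "\<And>n. s n \<in> S" and s: "\<And>n. N (\<lambda>x. f x - s n x) < d + inverse (real (Suc n))"
    by metis
  have sl: "l2fun a b (s n)" for n using S(1) sS by blast
  have parallelogram: "N (\<lambda>x. u x - v x) + 4 * N (\<lambda>x. (1/2) * (u x + v x)) = 2 * N u + 2 * N v"
    if "l2fun a b u" "l2fun a b v" for u v
    using that l2.ip_cnj[of u a b v]
    by (simp add: N_def l2.ip_diff l2.ip_diff_right l2.ip_add l2.ip_add_right l2.ip_scale
        l2.ip_scale_right l2fun_add l2fun_diff l2fun_scale del: times_divide_eq_left)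
      (simp add: field_simps)
  have diff: "N (\<lambda>x. s i x - s j x) \<le> 2 * inverse (real (Suc i)) + 2 * inverse (real (Suc j))" for i j
  proof -
    have eq: "(\<lambda>x. (1/2) * ((f x - s i x) + (f x - s j x))) = (\<lambda>x. f x - (1/2) * (s i x + s j x))"
      by (auto simp: algebra_simps)
    \<comment> \<open>The mean of two members lies in \<open>S\<close>, so its squared distance from
      \<open>f\<close> is at least \<open>d\<close>; in the parallelogram law only the excesses over
      \<open>d\<close> remain.\<close>
    have "d \<le> N (\<lambda>x. f x - (1/2) * (s i x + s j x))"
      by (intro d_le scale add sS)
    then have "N (\<lambda>x. (f x - s i x) - (f x - s j x)) \<le> 2 * inverse (real (Suc i)) + 2 * inverse (real (Suc j))"
      using parallelogram[OF l2fun_diff[OF f sl] l2fun_diff[OF f sl], of i j] s[of i] s[of j]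
      unfolding eq by linarith
    moreover have "N (\<lambda>x. (f x - s i x) - (f x - s j x)) = N (\<lambda>x. s i x - s j x)"
      by (simp add: N_def l2inner_self norm_minus_commute)
    ultimately show ?thesis by simp
  qed
  have small: "\<exists>n. inverse (real (Suc n)) < e" if "0 < e" for e
    using reals_Archimedean[OF that] by blast
  have inv_mono: "inverse (real (Suc i)) \<le> inverse (real (Suc n))" if "i \<ge> n" for i n
    using that by (auto intro!: le_imp_inverse_le)
  obtain p where p: "l2fun a b p"
    and p_lim: "\<And>e. 0 < e \<Longrightarrow> \<exists>n. \<forall>i\<ge>n. N (\<lambda>x. p x - s i x) \<le> e"
  proof (rule l2_complete[OF ab sl])
    fix e :: real assume "0 < e"
    then obtain n where n: "inverse (real (Suc n)) < e / 4" using small[of "e / 4"] by auto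
    have "N (\<lambda>x. s i x - s j x) < e" if "i \<ge> n" "j \<ge> n" for i j
      using diff[of i j] inv_mono[OF that(1)] inv_mono[OF that(2)] n by linarith
    then show "\<exists>n. \<forall>i\<ge>n. \<forall>j\<ge>n. Re (l2inner a b (\<lambda>x. s i x - s j x) (\<lambda>x. s i x - s j x)) < e"
      unfolding N_def by blast
  qed (auto simp: N_def)
  have "l2inner a b (\<lambda>x. f x - p x) t = 0" if t: "t \<in> S" for t
  proof (rule ccontr)
    assume ne: "l2inner a b (\<lambda>x. f x - p x) t \<noteq> 0"
    have tl: "l2fun a b t" using S(1) t .
    \<comment> \<open>Chosen such that \<open>4 * (\<delta> * (N t + 1))\<close> equals the squared
      product assumed to be nonzero. The summand 1 allows \<open>N t = 0\<close> and makes the final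
      inequality strict.\<close>
    define \<delta> where "\<delta> = (cmod (l2inner a b (\<lambda>x. f x - p x) t))\<^sup>2 / (4 * (N t + 1))"
    have "0 < \<delta>" using ne N_nonneg[of t] by (auto simp: \<delta>_def intro!: divide_pos_pos)
    then obtain n0 where n0: "inverse (real (Suc n0)) < \<delta>" using small by blast
    obtain n1 where n1: "\<And>i. i \<ge> n1 \<Longrightarrow> N (\<lambda>x. p x - s i x) \<le> \<delta>" using p_lim[OF \<open>0 < \<delta>\<close>] by blast
    define i where "i = max n0 n1"
    have i: "inverse (real (Suc i)) \<le> \<delta>" "N (\<lambda>x. p x - s i x) \<le> \<delta>"
      using inv_mono[of n0 i] n0 n1[of i] unfolding i_def by linarith+
    \<comment> \<open>The vector \<open>s i\<close> is within the tolerance of a minimizer, and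
      adding multiples of \<open>t\<close> does not leave \<open>S\<close>.\<close>
    have A: "(cmod (l2inner a b (\<lambda>x. f x - s i x) t))\<^sup>2 \<le> \<delta> * N t"
      unfolding N_def
    proof (rule l2.almost_orthogonal)
      fix c
      have "d \<le> N (\<lambda>x. f x - (s i x + c * t x))"
        by (intro d_le add scale sS t)
      then show "Re (l2inner a b (\<lambda>x. f x - s i x) (\<lambda>x. f x - s i x)) - \<delta>
          \<le> Re (l2inner a b (\<lambda>x. f x - s i x - c * t x) (\<lambda>x. f x - s i x - c * t x))"
        using s[of i] i(1) by (simp add: N_def diff_diff_eq)
    qed (use f sl tl l2fun_diff in auto)
    have B: "(cmod (l2inner a b (\<lambda>x. p x - s i x) t))\<^sup>2 \<le> \<delta> * N t"
    proof -
      have "(cmod (l2inner a b (\<lambda>x. p x - s i x) t))\<^sup>2 \<le> N (\<lambda>x. p x - s i x) * N t"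
        unfolding N_def using p sl tl by (intro l2.Cauchy_Schwarz) (auto intro: l2fun_diff)
      also have "\<dots> \<le> \<delta> * N t" using i(2) N_nonneg by (intro mult_right_mono)
      finally show ?thesis .
    qed
    have "l2inner a b (\<lambda>x. f x - p x) t = l2inner a b (\<lambda>x. f x - s i x) t - l2inner a b (\<lambda>x. p x - s i x) t"
      using f p sl[of i] tl by (simp add: l2.ip_diff)
    then have "(cmod (l2inner a b (\<lambda>x. f x - p x) t))\<^sup>2
        \<le> (cmod (l2inner a b (\<lambda>x. f x - s i x) t) + cmod (l2inner a b (\<lambda>x. p x - s i x) t))\<^sup>2"
      by (metis norm_ge_zero norm_triangle_ineq4 power_mono)
    also have "\<dots> \<le> 2 * (cmod (l2inner a b (\<lambda>x. f x - s i x) t))\<^sup>2 + 2 * (cmod (l2inner a b (\<lambda>x. p x - s i x) t))\<^sup>2"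
      using zero_le_power2[of "cmod (l2inner a b (\<lambda>x. f x - s i x) t) - cmod (l2inner a b (\<lambda>x. p x - s i x) t)"]
      by (simp add: power2_eq_square algebra_simps)
    also have "\<dots> \<le> 4 * (\<delta> * N t)" using A B by simp
    also have "\<dots> < 4 * (\<delta> * (N t + 1))" using \<open>0 < \<delta>\<close> by simp
    also have "\<dots> = (cmod (l2inner a b (\<lambda>x. f x - p x) t))\<^sup>2"
      using N_nonneg[of t] by (simp add: \<delta>_def field_simps)
    finally show False by simp
  qed
  then have "aeq a b (\<lambda>x. f x - p x) (\<lambda>_. 0)" using f p by (intro orth l2fun_diff)
  then have fp: "aeq a b (\<lambda>x. f x - s n x) (\<lambda>x. p x - s n x)" for n
    unfolding aeq_def by eventually_elim simp
  obtain n where n: "N (\<lambda>x. p x - s n x) \<le> \<epsilon> / 2" using p_lim[of "\<epsilon> / 2"] \<open>0 < \<epsilon>\<close> by auto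
  have "N (\<lambda>x. f x - s n x) = N (\<lambda>x. p x - s n x)"
    unfolding N_def using f p sl fp by (subst l2inner_cong_AE) (auto intro: l2fun_diff)
  then show False using n N_far[OF sS[of n]] \<open>0 < \<epsilon>\<close> by simp
qed

section \<open>Quasi-derivatives and the Green formula\<close>

lemma integrable_lebesgue_on_Icc_iff:
  fixes f :: "real \<Rightarrow> 'a::euclidean_space"
  shows "integrable (lebesgue_on {a..b}) f \<longleftrightarrow> f absolutely_integrable_on {a..b}"
  by (simp add: integrable_restrict_space set_integrable_def)

lemma absolutely_integrable_if:
  fixes f :: "real \<Rightarrow> 'a::euclidean_space"
  shows "f absolutely_integrable_on S \<Longrightarrow> (\<lambda>x. if P then f x else 0) absolutely_integrable_on S"
  by (cases P) simp_all

lemma l2fun_continuous: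
  assumes "continuous_on {a..b} f"
  shows "l2fun a b f"
proof -
  have "(\<lambda>x. (cmod (f x))\<^sup>2) absolutely_integrable_on {a..b}"
    using assms by (intro absolutely_integrable_continuous_real continuous_intros)
  then have "integrable (lebesgue_on {a..b}) (\<lambda>x. (cmod (f x))\<^sup>2)"
    by (simp only: integrable_lebesgue_on_Icc_iff)
  moreover have "f \<in> borel_measurable (lebesgue_on {a..b})"
    using assms by (rule continuous_imp_measurable_on_sets_lebesgue) auto
  ultimately show ?thesis by (simp add: l2fun_def)
qed

text \<open>A nonempty open set is not negligible, which settles the interior; the endpoints follow
  because the zero set is closed.\<close>

lemma continuous_AE_eq_0:
  fixes f :: "real \<Rightarrow> complex"
  assumes "a < b" and f: "continuous_on {a..b} f" and ae: "AE x in lebesgue_on {a..b}. f x = 0"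
    and x: "x \<in> {a..b}"
  shows "f x = 0"
proof -
  obtain N where N: "negligible N" "\<And>x. x \<in> {a..b} - N \<Longrightarrow> f x = 0"
    using ae by (auto simp: AE_lebesgue_on_iff_negligible)
  define U where "U = {a<..<b} \<inter> f -` (- {0})"
  have "continuous_on {a<..<b} f" using f by (rule continuous_on_subset) auto
  then have "open U" unfolding U_def by (intro continuous_open_preimage) auto
  moreover have "negligible U"
    using N(1)
  proof (rule negligible_subset)
    show "U \<subseteq> N"
    proof
      fix x assume "x \<in> U"
      then have "x \<in> {a..b}" "f x \<noteq> 0" by (auto simp: U_def)
      then show "x \<in> N" using N(2)[of x] by blast
    qed
  qed
  ultimately have "U = {}" using open_not_negligible by blast
  then have zero: "f x = 0" if "x \<in> {a<..<b}" for x using that by (auto simp: U_def)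
  have "closed ({a..b} \<inter> f -` {0})"
    using f by (intro continuous_closed_preimage) auto
  then have "closure {a<..<b} \<subseteq> {a..b} \<inter> f -` {0}"
    using zero by (intro closure_minimal) auto
  then show ?thesis using x \<open>a < b\<close> by auto
qed

lemma AE_derivative_eq_0:
  fixes f g :: "real \<Rightarrow> complex"
  assumes f: "\<And>x. x \<in> {a..b} \<Longrightarrow> f x = 0"
    and der: "AE x in lebesgue_on {a..b}. (f has_vector_derivative g x) (at x)"
  shows "AE x in lebesgue_on {a..b}. g x = 0"
proof -
  obtain N where N: "negligible N" "\<And>x. x \<in> {a..b} - N \<Longrightarrow> (f has_vector_derivative g x) (at x)"
    using der by (auto simp: AE_lebesgue_on_iff_negligible)
  have "g x = 0" if x: "x \<in> {a..b} - (N \<union> {a,b})" for x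
  proof -
    have "(f has_vector_derivative 0) (at x)"
      using x f by (intro has_vector_derivative_transform_within_open[of "\<lambda>_. 0" 0 x "{a<..<b}" f]) auto
    then show ?thesis using N(2)[of x] x vector_derivative_unique_at by blast
  qed
  moreover have "negligible (N \<union> {a,b})" using N(1) by (intro negligible_Un) auto
  ultimately show ?thesis
    unfolding AE_lebesgue_on_iff_negligible[OF lmeasurable_cbox[THEN fmeasurableD, of a b, unfolded cbox_interval]]
    by blast
qed

lemma cnj_i_power: "cnj (\<i> ^ m) = (-1) ^ m * \<i> ^ m"
  by (induction m) auto

lemma cnj_inverse_i_power: "cnj (inverse (\<i> ^ m)) = (-1) ^ m * inverse (\<i> ^ m)"
  by (simp only: complex_cnj_inverse cnj_i_power inverse_mult_distrib) (simp add: power_inverse[symmetric])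

section \<open>Towers of quasi-derivatives as solutions of a first-order system\<close>

locale quasi_differential =
  fixes m :: nat and Q :: "real \<Rightarrow> real" and a b :: real
  assumes ab: "a < b" and m: "3 \<le> m" and Q: "integrable (lebesgue_on {a..b}) Q"
begin

definition \<kappa> :: complex where "\<kappa> = inverse (\<i> ^ m)"

lemma cnj_\<kappa>: "cnj \<kappa> = (-1) ^ m * \<kappa>"
  unfolding \<kappa>_def by (rule cnj_inverse_i_power)

text \<open>Collects the terms with \<open>Q\<close> so that the equations of all orders, including
  the two exceptional ones, read \<open>D k' = D (Suc k) + qpart D k\<close>.\<close>

definition qpart :: "(nat \<Rightarrow> real \<Rightarrow> complex) \<Rightarrow> nat \<Rightarrow> real \<Rightarrow> complex" where
  "qpart D k x = (if k = m - 2 then - \<kappa> * of_real (Q x) * D 0 x else 0)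
     + (if k = m - 1 then \<kappa> * of_real (Q x) * D 1 x else 0)"

definition qdom :: "(nat \<Rightarrow> real \<Rightarrow> complex) \<Rightarrow> bool" where
  "qdom D \<longleftrightarrow> l2fun a b (D m) \<and> (\<forall>k<m. ac_on a b (D k) \<and>
     (AE x in lebesgue_on {a..b}. (D k has_vector_derivative D (Suc k) x + qpart D k x) (at x)))"

text \<open>Splits off the function \<open>y\<close>, which only has to agree with
  \<open>D 0\<close> on the interval. From here on the tower \<open>D\<close> carries all the
  information.\<close>

lemma quasi_derivs_iff:
  "quasi_derivs m Q a b y D \<and> l2fun a b (D m) \<longleftrightarrow> (\<forall>x\<in>{a..b}. D 0 x = y x) \<and> qdom D"
proof -
  let ?der = "\<lambda>k. AE x in lebesgue_on {a..b}. (D k has_vector_derivative D (Suc k) x + qpart D k x) (at x)"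
  have split: "(\<forall>k<m. P k) \<longleftrightarrow> (\<forall>k. k + 2 < m \<longrightarrow> P k) \<and> P (m - 2) \<and> P (m - 1)" for P
  proof safe
    fix k assume *: "\<forall>k. k + 2 < m \<longrightarrow> P k" "P (m - 2)" "P (m - 1)" "k < m"
    then have "k + 2 < m \<or> k = m - 2 \<or> k = m - 1" by linarith
    then show "P k" using * by auto
  qed (use m in auto)
  have 1: "?der k \<longleftrightarrow> (AE x in lebesgue_on {a..b}. (D k has_vector_derivative D (Suc k) x) (at x))"
    if "k + 2 < m" for k
  proof -
    have "k \<noteq> m - 2" "k \<noteq> m - 1" using that by linarith+
    then show ?thesis by (simp add: qpart_def)
  qed
  have "Suc (m - 2) = m - 1" "Suc (m - 1) = m" "m - 2 \<noteq> m - 1" using m by auto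
  then have 2: "?der (m - 2) \<longleftrightarrow> (AE x in lebesgue_on {a..b}.
      (D (m-2) has_vector_derivative (D (m-1) x - inverse (\<i> ^ m) * of_real (Q x) * D 0 x)) (at x))"
    and 3: "?der (m - 1) \<longleftrightarrow> (AE x in lebesgue_on {a..b}.
      (D (m-1) has_vector_derivative (D m x + inverse (\<i> ^ m) * of_real (Q x) * D 1 x)) (at x))"
    by (simp_all add: qpart_def \<kappa>_def)
  have "qdom D \<longleftrightarrow> l2fun a b (D m) \<and> (\<forall>k<m. ac_on a b (D k)) \<and> (\<forall>k<m. ?der k)"
    unfolding qdom_def by blast
  also have "(\<forall>k<m. ?der k) \<longleftrightarrow> (\<forall>k. k + 2 < m \<longrightarrow> ?der k) \<and> ?der (m - 2) \<and> ?der (m - 1)"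
    by (rule split)
  finally show ?thesis
    unfolding quasi_derivs_def 2 3 using 1 by auto
qed

lemma qdomD:
  assumes "qdom D" "k < m"
  shows "ac_on a b (D k)" "continuous_on {a..b} (D k)"
    "AE x in lebesgue_on {a..b}. (D k has_vector_derivative D (Suc k) x + qpart D k x) (at x)"
  using assms ac_on_imp_continuous_on by (auto simp: qdom_def)

lemma l2_top: "qdom D \<Longrightarrow> l2fun a b (D m)"
  by (simp add: qdom_def)

lemma l2_0: "qdom D \<Longrightarrow> l2fun a b (D 0)"
  using m by (intro l2fun_continuous qdomD) auto

lemma qdom_zero: "qdom (\<lambda>_ _. 0)"
  by (simp add: qdom_def qpart_def ac_on_const l2fun_def)

lemma qdom_lincomb:
  assumes D: "qdom D" and E: "qdom E"
  shows "qdom (\<lambda>k x. D k x + c * E k x)"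
  unfolding qdom_def
proof (intro conjI allI impI)
  show "l2fun a b (\<lambda>x. D m x + c * E m x)"
    using D E by (intro l2fun_add l2fun_scale l2_top)
  fix k assume k: "k < m"
  show "ac_on a b (\<lambda>x. D k x + c * E k x)"
    using qdomD(1)[OF D k] qdomD(1)[OF E k] by (intro ac_on_add ac_on_cmult)
  show "AE x in lebesgue_on {a..b}. ((\<lambda>x. D k x + c * E k x) has_vector_derivative
      D (Suc k) x + c * E (Suc k) x + qpart (\<lambda>k x. D k x + c * E k x) k x) (at x)"
    using qdomD(3)[OF D k] qdomD(3)[OF E k]
  proof eventually_elim
    case (elim x)
    have "((\<lambda>x. D k x + c * E k x) has_vector_derivative
        (D (Suc k) x + qpart D k x) + c * (E (Suc k) x + qpart E k x)) (at x)"
      using elim by (intro has_vector_derivative_add has_vector_derivative_mult_right)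
    moreover have "qpart (\<lambda>k x. D k x + c * E k x) k x = qpart D k x + c * qpart E k x"
      by (simp add: qpart_def algebra_simps)
    ultimately show ?case by (simp add: algebra_simps)
  qed
qed

lemma qdom_scale: "qdom D \<Longrightarrow> qdom (\<lambda>k x. c * D k x)"
  using qdom_lincomb[OF qdom_zero, of D c] by simp

lemma qdom_diff: "qdom D \<Longrightarrow> qdom E \<Longrightarrow> qdom (\<lambda>k x. D k x - E k x)"
  using qdom_lincomb[of D E "-1"] by simp

lemma qdom_add: "qdom D \<Longrightarrow> qdom E \<Longrightarrow> qdom (\<lambda>k x. D k x + E k x)"
  using qdom_lincomb[of D E 1] by simp

lemma qdom_sum:
  assumes "\<And>i. i \<in> I \<Longrightarrow> qdom (Z i)"
  shows "qdom (\<lambda>k x. \<Sum>i\<in>I. c i * Z i k x)"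
  using assms
proof (induction I rule: infinite_finite_induct)
  case (insert i I)
  then have "qdom (\<lambda>k x. (\<Sum>i\<in>I. c i * Z i k x) + c i * Z i k x)"
    by (intro qdom_lincomb) auto
  then show ?case using insert.hyps by (simp add: add.commute)
qed (simp_all add: qdom_zero)

text \<open>Makes quasi-derivatives, and hence boundary values, well defined on classes. Continuity
  turns vanishing almost everywhere into vanishing everywhere, and differentiating an identically
  zero \<open>D k\<close> passes this on to the next order, since the terms with \<open>Q\<close>
  involve only \<open>D 0\<close> and \<open>D 1\<close>.\<close>

lemma qdom_vanishing:
  assumes D: "qdom D" and ae: "aeq a b (D 0) (\<lambda>_. 0)"
  shows "\<And>k x. k < m \<Longrightarrow> x \<in> {a..b} \<Longrightarrow> D k x = 0" and "aeq a b (D m) (\<lambda>_. 0)"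
proof -
  have zero: "\<forall>x\<in>{a..b}. D k x = 0" if "k < m" for k
    using that
  proof (induction k rule: less_induct)
    case (less k)
    have "AE x in lebesgue_on {a..b}. D k x = 0"
    proof (cases k)
      case 0
      then show ?thesis using ae by (simp add: aeq_def)
    next
      case (Suc l)
      have "AE x in lebesgue_on {a..b}. D k x + qpart D l x = 0"
        using AE_derivative_eq_0[OF _ qdomD(3)[OF D, of l]] less Suc by auto
      moreover have "AE x in lebesgue_on {a..b}. x \<in> {a..b}"
        by (intro AE_I2) simp
      ultimately show ?thesis
      proof eventually_elim
        case (elim x)
        \<comment> \<open>Below the top, \<open>l\<close> is at most \<open>m - 2\<close>, so the
          only term with \<open>Q\<close> that can occur is the one with \<open>D 0\<close>.\<close>
        have "D 0 x = 0" using less Suc elim(2) by auto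
        then show ?case using elim(1) less.prems Suc by (auto simp: qpart_def split: if_splits)
      qed
    qed
    then show ?case using continuous_AE_eq_0[OF ab qdomD(2)[OF D less.prems]] by blast
  qed
  then show "\<And>k x. k < m \<Longrightarrow> x \<in> {a..b} \<Longrightarrow> D k x = 0" by blast
  have "AE x in lebesgue_on {a..b}. D (Suc (m - 1)) x + qpart D (m - 1) x = 0"
    using zero m by (intro AE_derivative_eq_0[of a b "D (m - 1)"] qdomD(3)[OF D]) auto
  moreover have "AE x in lebesgue_on {a..b}. x \<in> {a..b}"
    by (intro AE_I2) simp
  ultimately have "AE x in lebesgue_on {a..b}. D m x = 0"
  proof eventually_elim
    case (elim x)
    have "D 0 x = 0" "D 1 x = 0" using zero elim(2) m by auto
    then show ?case using elim(1) m by (simp add: qpart_def split: if_splits)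
  qed
  then show "aeq a b (D m) (\<lambda>_. 0)" by (simp add: aeq_def)
qed

lemma qdom_unique:
  assumes "qdom D" "qdom E" "aeq a b (D 0) (E 0)"
  shows "\<And>k x. k < m \<Longrightarrow> x \<in> {a..b} \<Longrightarrow> D k x = E k x" and "aeq a b (D m) (E m)"
proof -
  have "aeq a b (\<lambda>x. D 0 x - E 0 x) (\<lambda>_. 0)"
    using assms(3) unfolding aeq_def by eventually_elim simp
  note van = qdom_vanishing[OF qdom_diff[OF assms(1,2)] this]
  show "\<And>k x. k < m \<Longrightarrow> x \<in> {a..b} \<Longrightarrow> D k x = E k x" using van(1) by simp
  show "aeq a b (D m) (E m)" using van(2) unfolding aeq_def by eventually_elim simp
qed

text \<open>The companion matrix of the system for the unknowns of order below \<open>m\<close>. The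
  top entry \<open>D m\<close> is not an unknown; it enters as the inhomogeneity of the last
  row.\<close>

definition coef :: "nat \<Rightarrow> nat \<Rightarrow> real \<Rightarrow> complex" where
  "coef j k x = (if k = Suc j then 1 else 0) + (if j = m - 2 \<and> k = 0 then - \<kappa> * of_real (Q x) else 0)
     + (if j = m - 1 \<and> k = 1 then \<kappa> * of_real (Q x) else 0)"

lemma coef_integrable: "coef j k absolutely_integrable_on {a..b}"
proof -
  have Q': "(\<lambda>x. c * complex_of_real (Q x)) absolutely_integrable_on {a..b}" for c
    using Q by (simp flip: integrable_lebesgue_on_Icc_iff)
  have c: "(\<lambda>x. c) absolutely_integrable_on {a..b}" for c :: complex
    by (intro absolutely_integrable_continuous_real) auto
  show ?thesis
    unfolding coef_def[abs_def]
    by (intro set_integral_add(1) absolutely_integrable_if Q' c)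
qed

lemma coef_sum:
  assumes "j < m"
  shows "(\<Sum>k<m. coef j k x * Y k x) + (if j = m - 1 then f x else 0)
    = (\<lambda>k. if k < m then Y k else f) (Suc j) x + qpart (\<lambda>k. if k < m then Y k else f) j x"
proof -
  have "(\<Sum>k<m. coef j k x * Y k x) = (\<Sum>k<m. (if k = Suc j then Y k x else 0)
      + (if k = 0 then (if j = m - 2 then - \<kappa> * of_real (Q x) * Y 0 x else 0) else 0)
      + (if k = 1 then (if j = m - 1 then \<kappa> * of_real (Q x) * Y 1 x else 0) else 0))"
    by (intro sum.cong) (auto simp: coef_def algebra_simps)
  also have "\<dots> = (if Suc j < m then Y (Suc j) x else 0)
      + (if j = m - 2 then - \<kappa> * of_real (Q x) * Y 0 x else 0)
      + (if j = m - 1 then \<kappa> * of_real (Q x) * Y 1 x else 0)"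
    using m by (simp add: sum.distrib)
  finally show ?thesis using assms m by (auto simp: qpart_def)
qed

lemma qdom_of_solution:
  assumes f: "l2fun a b f" and Y: "\<And>k. k < m \<Longrightarrow> continuous_on {a..b} (Y k)"
    and eq: "\<And>j u v. j < m \<Longrightarrow> a \<le> u \<Longrightarrow> u \<le> v \<Longrightarrow> v \<le> b \<Longrightarrow>
      Y j v - Y j u = integral {u..v} (\<lambda>t. (\<Sum>k<m. coef j k t * Y k t) + (if j = m - 1 then f t else 0))"
  shows "qdom (\<lambda>k. if k < m then Y k else f)"
proof -
  let ?D = "\<lambda>k. if k < m then Y k else f"
  have "ac_on a b (Y j) \<and>
      (AE x in lebesgue_on {a..b}. (Y j has_vector_derivative ?D (Suc j) x + qpart ?D j x) (at x))"
    if j: "j < m" for j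
  proof -
    let ?g = "\<lambda>t. (\<Sum>k<m. coef j k t * Y k t) + (if j = m - 1 then f t else 0)"
    have "f absolutely_integrable_on {a..b}"
      using l2fun_integrable[OF f] by (simp add: integrable_lebesgue_on_Icc_iff)
    then have g: "?g absolutely_integrable_on {a..b}"
      by (intro set_integral_add(1) absolutely_integrable_system absolutely_integrable_if)
        (auto simp: coef_integrable Y j ab less_imp_le)
    then have gi: "?g integrable_on {a..b}" by (simp add: absolutely_integrable_on_def)
    have "ac_on a b (Y j)" by (rule ac_on_indefinite_integral[OF g eq[OF j]])
    moreover have "AE x in lebesgue_on {a..b}. (Y j has_vector_derivative ?g x) (at x)"
      by (rule AE_has_vector_derivative_integral[OF gi eq[OF j]])
    ultimately show ?thesis by (simp only: coef_sum[OF j])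
  qed
  then show ?thesis unfolding qdom_def using f by simp
qed

lemma ex_solution_left:
  assumes f: "l2fun a b f"
  obtains D where "qdom D" "D m = f" "\<And>k. k < m \<Longrightarrow> D k a = c k"
proof -
  have fi: "(\<lambda>t. if j = m - 1 then f t else 0) absolutely_integrable_on {a..b}" for j
    using l2fun_integrable[OF f] unfolding integrable_lebesgue_on_Icc_iff by (rule absolutely_integrable_if)
  show thesis
  proof (rule linear_system_solvable_left[OF less_imp_le[OF ab] coef_integrable fi, where c = c and m = m])
    fix Y assume Y: "\<And>j. j < m \<Longrightarrow> continuous_on {a..b} (Y j)" "\<And>j. j < m \<Longrightarrow> Y j a = c j"
      "\<And>j u v. j < m \<Longrightarrow> a \<le> u \<Longrightarrow> u \<le> v \<Longrightarrow> v \<le> b \<Longrightarrow>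
        Y j v - Y j u = integral {u..v} (\<lambda>t. (\<Sum>k<m. coef j k t * Y k t) + (if j = m - 1 then f t else 0))"
    show thesis
      using qdom_of_solution[OF f Y(1,3)] Y(2) by (intro that[of "\<lambda>k. if k < m then Y k else f"]) auto
  qed
qed

lemma ex_solution_right:
  assumes f: "l2fun a b f"
  obtains D where "qdom D" "D m = f" "\<And>k. k < m \<Longrightarrow> D k b = c k"
proof -
  have fi: "(\<lambda>t. if j = m - 1 then f t else 0) absolutely_integrable_on {a..b}" for j
    using l2fun_integrable[OF f] unfolding integrable_lebesgue_on_Icc_iff by (rule absolutely_integrable_if)
  show thesis
  proof (rule linear_system_solvable_right[OF less_imp_le[OF ab] coef_integrable fi, where c = c and m = m])
    fix Y assume Y: "\<And>j. j < m \<Longrightarrow> continuous_on {a..b} (Y j)" "\<And>j. j < m \<Longrightarrow> Y j b = c j"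
      "\<And>j u v. j < m \<Longrightarrow> a \<le> u \<Longrightarrow> u \<le> v \<Longrightarrow> v \<le> b \<Longrightarrow>
        Y j v - Y j u = integral {u..v} (\<lambda>t. (\<Sum>k<m. coef j k t * Y k t) + (if j = m - 1 then f t else 0))"
    show thesis
      using qdom_of_solution[OF f Y(1,3)] Y(2) by (intro that[of "\<lambda>k. if k < m then Y k else f"]) auto
  qed
qed

text \<open>The Lagrange bracket: the boundary term left by repeated integration by parts.\<close>

definition bform :: "(nat \<Rightarrow> real \<Rightarrow> complex) \<Rightarrow> (nat \<Rightarrow> real \<Rightarrow> complex) \<Rightarrow> real \<Rightarrow> complex" where
  "bform D E x = \<i> ^ m * (\<Sum>k<m. (-1) ^ k * D (m - 1 - k) x * cnj (E k x))"

text \<open>The Q-terms cancel in pairs, since conjugation multiplies \<kappa> by (-1)^m, and the remaining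
  sum telescopes.\<close>
lemma bform_derivative:
  "(\<Sum>k<m. (-1) ^ k * ((D (m - k) x + qpart D (m - 1 - k) x) * cnj (E k x)
      + D (m - 1 - k) x * cnj (E (Suc k) x + qpart E k x)))
    = D m x * cnj (E 0 x) - (-1) ^ m * D 0 x * cnj (E m x)"
proof -
  define T where "T k = (-1) ^ k * D (m - k) x * cnj (E k x)" for k
  define q where "q = \<kappa> * of_real (Q x)"
  have cq: "cnj q = (-1) ^ m * q" by (simp add: q_def cnj_\<kappa>)
  have tel: "(\<Sum>k<m. T k - T (Suc k)) = D m x * cnj (E 0 x) - (-1) ^ m * D 0 x * cnj (E m x)"
    by (subst sum_lessThan_telescope') (simp add: T_def)
  have qD: "qpart D (m - 1 - k) x = (if k = 1 then - q * D 0 x else 0) + (if k = 0 then q * D 1 x else 0)"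
    if "k < m" for k
  proof -
    have "m - 1 - k = m - 2 \<longleftrightarrow> k = 1" "m - 1 - k = m - 1 \<longleftrightarrow> k = 0"
      using that m by arith+
    then show ?thesis by (simp only: qpart_def q_def) simp
  qed
  have "(\<Sum>k<m. (-1) ^ k * (qpart D (m - 1 - k) x * cnj (E k x)))
      = (\<Sum>k<m. (if k = 1 then q * D 0 x * cnj (E 1 x) else 0)
        + (if k = 0 then q * D 1 x * cnj (E 0 x) else 0))"
  proof (intro sum.cong refl)
    fix k assume "k \<in> {..<m}"
    then have "k < m" by simp
    show "(-1) ^ k * (qpart D (m - 1 - k) x * cnj (E k x))
      = (if k = 1 then q * D 0 x * cnj (E 1 x) else 0) + (if k = 0 then q * D 1 x * cnj (E 0 x) else 0)"
      unfolding qD[OF \<open>k < m\<close>] by auto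
  qed
  also have "\<dots> = q * D 0 x * cnj (E 1 x) + q * D 1 x * cnj (E 0 x)"
    using m by (simp add: sum.distrib)
  finally have q1: "(\<Sum>k<m. (-1) ^ k * (qpart D (m - 1 - k) x * cnj (E k x)))
      = q * D 0 x * cnj (E 1 x) + q * D 1 x * cnj (E 0 x)" .
  \<comment> \<open>The terms with \<open>Q\<close> coming from \<open>D\<close> sit at
    \<open>k = 0, 1\<close>, those coming from \<open>E\<close> at \<open>k = m - 2, m - 1\<close>.
    These parities combined with the sign in \<open>cnj q\<close> make the two contributions
    opposite.\<close>
  have sgn: "(-1) ^ (m - 2) * (-1) ^ m = (1::complex)" "(-1) ^ (m - 1) * (-1) ^ m = (-1::complex)"
    using m by (auto simp flip: power_add simp: minus_one_power_iff)
  have "(\<Sum>k<m. (-1) ^ k * (D (m - 1 - k) x * cnj (qpart E k x)))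
      = (\<Sum>k<m. (if k = m - 2 then (-1) ^ (m - 2) * D 1 x * (- cnj q * cnj (E 0 x)) else 0)
        + (if k = m - 1 then (-1) ^ (m - 1) * D 0 x * (cnj q * cnj (E 1 x)) else 0))"
  proof (intro sum.cong refl)
    fix k assume "k \<in> {..<m}"
    moreover have "m - 1 - (m - 2) = 1" using m by simp
    ultimately show "(-1) ^ k * (D (m - 1 - k) x * cnj (qpart E k x))
      = (if k = m - 2 then (-1) ^ (m - 2) * D 1 x * (- cnj q * cnj (E 0 x)) else 0)
        + (if k = m - 1 then (-1) ^ (m - 1) * D 0 x * (cnj q * cnj (E 1 x)) else 0)"
      using m by (auto simp: qpart_def q_def)
  qed
  also have "\<dots> = (-1) ^ (m - 2) * D 1 x * (- cnj q * cnj (E 0 x))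
      + (-1) ^ (m - 1) * D 0 x * (cnj q * cnj (E 1 x))"
    using m by (simp add: sum.distrib)
  also have "\<dots> = - ((-1) ^ (m - 2) * (-1) ^ m) * q * D 1 x * cnj (E 0 x)
      + ((-1) ^ (m - 1) * (-1) ^ m) * q * D 0 x * cnj (E 1 x)"
    by (simp add: cq)
  also have "\<dots> = - (q * D 0 x * cnj (E 1 x) + q * D 1 x * cnj (E 0 x))"
    unfolding sgn by simp
  finally have q2: "(\<Sum>k<m. (-1) ^ k * (D (m - 1 - k) x * cnj (qpart E k x)))
      = - (q * D 0 x * cnj (E 1 x) + q * D 1 x * cnj (E 0 x))" .
  have "(\<Sum>k<m. (-1) ^ k * ((D (m - k) x + qpart D (m - 1 - k) x) * cnj (E k x)
      + D (m - 1 - k) x * cnj (E (Suc k) x + qpart E k x)))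
    = (\<Sum>k<m. (T k - T (Suc k)) + (-1) ^ k * (qpart D (m - 1 - k) x * cnj (E k x))
      + (-1) ^ k * (D (m - 1 - k) x * cnj (qpart E k x)))"
    by (intro sum.cong) (auto simp: T_def algebra_simps)
  also have "\<dots> = (\<Sum>k<m. T k - T (Suc k))"
    by (simp only: sum.distrib q1 q2) simp
  finally show ?thesis using tel by simp
qed

text \<open>The bracket involves only orders below \<open>m\<close>, so it is absolutely continuous
  and the fundamental theorem applies to it as a whole. Moving \<open>\<i> ^ m\<close> into the
  second slot produces the sign \<open>(-1) ^ m\<close> of the telescoped sum.\<close>

theorem Green:
  assumes D: "qdom D" and E: "qdom E"
  shows "l2inner a b (\<lambda>x. \<i> ^ m * D m x) (E 0) - l2inner a b (D 0) (\<lambda>x. \<i> ^ m * E m x)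
    = bform D E b - bform D E a"
proof -
  define W where "W x = (\<Sum>k<m. (-1) ^ k * (D (m - 1 - k) x * cnj (E k x)))" for x
  define g where "g x = D m x * cnj (E 0 x) - (-1) ^ m * D 0 x * cnj (E m x)" for x
  have "ac_on a b W"
    unfolding W_def[abs_def]
    using m by (intro ac_on_sum ac_on_cmult ac_on_mult ac_on_cnj qdomD(1)[OF D] qdomD(1)[OF E]) auto
  moreover have "AE x in lebesgue_on {a..b}. (W has_vector_derivative g x) (at x)"
  proof -
    have "AE x in lebesgue_on {a..b}. \<forall>k<m.
        (D k has_vector_derivative D (Suc k) x + qpart D k x) (at x) \<and>
        (E k has_vector_derivative E (Suc k) x + qpart E k x) (at x)"
      using qdomD(3)[OF D] qdomD(3)[OF E] by (auto simp: AE_all_countable)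
    then show ?thesis
    proof eventually_elim
      case (elim x)
      have "(W has_vector_derivative (\<Sum>k<m. (-1) ^ k * (D (m - 1 - k) x * cnj (E (Suc k) x + qpart E k x)
          + (D (Suc (m - 1 - k)) x + qpart D (m - 1 - k) x) * cnj (E k x)))) (at x)"
        unfolding W_def[abs_def] using elim
        by (intro has_vector_derivative_sum has_vector_derivative_mult_right has_vector_derivative_mult
            has_vector_derivative_cnj) auto
      also have "(\<Sum>k<m. (-1) ^ k * (D (m - 1 - k) x * cnj (E (Suc k) x + qpart E k x)
          + (D (Suc (m - 1 - k)) x + qpart D (m - 1 - k) x) * cnj (E k x))) = g x"
        unfolding g_def bform_derivative[symmetric]
        by (intro sum.cong) (auto simp: Suc_diff_Suc add.commute)
      finally show ?case .
    qed
  qed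
  ultimately have W: "(g has_integral W b - W a) {a..b}"
    using ab by (intro ac_on_has_integral) auto
  note int = l2fun_integrable_mult_cnj[OF l2_top[OF D] l2_0[OF E]] l2fun_integrable_mult_cnj[OF l2_0[OF D] l2_top[OF E]]
  have "integrable (lebesgue_on {a..b}) g"
    unfolding g_def[abs_def] mult.assoc using int by simp
  then have "(g has_integral integral\<^sup>L (lebesgue_on {a..b}) g) {a..b}"
    by (rule has_integral_integral_lebesgue_on) simp
  with W have g1: "integral\<^sup>L (lebesgue_on {a..b}) g = W b - W a"
    using has_integral_unique by blast
  have g2: "integral\<^sup>L (lebesgue_on {a..b}) g
      = l2inner a b (D m) (E 0) - (-1) ^ m * l2inner a b (D 0) (E m)"
    unfolding g_def[abs_def] mult.assoc l2inner_def using int by simp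
  have "l2inner a b (\<lambda>x. \<i> ^ m * D m x) (E 0) = \<i> ^ m * l2inner a b (D m) (E 0)"
    using l2_top[OF D] l2_0[OF E] by (simp add: l2.ip_scale)
  moreover have "l2inner a b (D 0) (\<lambda>x. \<i> ^ m * E m x) = (-1) ^ m * \<i> ^ m * l2inner a b (D 0) (E m)"
    using l2_0[OF D] l2_top[OF E] unfolding cnj_i_power[symmetric] by (subst l2.ip_scale_right) auto
  ultimately have "l2inner a b (\<lambda>x. \<i> ^ m * D m x) (E 0) - l2inner a b (D 0) (\<lambda>x. \<i> ^ m * E m x)
      = \<i> ^ m * (l2inner a b (D m) (E 0) - (-1) ^ m * l2inner a b (D 0) (E m))"
    by (simp only: right_diff_distrib mult_ac)
  also have "\<dots> = \<i> ^ m * (W b - W a)"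
    using g1 g2 by simp
  finally show ?thesis by (simp add: bform_def W_def right_diff_distrib mult.assoc)
qed

end

section \<open>The minimal operator and its dissipative extensions\<close>

lemma aeq_refl: "aeq a b f f"
  by (simp add: aeq_def)

lemma aeq_sym: "aeq a b f g \<Longrightarrow> aeq a b g f"
  unfolding aeq_def by (auto elim: eventually_mono)

lemma aeq_trans: "aeq a b f g \<Longrightarrow> aeq a b g h \<Longrightarrow> aeq a b f h"
  unfolding aeq_def by (erule (1) eventually_elim2) simp

lemma aeq_add: "aeq a b f f' \<Longrightarrow> aeq a b g g' \<Longrightarrow> aeq a b (\<lambda>x. f x + g x) (\<lambda>x. f' x + g' x)"
  unfolding aeq_def by (erule (1) eventually_elim2) simp

lemma aeq_scale: "aeq a b f f' \<Longrightarrow> aeq a b (\<lambda>x. c * f x) (\<lambda>x. c * f' x)"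
  unfolding aeq_def by (erule eventually_mono) simp

lemma aeq_diff_0_iff: "aeq a b (\<lambda>x. f x - g x) (\<lambda>_. 0) \<longleftrightarrow> aeq a b f g"
  by (simp add: aeq_def)

context quasi_differential
begin

section \<open>Kernel, range and density of the minimal operator; free boundary data\<close>

definition qop :: "(nat \<Rightarrow> real \<Rightarrow> complex) \<Rightarrow> real \<Rightarrow> complex" where
  "qop D x = \<i> ^ m * D m x"

definition minimal :: "(nat \<Rightarrow> real \<Rightarrow> complex) \<Rightarrow> bool" where
  "minimal D \<longleftrightarrow> (\<forall>k<m. D k a = 0 \<and> D k b = 0)"

lemma l2_qop: "qdom D \<Longrightarrow> l2fun a b (qop D)"
  unfolding qop_def[abs_def] by (intro l2fun_scale l2_top)

lemma Green': "qdom D \<Longrightarrow> qdom E \<Longrightarrow>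
    l2inner a b (qop D) (E 0) - l2inner a b (D 0) (qop E) = bform D E b - bform D E a"
  using Green unfolding qop_def[abs_def] by blast

lemma qop_lincomb: "qop (\<lambda>k x. D k x + c * E k x) = (\<lambda>x. qop D x + c * qop E x)"
  by (auto simp: qop_def algebra_simps)

lemma ex_solution_qop:
  assumes "l2fun a b f"
  obtains D where "qdom D" "qop D = f" "\<And>k. k < m \<Longrightarrow> D k a = c k"
proof -
  obtain D where "qdom D" "D m = (\<lambda>x. inverse (\<i> ^ m) * f x)" "\<And>k. k < m \<Longrightarrow> D k a = c k"
    using ex_solution_left[OF l2fun_scale[OF assms]] by metis
  moreover from this have "qop D = f" by (auto simp: qop_def)
  ultimately show thesis using that by blast
qed

lemma bform_eq_0: "\<forall>k<m. D k x = 0 \<Longrightarrow> bform D E x = 0"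
  unfolding bform_def using m by simp

lemma bform_unit:
  assumes "i < m" "\<forall>k<m. E k x = (if k = i then 1 else 0)"
  shows "bform D E x = \<i> ^ m * ((-1) ^ i * D (m - 1 - i) x)"
proof -
  have "(\<Sum>k<m. (-1) ^ k * D (m - 1 - k) x * cnj (E k x))
      = (\<Sum>k<m. if k = i then (-1) ^ i * D (m - 1 - i) x else 0)"
    using assms(2) by (intro sum.cong) auto
  then show ?thesis using assms(1) by (simp add: bform_def)
qed

text \<open>With unit data at \<open>b\<close>, the bracket at \<open>b\<close> against
  \<open>N i\<close> picks out the single value of order \<open>m - 1 - i\<close>. Paired with
  functions that vanish at \<open>a\<close> to all orders below \<open>m\<close>, this leaves one
  boundary value in the Green formula.\<close>

lemma ex_kernel_basis:
  "\<exists>N. \<forall>i. qdom (N i) \<and> N i m = (\<lambda>_. 0) \<and> (\<forall>k<m. N i k b = (if k = i then 1 else 0))"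
proof (intro choice allI)
  fix i :: nat
  have "l2fun a b (\<lambda>_. 0)" by (simp add: l2fun_def)
  from ex_solution_right[OF this, of "\<lambda>k. if k = i then 1 else 0"]
  show "\<exists>D. qdom D \<and> D m = (\<lambda>_. 0) \<and> (\<forall>k<m. D k b = (if k = i then 1 else 0))" by metis
qed

lemma Green_kernel:
  assumes H: "qdom H" "\<forall>k<m. H k a = 0"
    and N: "qdom N" "N m = (\<lambda>_. 0)" "\<forall>k<m. N k b = (if k = i then 1 else 0)" "i < m"
  shows "l2inner a b (qop H) (N 0) = \<i> ^ m * ((-1) ^ i * H (m - 1 - i) b)"
proof -
  have "l2inner a b (H 0) (qop N) = 0"
    using N(2) by (simp add: qop_def[abs_def] l2inner_def)
  then show ?thesis
    using Green'[OF H(1) N(1)] bform_eq_0[of H a] bform_unit[of i N b H] H(2) N(3,4) by simp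
qed

text \<open>Let \<open>r\<close> be the part of \<open>w\<close> orthogonal to the kernel. Solving
  \<open>qop H = r\<close> with zero data at \<open>a\<close>, the products of \<open>r\<close> with
  the kernel basis are the values of \<open>H\<close> at \<open>b\<close>, so \<open>H\<close> is
  minimal. Thus \<open>r\<close> lies in the range and is orthogonal to \<open>w\<close> as well as
  to the kernel part \<open>Z 0\<close>, hence to itself.\<close>

lemma orthogonal_range_minimal:
  assumes w: "l2fun a b w"
    and orth: "\<And>H. qdom H \<Longrightarrow> minimal H \<Longrightarrow> l2inner a b (qop H) w = 0"
  obtains Z where "qdom Z" "qop Z = (\<lambda>_. 0)" "aeq a b w (Z 0)"
proof -
  obtain N where N: "\<And>i. qdom (N i)" "\<And>i. N i m = (\<lambda>_. 0)"
      "\<And>i. \<forall>k<m. N i k b = (if k = i then 1 else 0)"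
    using ex_kernel_basis by metis
  have N0: "l2fun a b (N i 0)" for i using N(1) by (rule l2_0)
  obtain c where c: "\<And>i. i < m \<Longrightarrow> l2inner a b (\<lambda>x. w x - (\<Sum>j<m. c j * N j 0 x)) (N i 0) = 0"
    using l2.ex_orthogonal_residual[of "{..<m}" "\<lambda>i. N i 0" a b w] w N0 by auto
  define Z where "Z k x = (\<Sum>j<m. c j * N j k x)" for k x
  define r where "r x = w x - Z 0 x" for x
  have Z: "qdom Z" unfolding Z_def[abs_def] using N(1) by (intro qdom_sum)
  have r: "l2fun a b r" unfolding r_def[abs_def] using w l2_0[OF Z] by (rule l2fun_diff)
  have rN: "l2inner a b r (N i 0) = 0" if "i < m" for i
    using c[OF that] by (simp add: r_def[abs_def] Z_def)
  obtain H where H: "qdom H" "qop H = r" "\<forall>k<m. H k a = 0"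
    using ex_solution_qop[OF r, of "\<lambda>_. 0"] by metis
  have "H k b = 0" if "k < m" for k
  proof -
    have "m - 1 - k < m" "m - 1 - (m - 1 - k) = k" using that m by auto
    then show ?thesis
      using Green_kernel[OF H(1,3) N(1,2,3), of "m - 1 - k"] rN[of "m - 1 - k"] H(2) by simp
  qed
  then have "l2inner a b r w = 0" using orth[of H] H by (simp add: minimal_def)
  moreover have "l2inner a b r (Z 0) = (\<Sum>j<m. cnj (c j) * l2inner a b r (N j 0))"
    unfolding Z_def using r N0 by (intro l2.ip_sum_right) auto
  ultimately have "l2inner a b r r = 0"
    using r w l2_0[OF Z] rN by (subst (2) r_def[abs_def]) (simp add: l2.ip_diff_right)
  then have "aeq a b w (Z 0)"
    using r by (simp add: l2inner_self_eq_0_iff) (simp add: r_def[abs_def] aeq_diff_0_iff)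
  moreover have "qop Z = (\<lambda>_. 0)" by (simp add: qop_def[abs_def] Z_def N(2))
  ultimately show thesis using that Z by blast
qed

text \<open>\<open>E\<close> has the right values at \<open>a\<close>. The correction
  \<open>H\<close> vanishes at \<open>a\<close>, and its values at \<open>b\<close> are the products
  of \<open>qop H\<close> with the kernel basis; taking \<open>qop H\<close> in the kernel, these
  can be prescribed through the Gram matrix.\<close>

lemma boundary_data_surjective:
  obtains D where "qdom D" "\<And>k. k < m \<Longrightarrow> D k a = \<alpha> k" "\<And>k. k < m \<Longrightarrow> D k b = \<beta> k"
proof -
  obtain N where N: "\<And>i. qdom (N i)" "\<And>i. N i m = (\<lambda>_. 0)"
      "\<And>i. \<forall>k<m. N i k b = (if k = i then 1 else 0)"
    using ex_kernel_basis by metis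
  have N0: "l2fun a b (N i 0)" for i using N(1) by (rule l2_0)
  obtain E where E: "qdom E" "\<And>k. k < m \<Longrightarrow> E k a = \<alpha> k"
    using ex_solution_left[of "\<lambda>_. 0" \<alpha>] by (auto simp: l2fun_def)
  \<comment> \<open>Read off from \<open>Green_kernel\<close>, which returns the value of order
    \<open>m - 1 - i\<close> at index \<open>i\<close>.\<close>
  define \<tau> where "\<tau> i = \<i> ^ m * ((-1) ^ i * (\<beta> (m - 1 - i) - E (m - 1 - i) b))" for i
  \<comment> \<open>A combination that vanishes in L_2 vanishes with its quasi-derivatives of order
    below \<open>m\<close>, and those at \<open>b\<close> are its coefficients.\<close>
  have indep: "c i = 0" if "l2inner a b (\<lambda>x. \<Sum>j<m. c j * N j 0 x) (\<lambda>x. \<Sum>j<m. c j * N j 0 x) = 0"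
    and i: "i \<in> {..<m}" for c i
  proof -
    define Z where "Z k x = (\<Sum>j<m. c j * N j k x)" for k x
    have Z: "qdom Z" unfolding Z_def[abs_def] using N(1) by (intro qdom_sum)
    have "l2inner a b (Z 0) (Z 0) = 0" using that(1) by (simp add: Z_def[abs_def])
    then have "aeq a b (Z 0) (\<lambda>_. 0)" using l2_0[OF Z] by (simp add: l2inner_self_eq_0_iff)
    then have "Z i b = 0" using qdom_vanishing(1)[OF Z] i ab by simp
    moreover have "Z i b = (\<Sum>j<m. if j = i then c i else 0)"
      unfolding Z_def using i N(3) by (intro sum.cong) auto
    ultimately show ?thesis using i by simp
  qed
  have "\<exists>c. \<forall>i\<in>{..<m}. l2inner a b (\<lambda>x. \<Sum>j<m. c j * N j 0 x) (N i 0) = \<tau> i"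
    using indep N0 by (intro l2.ex_prescribed_products) auto
  then obtain c where c: "\<And>i. i < m \<Longrightarrow> l2inner a b (\<lambda>x. \<Sum>j<m. c j * N j 0 x) (N i 0) = \<tau> i"
    by blast
  have "l2fun a b (\<lambda>x. \<Sum>j<m. c j * N j 0 x)"
    using l2.sum_mem[of "{..<m}" "\<lambda>i. N i 0" a b c] N0 by simp
  then obtain H where H: "qdom H" "qop H = (\<lambda>x. \<Sum>j<m. c j * N j 0 x)" "\<forall>k<m. H k a = 0"
    using ex_solution_qop[of "\<lambda>x. \<Sum>j<m. c j * N j 0 x" "\<lambda>_. 0"] by metis
  have Hb: "H k b = \<beta> k - E k b" if "k < m" for k
  proof -
    have "m - 1 - k < m" "m - 1 - (m - 1 - k) = k" using that m by auto
    then show ?thesis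
      using Green_kernel[OF H(1,3) N(1,2,3), of "m - 1 - k"] c[of "m - 1 - k"] H(2)
      by (simp add: \<tau>_def)
  qed
  show thesis
    using qdom_add[OF H(1) E(1)] H(3) Hb E(2) by (intro that[of "\<lambda>k x. H k x + E k x"]) auto
qed

text \<open>Let \<open>g\<close> be orthogonal to the minimal domain and write
  \<open>g = qop Z\<close>. The Green formula shows that \<open>Z 0\<close> is orthogonal to the
  range of the minimal operator, so it agrees with a function in the kernel; then \<open>g\<close>
  vanishes almost everywhere.\<close>

lemma minimal_dense:
  assumes f: "l2fun a b f" and "0 < \<epsilon>"
  shows "\<exists>H. qdom H \<and> minimal H \<and> (LINT x|lebesgue_on {a..b}. (cmod (f x - H 0 x))\<^sup>2) < \<epsilon>"
proof -
  define S where "S = {H 0 | H. qdom H \<and> minimal H}"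
  have "\<exists>s\<in>S. (LINT x|lebesgue_on {a..b}. (cmod (f x - s x))\<^sup>2) < \<epsilon>"
  proof (rule l2_dense_criterion[OF less_imp_le[OF ab] _ _ _ _ _ f \<open>0 < \<epsilon>\<close>])
    show "l2fun a b s" if "s \<in> S" for s using that l2_0 by (auto simp: S_def)
    show "S \<noteq> {}" using qdom_zero by (auto simp: S_def minimal_def)
    show "(\<lambda>x. s x + t x) \<in> S" if st: "s \<in> S" "t \<in> S" for s t
    proof -
      obtain H H' where "qdom H" "minimal H" "s = H 0" "qdom H'" "minimal H'" "t = H' 0"
        using st by (auto simp: S_def)
      then show ?thesis
        unfolding S_def by (intro CollectI exI[of _ "\<lambda>k x. H k x + H' k x"]) (auto simp: minimal_def qdom_add)
    qed
    show "(\<lambda>x. c * s x) \<in> S" if st: "s \<in> S" for s c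
    proof -
      obtain H where "qdom H" "minimal H" "s = H 0" using st by (auto simp: S_def)
      then show ?thesis
        unfolding S_def by (intro CollectI exI[of _ "\<lambda>k x. c * H k x"]) (auto simp: minimal_def qdom_scale)
    qed
    fix g assume g: "l2fun a b g" and orth: "\<And>s. s \<in> S \<Longrightarrow> l2inner a b g s = 0"
    obtain Z where Z: "qdom Z" "qop Z = g" using ex_solution_qop[OF g, of "\<lambda>_. 0"] by metis
    have "l2inner a b (qop H) (Z 0) = 0" if H: "qdom H" "minimal H" for H
    proof -
      have "l2inner a b g (H 0) = 0" using H by (intro orth) (auto simp: S_def)
      then have "l2inner a b (H 0) (qop Z) = 0"
        using Z(2) l2.ip_cnj[of g a b "H 0"] g l2_0[OF H(1)] by simp
      moreover have "bform H Z a = 0" "bform H Z b = 0"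
        using H(2) by (auto simp: minimal_def intro!: bform_eq_0)
      ultimately show ?thesis using Green'[OF H(1) Z(1)] by simp
    qed
    then obtain N where N: "qdom N" "qop N = (\<lambda>_. 0)" "aeq a b (Z 0) (N 0)"
      using orthogonal_range_minimal[OF l2_0[OF Z(1)]] by metis
    have "aeq a b (qop Z) (qop N)"
      unfolding qop_def[abs_def] using qdom_unique(2)[OF Z(1) N(1,3)] by (rule aeq_scale)
    then show "aeq a b g (\<lambda>_. 0)" using Z(2) N(2) by simp
  qed
  then show ?thesis by (auto simp: S_def)
qed

section \<open>Restrictions of the maximal operator given by conditions on the tower\<close>

definition opgraph :: "((nat \<Rightarrow> real \<Rightarrow> complex) \<Rightarrow> bool) \<Rightarrow> graph" where
  "opgraph P = {(f,g). l2fun a b f \<and> l2fun a b g \<and>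
     (\<exists>D. qdom D \<and> P D \<and> aeq a b f (D 0) \<and> aeq a b g (qop D))}"

lemma sat_quasi_derivs:
  "sat a b {(y, \<lambda>x. \<i> ^ m * D m x) | y D. quasi_derivs m Q a b y D \<and> l2fun a b (D m) \<and> P D} = opgraph P"
proof -
  have AEI: "AE x in lebesgue_on {a..b}. x \<in> {a..b}" by (intro AE_I2) simp
  have y: "aeq a b y (D 0)" if "\<forall>x\<in>{a..b}. D 0 x = y x" for y D
    unfolding aeq_def using AEI by eventually_elim (use that in auto)
  show ?thesis
  proof (intro equalityI subsetI)
    fix p assume "p \<in> sat a b {(y, \<lambda>x. \<i> ^ m * D m x) | y D. quasi_derivs m Q a b y D \<and> l2fun a b (D m) \<and> P D}"
    then obtain f g y D where p: "p = (f,g)" "l2fun a b f" "l2fun a b g" "aeq a b f y"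
      "aeq a b g (\<lambda>x. \<i> ^ m * D m x)" and D: "quasi_derivs m Q a b y D \<and> l2fun a b (D m)" "P D"
      by (auto simp: sat_def)
    have "aeq a b f (D 0)" "qdom D"
      using D(1) p(4) y aeq_trans unfolding quasi_derivs_iff by blast+
    then show "p \<in> opgraph P"
      using p D by (auto simp: opgraph_def qop_def[abs_def])
  next
    fix p assume "p \<in> opgraph P"
    then obtain f g D where p: "p = (f,g)" "l2fun a b f" "l2fun a b g" "qdom D" "P D"
      "aeq a b f (D 0)" "aeq a b g (\<lambda>x. \<i> ^ m * D m x)"
      by (auto simp: opgraph_def qop_def[abs_def])
    moreover have "quasi_derivs m Q a b (D 0) D \<and> l2fun a b (D m)"
      using p(4) unfolding quasi_derivs_iff by simp
    ultimately show "p \<in> sat a b {(y, \<lambda>x. \<i> ^ m * D m x) | y D. quasi_derivs m Q a b y D \<and> l2fun a b (D m) \<and> P D}"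
      unfolding sat_def by blast
  qed
qed

lemma mem_opgraph: "qdom D \<Longrightarrow> P D \<Longrightarrow> (D 0, qop D) \<in> opgraph P"
  unfolding opgraph_def using l2_0 l2_qop aeq_refl by blast

text \<open>A graph element may be represented by different towers; it is single-valued because
  towers whose lowest entries agree almost everywhere have tops that agree almost
  everywhere.\<close>

lemma opgraph_is_operator:
  assumes P0: "P (\<lambda>_ _. 0)" and P: "\<And>D E c. P D \<Longrightarrow> P E \<Longrightarrow> P (\<lambda>k x. D k x + c * E k x)"
  shows "is_operator a b (opgraph P)"
proof -
  have "sat a b (opgraph P) = opgraph P"
  proof (intro equalityI subsetI)
    fix p assume "p \<in> sat a b (opgraph P)"
    then show "p \<in> opgraph P"
      unfolding sat_def opgraph_def using aeq_trans by blast
  next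
    fix p assume p: "p \<in> opgraph P"
    then obtain f g where "p = (f,g)" "l2fun a b f" "l2fun a b g" by (auto simp: opgraph_def)
    then show "p \<in> sat a b (opgraph P)"
      unfolding sat_def using p aeq_refl by blast
  qed
  moreover have "((\<lambda>_. 0), (\<lambda>_. 0)) \<in> opgraph P"
    using mem_opgraph[of "\<lambda>_ _. 0" P] qdom_zero P0 by (simp add: qop_def[abs_def])
  moreover have lin: "(\<lambda>x. f x + c * f' x, \<lambda>x. g x + c * g' x) \<in> opgraph P"
    if fg: "(f,g) \<in> opgraph P" "(f',g') \<in> opgraph P" for f g f' g' c
  proof -
    obtain D where D: "l2fun a b f" "l2fun a b g" "qdom D" "P D" "aeq a b f (D 0)" "aeq a b g (qop D)"
      using fg(1) by (auto simp: opgraph_def)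
    obtain E where E: "l2fun a b f'" "l2fun a b g'" "qdom E" "P E" "aeq a b f' (E 0)" "aeq a b g' (qop E)"
      using fg(2) by (auto simp: opgraph_def)
    show ?thesis
      unfolding opgraph_def using D E
      by (auto simp: qop_lincomb intro!: l2fun_add l2fun_scale exI[of _ "\<lambda>k x. D k x + c * E k x"]
          qdom_lincomb P aeq_add aeq_scale)
  qed
  moreover have "aeq a b g g'"
    if fg: "(f,g) \<in> opgraph P" "(f',g') \<in> opgraph P" and "aeq a b f f'" for f g f' g'
  proof -
    obtain D where D: "qdom D" "aeq a b f (D 0)" "aeq a b g (qop D)"
      using fg(1) by (auto simp: opgraph_def)
    obtain E where E: "qdom E" "aeq a b f' (E 0)" "aeq a b g' (qop E)"
      using fg(2) by (auto simp: opgraph_def)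
    have "aeq a b (D 0) (E 0)"
      using D(2) E(2) \<open>aeq a b f f'\<close> aeq_sym aeq_trans by meson
    then have "aeq a b (qop D) (qop E)"
      unfolding qop_def[abs_def] using qdom_unique(2)[OF D(1) E(1)] by (intro aeq_scale)
    then show ?thesis using D(3) E(3) aeq_sym aeq_trans by meson
  qed
  ultimately show ?thesis
    unfolding is_operator_def using lin[of _ _ _ _ 1] lin[of "\<lambda>_. 0" "\<lambda>_. 0"] by auto
qed

lemma opgraph_densely_defined:
  assumes "\<And>D. qdom D \<Longrightarrow> minimal D \<Longrightarrow> P D"
  shows "densely_defined a b (opgraph P)"
  unfolding densely_defined_def
proof (intro allI impI)
  fix f and \<epsilon> :: real assume "l2fun a b f" "0 < \<epsilon>"
  then obtain H where "qdom H" "minimal H" "(LINT x|lebesgue_on {a..b}. (cmod (f x - H 0 x))\<^sup>2) < \<epsilon>"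
    using minimal_dense by blast
  then show "\<exists>(g,h)\<in>opgraph P. (LINT x|lebesgue_on {a..b}. (cmod (f x - g x))\<^sup>2) < \<epsilon>"
    using mem_opgraph[OF _ assms, of H] by (intro bexI[of _ "(H 0, qop H)"]) auto
qed

lemma is_operatorD:
  assumes "is_operator a b G"
  shows "(f,g) \<in> G \<Longrightarrow> l2fun a b f \<and> l2fun a b g"
    and "(f,g) \<in> G \<Longrightarrow> (f',g') \<in> G \<Longrightarrow> (\<lambda>x. f x + c * f' x, \<lambda>x. g x + c * g' x) \<in> G"
    and "(f,g) \<in> G \<Longrightarrow> l2fun a b f' \<Longrightarrow> l2fun a b g' \<Longrightarrow> aeq a b f' f \<Longrightarrow> aeq a b g' g \<Longrightarrow> (f',g') \<in> G"
    and "((\<lambda>_. 0), (\<lambda>_. 0)) \<in> G"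
proof -
  have sat: "sat a b G = G" using assms by (simp add: is_operator_def)
  show "(f,g) \<in> G \<Longrightarrow> l2fun a b f \<and> l2fun a b g"
    using sat by (auto simp: sat_def)
  show "(f',g') \<in> G" if "(f,g) \<in> G" "l2fun a b f'" "l2fun a b g'" "aeq a b f' f" "aeq a b g' g"
  proof -
    have "(f',g') \<in> sat a b G" unfolding sat_def using that by blast
    then show ?thesis using sat by simp
  qed
  show "((\<lambda>_. 0), (\<lambda>_. 0)) \<in> G" using assms by (simp add: is_operator_def)
  show "(\<lambda>x. f x + c * f' x, \<lambda>x. g x + c * g' x) \<in> G" if "(f,g) \<in> G" "(f',g') \<in> G"
  proof -
    have add: "\<forall>p\<in>G. \<forall>q\<in>G. (\<lambda>x. fst p x + fst q x, \<lambda>x. snd p x + snd q x) \<in> G"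
      and scale: "\<forall>p\<in>G. \<forall>c. (\<lambda>x. c * fst p x, \<lambda>x. c * snd p x) \<in> G"
      using assms by (simp_all add: is_operator_def split_def)
    have "(\<lambda>x. c * f' x, \<lambda>x. c * g' x) \<in> G"
      using bspec[OF scale that(2)] by simp
    from bspec[OF bspec[OF add that(1)] this] show ?thesis by simp
  qed
qed

text \<open>Testing dissipativity on f + c h with h in the minimal domain shows that the extension is
  contained in the adjoint of the minimal operator.\<close>
lemma dissipative_extension_le_max:
  assumes G: "dissipative a b G" and min: "opgraph minimal \<subseteq> G" and fg: "(f,g) \<in> G"
  obtains D where "qdom D" "aeq a b f (D 0)" "aeq a b g (qop D)"
proof -
  have op: "is_operator a b G" and pos: "\<And>f g. (f,g) \<in> G \<Longrightarrow> 0 \<le> Im (l2inner a b g f)"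
    using G by (auto simp: dissipative_def)
  have f: "l2fun a b f" and g: "l2fun a b g" using is_operatorD(1)[OF op fg] by auto
  have adj: "l2inner a b (qop H) f = l2inner a b (H 0) g" if H: "qdom H" "minimal H" for H
  proof -
    have HG: "(H 0, qop H) \<in> G" using mem_opgraph[of H minimal] H min by blast
    note l2H = l2_0[OF H(1)] l2_qop[OF H(1)]
    have "bform H H a = 0" "bform H H b = 0"
      using H(2) by (auto simp: minimal_def intro!: bform_eq_0)
    then have "l2inner a b (qop H) (H 0) = cnj (l2inner a b (qop H) (H 0))"
      using Green'[OF H(1,1)] l2.ip_cnj[of "qop H" a b "H 0"] l2H by simp
    then have real: "Im (l2inner a b (qop H) (H 0)) = 0"
      by (metis Reals_cnj_iff complex_is_Real_iff)
    define w where "w = l2inner a b (qop H) f - cnj (l2inner a b g (H 0))"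
    have ineq: "t * (cmod w)\<^sup>2 \<le> Im (l2inner a b g f)" for t :: real
    proof -
      \<comment> \<open>This multiple makes \<open>c * w\<close> equal to
        \<open>- \<i> * t * (cmod w)\<^sup>2\<close>, and the quadratic term in \<open>c\<close> is
        real since \<open>H\<close> is minimal. A bound linear in an arbitrary real \<open>t\<close>
        remains, which forces \<open>w = 0\<close>.\<close>
      define c where "c = - \<i> * of_real t * cnj w"
      have "0 \<le> Im (l2inner a b (\<lambda>x. g x + c * qop H x) (\<lambda>x. f x + c * H 0 x))"
        using is_operatorD(2)[OF op fg HG, of c] by (rule pos)
      also have "l2inner a b (\<lambda>x. g x + c * qop H x) (\<lambda>x. f x + c * H 0 x)
          = l2inner a b g f + cnj c * l2inner a b g (H 0) + c * l2inner a b (qop H) f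
            + c * cnj c * l2inner a b (qop H) (H 0)"
        using f g l2H
        by (simp add: l2.ip_add l2.ip_add_right l2.ip_scale l2.ip_scale_right l2fun_add l2fun_scale algebra_simps)
      also have "Im \<dots> = Im (l2inner a b g f) + Im (c * w)"
        using real by (simp add: w_def complex_mult_cnj algebra_simps)
      also have "c * w = - \<i> * of_real (t * (cmod w)\<^sup>2)"
        using complex_norm_square[of w] by (simp add: c_def mult_ac)
      finally show ?thesis by simp
    qed
    have "(cmod w)\<^sup>2 = 0"
    proof (rule ccontr)
      assume "(cmod w)\<^sup>2 \<noteq> 0"
      then show False using ineq[of "(Im (l2inner a b g f) + 1) / (cmod w)\<^sup>2"] by simp
    qed
    then show ?thesis using l2.ip_cnj[of g a b "H 0"] g l2H by (simp add: w_def)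
  qed
  \<comment> \<open>By \<open>adj\<close> the pair lies in the adjoint. Once \<open>g\<close> is
    solved for, \<open>f - Z 0\<close> is orthogonal to the range of the minimal operator and
    differs from a kernel function only on a null set.\<close>
  obtain Z where Z: "qdom Z" "qop Z = g" using ex_solution_qop[OF g, of "\<lambda>_. 0"] by metis
  have "l2inner a b (qop H) (\<lambda>x. f x - Z 0 x) = 0" if H: "qdom H" "minimal H" for H
  proof -
    have "bform H Z a = 0" "bform H Z b = 0"
      using H(2) by (auto simp: minimal_def intro!: bform_eq_0)
    then have "l2inner a b (qop H) (Z 0) = l2inner a b (H 0) g"
      using Green'[OF H(1) Z(1)] Z(2) by simp
    then show ?thesis
      using adj[OF H] f l2_0[OF Z(1)] l2_qop[OF H(1)] by (simp add: l2.ip_diff_right)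
  qed
  then obtain N where N: "qdom N" "qop N = (\<lambda>_. 0)" "aeq a b (\<lambda>x. f x - Z 0 x) (N 0)"
    using orthogonal_range_minimal[OF l2fun_diff[OF f l2_0[OF Z(1)]]] by metis
  show thesis
  proof
    show "qdom (\<lambda>k x. Z k x + 1 * N k x)" by (rule qdom_lincomb[OF Z(1) N(1)])
    show "aeq a b f (\<lambda>x. Z 0 x + 1 * N 0 x)"
      using N(3) unfolding aeq_def by eventually_elim (simp add: algebra_simps)
    show "aeq a b g (qop (\<lambda>k x. Z k x + 1 * N k x))"
      unfolding qop_lincomb by (simp add: Z(2) N(2) aeq_refl)
  qed
qed

end

section \<open>The boundary triplet\<close>

text \<open>The bracket couples order \<open>k\<close> with order \<open>m - 1 - k\<close>, while
  the boundary maps list each such couple once per endpoint. Folding the sum matches the two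
  layouts; an odd \<open>m\<close> leaves the self-coupled middle order.\<close>

lemma sum_fold_halves:
  fixes F :: "nat \<Rightarrow> complex"
  shows "(\<Sum>k<m. F k) = (\<Sum>k<m div 2. F k + F (m - 1 - k)) + (if odd m then F (m div 2) else 0)"
proof -
  define n where "n = m div 2"
  have n: "odd m \<Longrightarrow> m = n + Suc n" "even m \<Longrightarrow> m = n + n" "n \<le> m"
    unfolding n_def by presburger+
  have "(\<Sum>k<m. F k) = (\<Sum>k<n. F k) + (\<Sum>k\<in>{n..<m}. F k)"
    using n by (subst sum.atLeastLessThan_concat[of 0 n m, symmetric, unfolded atLeast0LessThan]) auto
  also have "(\<Sum>k\<in>{n..<m}. F k) = (if odd m then F n else 0) + (\<Sum>k\<in>{m - n..<m}. F k)"
  proof (cases "odd m")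
    case True
    then have "n < m" "m - n = Suc n" using n by auto
    then show ?thesis using True by (simp add: sum.atLeast_Suc_lessThan)
  next
    case False
    then have "m - n = n" using n by auto
    then show ?thesis using False by simp
  qed
  also have "(\<Sum>k\<in>{m - n..<m}. F k) = (\<Sum>k<n. F (m - 1 - k))"
    by (rule sum.reindex_bij_witness[of _ "\<lambda>k. m - 1 - k" "\<lambda>k. m - 1 - k"]) (auto simp: n_def)
  finally show ?thesis by (simp add: sum.distrib n_def)
qed

lemma sum_two_blocks:
  fixes G :: "nat \<Rightarrow> complex"
  shows "(\<Sum>j<m. G j) = (\<Sum>k<m div 2. G k + G (m div 2 + k)) + (if odd m then G (2 * (m div 2)) else 0)"
proof -
  define n where "n = m div 2"
  have split: "(\<Sum>j<n + n. G j) = (\<Sum>k<n. G k + G (n + k))"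
  proof -
    have "(\<Sum>j<n + n. G j) = (\<Sum>j<n. G j) + (\<Sum>j\<in>{n..<n + n}. G j)"
      by (subst sum.atLeastLessThan_concat[of 0 n "n + n", symmetric, unfolded atLeast0LessThan]) auto
    also have "(\<Sum>j\<in>{n..<n + n}. G j) = (\<Sum>k<n. G (n + k))"
      by (rule sum.reindex_bij_witness[of _ "\<lambda>k. n + k" "\<lambda>j. j - n"]) auto
    finally show ?thesis by (simp add: sum.distrib)
  qed
  show ?thesis
  proof (cases "odd m")
    case True
    then have "m = Suc (n + n)" unfolding n_def by presburger
    then have "(\<Sum>j<m. G j) = (\<Sum>j<n + n. G j) + G (n + n)" by simp
    then show ?thesis using True split by (simp add: n_def mult_2)
  next
    case False
    then have "m = n + n" by (auto simp: n_def)
    then have "(\<Sum>j<m. G j) = (\<Sum>j<n + n. G j)" by simp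
    then show ?thesis using False split by (simp add: n_def)
  qed
qed

text \<open>One elimination step per coordinate: a vector of \<open>U\<close> with nonzero last
  coordinate is normalised and subtracted off, leaving a subspace on which that coordinate vanishes.
  The generators are what orthogonal projection onto a space of boundary values will need.\<close>

lemma finitely_generated_subspace:
  fixes U :: "(nat \<Rightarrow> complex) set"
  assumes "(\<lambda>_. 0) \<in> U" and "\<And>u v c. u \<in> U \<Longrightarrow> v \<in> U \<Longrightarrow> (\<lambda>i. u i + c * v i) \<in> U"
  shows "\<exists>(r::nat) z. (\<forall>j<r. z j \<in> U) \<and> (\<forall>u\<in>U. \<exists>c. \<forall>i<m. u i = (\<Sum>j<r. c j * z j i))"
  using assms
proof (induction m arbitrary: U)
  case 0
  show ?case by (intro exI[of _ 0]) auto
next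
  case (Suc m)
  show ?case
  proof (cases "\<forall>u\<in>U. u m = 0")
    case True
    obtain r z where z: "\<forall>j<r::nat. z j \<in> U" "\<forall>u\<in>U. \<exists>c. \<forall>i<m. u i = (\<Sum>j<r. c j * z j i)"
      using Suc.IH[OF Suc.prems] by auto
    have "\<exists>c. \<forall>i<Suc m. u i = (\<Sum>j<r. c j * z j i)" if u: "u \<in> U" for u
    proof -
      obtain c where "\<forall>i<m. u i = (\<Sum>j<r. c j * z j i)" using z(2) u by blast
      moreover have "(\<Sum>j<r. c j * z j m) = 0" using z(1) True by (intro sum.neutral) auto
      ultimately show ?thesis using True u by (intro exI[of _ c]) (auto simp: less_Suc_eq)
    qed
    then show ?thesis using z(1) by blast
  next
    case False
    then obtain w where w: "w \<in> U" "w m \<noteq> 0" by blast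
    define z0 where "z0 i = w i / w m" for i
    have z0: "z0 \<in> U" "z0 m = 1"
      using Suc.prems(2)[OF Suc.prems(1) w(1), of "1 / w m"] w(2) by (simp_all add: z0_def[abs_def])
    define U' where "U' = {u\<in>U. u m = 0}"
    have "(\<lambda>_. 0) \<in> U'" "\<And>u v c. u \<in> U' \<Longrightarrow> v \<in> U' \<Longrightarrow> (\<lambda>i. u i + c * v i) \<in> U'"
      using Suc.prems by (auto simp: U'_def)
    from Suc.IH[OF this] obtain r z where z: "\<forall>j<r::nat. z j \<in> U'"
      "\<forall>u\<in>U'. \<exists>c. \<forall>i<m. u i = (\<Sum>j<r. c j * z j i)"
      by auto
    define z' where "z' j = (if j < r then z j else z0)" for j
    have "\<exists>c. \<forall>i<Suc m. u i = (\<Sum>j<Suc r. c j * z' j i)" if u: "u \<in> U" for u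
    proof -
      have "(\<lambda>i. u i + (- u m) * z0 i) \<in> U'"
        using Suc.prems(2)[OF u z0(1), of "- u m"] z0(2) by (simp add: U'_def)
      from bspec[OF z(2) this]
      obtain c where c: "\<forall>i<m. u i + (- u m) * z0 i = (\<Sum>j<r. c j * z j i)" by blast
      define c' where "c' j = (if j < r then c j else u m)" for j
      have "(\<Sum>j<Suc r. c' j * z' j i) = (\<Sum>j<r. c j * z j i) + u m * z0 i" for i
        by (simp add: c'_def z'_def)
      moreover have "(\<Sum>j<r. c j * z j m) = 0" using z(1) by (intro sum.neutral) (auto simp: U'_def)
      ultimately show ?thesis
        using c z0(2) by (intro exI[of _ c']) (auto simp: less_Suc_eq algebra_simps)
    qed
    moreover have "\<forall>j<Suc r. z' j \<in> U" using z(1) z0 by (auto simp: z'_def U'_def)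
    ultimately show ?thesis by blast
  qed
qed

context quasi_differential
begin

lemma Gamma_values:
  assumes "k < m div 2"
  shows "Gamma1 m a b D k = \<i> ^ m * ((-1) ^ Suc k * D (m - 1 - k) a)"
    and "Gamma1 m a b D (m div 2 + k) = \<i> ^ m * ((-1) ^ k * D (m - 1 - k) b)"
    and "Gamma2 m a b D k = D k a"
    and "Gamma2 m a b D (m div 2 + k) = D k b"
proof -
  have "2 * (m div 2) - Suc k = m - Suc k" if "even m" using that by simp
  moreover have "Suc (2 * (m div 2)) = m" "m div 2 + k < m - Suc 0" if "odd m"
    using that assms by presburger+
  ultimately show "Gamma1 m a b D k = \<i> ^ m * ((-1) ^ Suc k * D (m - 1 - k) a)"
    "Gamma1 m a b D (m div 2 + k) = \<i> ^ m * ((-1) ^ k * D (m - 1 - k) b)"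
    "Gamma2 m a b D k = D k a" "Gamma2 m a b D (m div 2 + k) = D k b"
    using assms by (auto simp: Gamma1_def Gamma2_def Let_def)
qed

lemma Gamma_middle:
  assumes "odd m"
  shows "Gamma1 m a b D (2 * (m div 2)) = \<i> ^ m * (D (m div 2) b + D (m div 2) a)"
    and "Gamma2 m a b D (2 * (m div 2)) = ((-1) ^ (m div 2) / 2 + \<i>) * D (m div 2) b
      + ((-1) ^ (m div 2 + 1) / 2 + \<i>) * D (m div 2) a"
  using assms by (auto simp: Gamma1_def Gamma2_def Let_def)

lemma index_cases:
  assumes "j < m"
  obtains "j < m div 2" | k where "k < m div 2" "j = m div 2 + k" | "odd m" "j = 2 * (m div 2)"
proof -
  have "j = 2 * (m div 2) \<and> odd m" if "2 * (m div 2) \<le> j"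
    using that assms by presburger
  moreover have "j - m div 2 < m div 2 \<and> j = m div 2 + (j - m div 2)" if "m div 2 \<le> j" "j < 2 * (m div 2)"
    using that by simp
  ultimately show thesis using that by (metis not_le)
qed

theorem boundary_triplet_identity:
  "bform D E b - bform D E a = (\<Sum>j<m. Gamma1 m a b D j * cnj (Gamma2 m a b E j)
     - Gamma2 m a b D j * cnj (Gamma1 m a b E j))"
proof -
  define n where "n = m div 2"
  define s where "s = (-1::complex) ^ m"
  define F where "F x k = \<i> ^ m * ((-1) ^ k * D (m - 1 - k) x * cnj (E k x))" for x k
  define G where "G j = Gamma1 m a b D j * cnj (Gamma2 m a b E j)
     - Gamma2 m a b D j * cnj (Gamma1 m a b E j)" for j
  have bf: "bform D E x = (\<Sum>k<n. F x k + F x (m - 1 - k)) + (if odd m then F x n else 0)" for x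
    unfolding bform_def sum_distrib_left n_def F_def by (rule sum_fold_halves)
  have ci: "cnj (\<i> ^ m) = s * \<i> ^ m" unfolding s_def by (rule cnj_i_power)
  \<comment> \<open>In the second member of a couple the high order falls on \<open>E\<close>. The
    factor \<open>s * \<i> ^ m\<close> brought out here is the conjugate of \<open>\<i> ^ m\<close>,
    as it arises from \<open>Gamma1\<close> in the second slot.\<close>
  have F2: "F x (m - 1 - k) = - (s * \<i> ^ m * ((-1) ^ k * D k x * cnj (E (m - 1 - k) x)))" if "k < n" for x k
  proof -
    have k: "k < m" "m - 1 - (m - 1 - k) = k" using that by (auto simp: n_def)
    then have "(-1::complex) ^ (m - 1 - k) * ((-1) ^ Suc k * (-1) ^ Suc k) = s * (-1) ^ Suc k"
      by (simp only: s_def mult.assoc[symmetric] power_add[symmetric]) (simp add: mult.commute)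
    moreover have "(-1::complex) ^ Suc k * (-1) ^ Suc k = 1" by (simp flip: power_mult_distrib)
    ultimately have "(-1::complex) ^ (m - 1 - k) = - (s * (-1) ^ k)" by simp
    then show ?thesis unfolding F_def k(2) by simp
  qed
  have pt: "(F b k + F b (m - 1 - k)) - (F a k + F a (m - 1 - k)) = G k + G (n + k)" if "k < n" for k
  proof -
    have k: "k < m div 2" using that by (simp add: n_def)
    show ?thesis
      unfolding F2[OF that] unfolding G_def n_def Gamma_values[OF k] complex_cnj_mult ci F_def
      by (simp add: algebra_simps)
  qed
  \<comment> \<open>This is what the constants in the last entry of \<open>Gamma2\<close> are made
    for. Twice their real parts are \<open>(-1) ^ n\<close> at \<open>b\<close> and
    \<open>- (-1) ^ n\<close> at \<open>a\<close>, which gives the diagonal terms; one constant plus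
    the conjugate of the other is zero, which removes the mixed terms.\<close>
  have mid: "F b n - F a n = G (2 * n)" if "odd m"
  proof -
    have "s = -1" using that by (simp add: s_def)
    moreover have "m - 1 - n = n" using that by (auto simp: n_def elim!: oddE)
    ultimately show ?thesis
      unfolding G_def n_def[symmetric] Gamma_middle[OF that, folded n_def] complex_cnj_mult ci F_def
      by (simp add: algebra_simps)
  qed
  have "bform D E b - bform D E a = (\<Sum>k<n. (F b k + F b (m - 1 - k)) - (F a k + F a (m - 1 - k)))
      + (if odd m then F b n - F a n else 0)"
    unfolding bf by (simp add: sum_subtractf)
  also have "\<dots> = (\<Sum>k<n. G k + G (n + k)) + (if odd m then G (2 * n) else 0)"
    using pt mid by simp
  also have "\<dots> = (\<Sum>j<m. G j)" unfolding n_def by (rule sum_two_blocks[symmetric])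
  finally show ?thesis by (simp add: G_def)
qed

section \<open>The Cayley transform of the boundary maps\<close>

definition ubd :: "(nat \<Rightarrow> real \<Rightarrow> complex) \<Rightarrow> nat \<Rightarrow> complex" where
  "ubd D j = Gamma1 m a b D j + \<i> * Gamma2 m a b D j"

definition vbd :: "(nat \<Rightarrow> real \<Rightarrow> complex) \<Rightarrow> nat \<Rightarrow> complex" where
  "vbd D j = Gamma1 m a b D j - \<i> * Gamma2 m a b D j"

lemma Gamma_lincomb:
  "Gamma1 m a b (\<lambda>k x. D k x + c * E k x) j = Gamma1 m a b D j + c * Gamma1 m a b E j"
  "Gamma2 m a b (\<lambda>k x. D k x + c * E k x) j = Gamma2 m a b D j + c * Gamma2 m a b E j"
  by (auto simp: Gamma1_def Gamma2_def Let_def algebra_simps)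

lemma ubd_lincomb: "ubd (\<lambda>k x. D k x + c * E k x) = (\<lambda>j. ubd D j + c * ubd E j)"
  and vbd_lincomb: "vbd (\<lambda>k x. D k x + c * E k x) = (\<lambda>j. vbd D j + c * vbd E j)"
  by (auto simp: ubd_def vbd_def Gamma_lincomb algebra_simps)

lemma bd_minimal:
  assumes "minimal D" "j < m"
  shows "ubd D j = 0" "vbd D j = 0"
proof -
  have z: "D k a = 0" "D k b = 0" if "k < m" for k using assms(1) that by (auto simp: minimal_def)
  have "Gamma1 m a b D j = 0 \<and> Gamma2 m a b D j = 0"
    using \<open>j < m\<close>
  proof (cases rule: index_cases)
    case 1
    then have "j < m" by simp
    then show ?thesis using Gamma_values[OF 1, of D] z by simp
  next
    case (2 k)
    then have "k < m" by simp
    then show ?thesis using Gamma_values[OF 2(1), of D] z 2(2) by simp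
  next
    case 3
    then show ?thesis using Gamma_middle[OF 3(1), of D] z m by simp
  qed
  then show "ubd D j = 0" "vbd D j = 0" by (simp_all add: ubd_def vbd_def)
qed

lemma zero_minimal: "minimal (\<lambda>_ _. 0)"
  by (simp add: minimal_def)

text \<open>Apart from the middle order the equations decouple: \<open>Gamma2\<close> prescribes the
  orders below the middle and \<open>Gamma1\<close> those above it, separately at each
  endpoint.\<close>

lemma Gamma_surjective:
  obtains D where "qdom D" "\<And>j. j < m \<Longrightarrow> Gamma1 m a b D j = p j" "\<And>j. j < m \<Longrightarrow> Gamma2 m a b D j = q j"
proof -
  define n where "n = m div 2"
  define s where "s = (-1::complex) ^ n"
  have s: "s * s = 1" by (simp add: s_def flip: power_mult_distrib)
  \<comment> \<open>For odd \<open>m\<close> the two middle values solve a 2 by 2 system whose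
    determinant is \<open>s\<close> up to sign; since \<open>s * s = 1\<close>, Cramer's rule
    multiplies by \<open>s\<close> instead of dividing.\<close>
  define \<alpha> where "\<alpha> k = (if k < n then q k
      else if odd m \<and> k = n then s * ((s / 2 + \<i>) * (p (2 * n) / \<i> ^ m) - q (2 * n))
      else p (m - 1 - k) / (\<i> ^ m * (-1) ^ Suc (m - 1 - k)))" for k
  define \<beta> where "\<beta> k = (if k < n then q (n + k)
      else if odd m \<and> k = n then s * (q (2 * n) - (- s / 2 + \<i>) * (p (2 * n) / \<i> ^ m))
      else p (n + (m - 1 - k)) / (\<i> ^ m * (-1) ^ (m - 1 - k)))" for k
  obtain D where D: "qdom D" "\<And>k. k < m \<Longrightarrow> D k a = \<alpha> k" "\<And>k. k < m \<Longrightarrow> D k b = \<beta> k"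
    using boundary_data_surjective[of \<alpha> \<beta>] by blast
  have low: "Gamma1 m a b D k = p k \<and> Gamma1 m a b D (n + k) = p (n + k) \<and>
      Gamma2 m a b D k = q k \<and> Gamma2 m a b D (n + k) = q (n + k)" if k: "k < n" for k
  proof -
    have k': "k < m div 2" using k by (simp add: n_def)
    have i: "m - 1 - k < m" "\<not> m - 1 - k < n" "\<not> (odd m \<and> m - 1 - k = n)" "m - 1 - (m - 1 - k) = k" "k < m"
      using k by (auto simp: n_def elim!: oddE)
    have "D (m - 1 - k) a = p k / (\<i> ^ m * (-1) ^ Suc k)" "D (m - 1 - k) b = p (n + k) / (\<i> ^ m * (-1) ^ k)"
      using D(2,3)[OF i(1)] i by (simp_all only: \<alpha>_def \<beta>_def if_False)
    moreover have "D k a = q k" "D k b = q (n + k)"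
      using D(2,3)[OF i(5)] k by (simp_all add: \<alpha>_def \<beta>_def)
    ultimately show ?thesis
      unfolding n_def Gamma_values[OF k'] by simp
  qed
  have mid: "Gamma1 m a b D (2 * n) = p (2 * n) \<and> Gamma2 m a b D (2 * n) = q (2 * n)" if "odd m"
  proof -
    define P where "P = p (2 * n) / \<i> ^ m"
    have "n < m" using m by (simp add: n_def)
    then have Dn: "D n a = s * ((s / 2 + \<i>) * P - q (2 * n))" "D n b = s * (q (2 * n) - (- s / 2 + \<i>) * P)"
      using D(2,3)[of n] that by (simp_all add: \<alpha>_def \<beta>_def P_def)
    have "D n b + D n a = (s * s) * P"
      unfolding Dn by (simp add: field_simps)
    moreover have "(s / 2 + \<i>) * D n b + (- s / 2 + \<i>) * D n a = (s * s) * q (2 * n)"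
      unfolding Dn by (simp add: field_simps)
    ultimately have "D n b + D n a = P" "(s / 2 + \<i>) * D n b + (- s / 2 + \<i>) * D n a = q (2 * n)"
      by (simp_all add: s)
    then show ?thesis
      using Gamma_middle[OF that, of D, folded n_def] by (simp add: s_def[symmetric] P_def)
  qed
  have all: "Gamma1 m a b D j = p j \<and> Gamma2 m a b D j = q j" if "j < m" for j
    using that by (cases rule: index_cases) (use low mid in \<open>auto simp: n_def\<close>)
  show thesis using D(1) all by (intro that[of D]) auto
qed

lemma bd_surjective:
  obtains D where "qdom D" "\<And>j. j < m \<Longrightarrow> ubd D j = p j" "\<And>j. j < m \<Longrightarrow> vbd D j = q j"
proof -
  obtain D where D: "qdom D" "\<And>j. j < m \<Longrightarrow> Gamma1 m a b D j = (p j + q j) / 2"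
      "\<And>j. j < m \<Longrightarrow> Gamma2 m a b D j = (p j - q j) / (2 * \<i>)"
    using Gamma_surjective[of "\<lambda>j. (p j + q j) / 2" "\<lambda>j. (p j - q j) / (2 * \<i>)"] by blast
  show thesis
  proof
    show "ubd D j = p j" "vbd D j = q j" if "j < m" for j
      unfolding ubd_def vbd_def D(2,3)[OF that] by (simp_all add: field_simps)
  qed (rule D(1))
qed

lemma Im_qop:
  assumes "qdom D"
  shows "4 * Im (l2inner a b (qop D) (D 0)) = (\<Sum>j<m. (cmod (ubd D j))\<^sup>2) - (\<Sum>j<m. (cmod (vbd D j))\<^sup>2)"
proof -
  define X where "X j = Gamma1 m a b D j * cnj (Gamma2 m a b D j)" for j
  have "l2inner a b (qop D) (D 0) - cnj (l2inner a b (qop D) (D 0)) = (\<Sum>j<m. X j - cnj (X j))"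
    using Green'[OF assms assms] l2.ip_cnj[of "qop D" a b "D 0"] l2_0[OF assms] l2_qop[OF assms]
    by (simp add: boundary_triplet_identity X_def mult.commute)
  from arg_cong[OF this, of Im]
  have "Im (l2inner a b (qop D) (D 0)) = (\<Sum>j<m. Im (X j))"
    by (simp add: sum_distrib_left[symmetric])
  \<comment> \<open>Polarization: \<open>|x + \<i> y|^2 - |x - \<i> y|^2\<close> is four times the
    imaginary part of \<open>x * cnj y\<close>.\<close>
  moreover have "4 * Im (X j) = (cmod (ubd D j))\<^sup>2 - (cmod (vbd D j))\<^sup>2" for j
    unfolding ubd_def vbd_def cmod_power2 X_def by (simp add: power2_eq_square algebra_simps)
  ultimately show ?thesis by (simp add: sum_distrib_left sum_subtractf[symmetric])
qed

section \<open>Contractions and maximal dissipative extensions\<close>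

definition bcond :: "(nat \<Rightarrow> nat \<Rightarrow> complex) \<Rightarrow> (nat \<Rightarrow> real \<Rightarrow> complex) \<Rightarrow> bool" where
  "bcond K D \<longleftrightarrow> (\<forall>i<m. mat_app m K (ubd D) i = vbd D i)"

lemma L_K_eq: "L_K m Q a b K = opgraph (bcond K)"
proof -
  have "(mat_app m K (Gamma1 m a b D) i - Gamma1 m a b D i)
      + \<i> * (mat_app m K (Gamma2 m a b D) i + Gamma2 m a b D i) = mat_app m K (ubd D) i - vbd D i" for D i
    by (simp add: mat_app_def ubd_def vbd_def sum.distrib sum_distrib_left algebra_simps)
  then show ?thesis
    unfolding L_K_def sat_quasi_derivs[symmetric] bcond_def by simp
qed

lemma L_min_eq: "L_min m Q a b = opgraph minimal"
  unfolding L_min_def sat_quasi_derivs[symmetric] minimal_def ..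

lemma opgraph_mono: "(\<And>D. P D \<Longrightarrow> P' D) \<Longrightarrow> opgraph P \<subseteq> opgraph P'"
  by (auto simp: opgraph_def)

lemma mat_app_cong: "(\<And>j. j < m \<Longrightarrow> v j = w j) \<Longrightarrow> mat_app m K v i = mat_app m K w i"
  by (simp add: mat_app_def)

lemma minimal_bcond: "minimal D \<Longrightarrow> bcond K D"
  by (auto simp: bcond_def bd_minimal mat_app_def)

lemma L_min_le: "L_min m Q a b \<subseteq> L_K m Q a b K"
  unfolding L_min_eq L_K_eq by (intro opgraph_mono minimal_bcond)

lemma mat_app_lincomb: "mat_app m K (\<lambda>j. v j + c * w j) i = mat_app m K v i + c * mat_app m K w i"
  by (simp add: mat_app_def sum.distrib sum_distrib_left algebra_simps)

lemma bcond_lincomb: "bcond K D \<Longrightarrow> bcond K E \<Longrightarrow> bcond K (\<lambda>k x. D k x + c * E k x)"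
  by (simp add: bcond_def ubd_lincomb vbd_lincomb mat_app_lincomb)

lemma dissipative_L_K:
  assumes K: "contraction m K"
  shows "dissipative a b (L_K m Q a b K)"
  unfolding dissipative_def L_K_eq
proof (intro conjI)
  show "is_operator a b (opgraph (bcond K))"
    by (rule opgraph_is_operator[OF minimal_bcond[OF zero_minimal] bcond_lincomb])
  show "densely_defined a b (opgraph (bcond K))"
    by (intro opgraph_densely_defined minimal_bcond)
  show "\<forall>(f,g)\<in>opgraph (bcond K). 0 \<le> Im (l2inner a b g f)"
  proof (clarify)
    fix f g assume "(f,g) \<in> opgraph (bcond K)"
    then obtain D where D: "l2fun a b f" "l2fun a b g" "qdom D" "bcond K D" "aeq a b f (D 0)" "aeq a b g (qop D)"
      by (auto simp: opgraph_def)
    have "l2inner a b g f = l2inner a b (qop D) (D 0)"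
      using D l2_0 l2_qop by (intro l2inner_cong_AE) auto
    moreover have "(\<Sum>j<m. (cmod (vbd D j))\<^sup>2) = (\<Sum>j<m. (cmod (mat_app m K (ubd D) j))\<^sup>2)"
      using D(4) by (simp add: bcond_def)
    moreover have "\<dots> \<le> (\<Sum>j<m. (cmod (ubd D j))\<^sup>2)"
      using K by (simp add: contraction_def)
    ultimately show "0 \<le> Im (l2inner a b g f)" using Im_qop[OF D(3)] by simp
  qed
qed

lemma dissipative_bound:
  assumes "dissipative a b G" "(D 0, qop D) \<in> G" "qdom D"
  shows "(\<Sum>j<m. (cmod (vbd D j))\<^sup>2) \<le> (\<Sum>j<m. (cmod (ubd D j))\<^sup>2)"
  using assms Im_qop[OF assms(3)] by (fastforce simp: dissipative_def)

text \<open>Any \<open>D\<close> in a dissipative extension is compared with some \<open>E\<close>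
  in \<open>L_K\<close> having the same \<open>ubd\<close>. Their difference stays in the extension
  and has \<open>ubd\<close> zero, so dissipativity forces its \<open>vbd\<close> to vanish, and
  \<open>D\<close> satisfies the boundary condition.\<close>

lemma max_dissipative_L_K:
  assumes K: "contraction m K"
  shows "max_dissipative a b (L_K m Q a b K)"
  unfolding max_dissipative_def
proof (intro conjI allI impI dissipative_L_K K, elim conjE)
  fix G assume G: "dissipative a b G" and le: "L_K m Q a b K \<subseteq> G"
  have op: "is_operator a b G" using G by (simp add: dissipative_def)
  have minG: "opgraph minimal \<subseteq> G" using L_min_le le by (auto simp: L_min_eq)
  show "G = L_K m Q a b K"
  proof (rule antisym[OF _ le], rule subrelI)
    fix f g assume fg: "(f,g) \<in> G"
    obtain D where D: "qdom D" "aeq a b f (D 0)" "aeq a b g (qop D)"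
      using dissipative_extension_le_max[OF G minG fg] .
    obtain E where E: "qdom E" "\<And>j. j < m \<Longrightarrow> ubd E j = ubd D j"
        "\<And>j. j < m \<Longrightarrow> vbd E j = mat_app m K (ubd D) j"
      using bd_surjective[of "ubd D" "mat_app m K (ubd D)"] by blast
    have "bcond K E" using E mat_app_cong[of "ubd E" "ubd D"] by (simp add: bcond_def)
    then have EG: "(E 0, qop E) \<in> G" using mem_opgraph[of E "bcond K"] E(1) le by (auto simp: L_K_eq)
    have DG: "(D 0, qop D) \<in> G"
      using is_operatorD(3)[OF op fg] l2_0[OF D(1)] l2_qop[OF D(1)] D aeq_sym by blast
    define F where "F k x = D k x + (-1) * E k x" for k x
    have F: "qdom F" unfolding F_def[abs_def] by (rule qdom_lincomb[OF D(1) E(1)])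
    have FG: "(F 0, qop F) \<in> G"
      unfolding F_def[abs_def] qop_lincomb using is_operatorD(2)[OF op DG EG] .
    have "ubd F j = 0" "vbd F j = vbd D j - mat_app m K (ubd D) j" if "j < m" for j
      using E(2,3)[OF that] by (simp_all add: F_def[abs_def] ubd_lincomb[where c = "-1", simplified]
          vbd_lincomb[where c = "-1", simplified])
    then have "(\<Sum>j<m. (cmod (vbd D j - mat_app m K (ubd D) j))\<^sup>2) \<le> 0"
      using dissipative_bound[OF G FG F] by simp
    then have "(\<Sum>j<m. (cmod (vbd D j - mat_app m K (ubd D) j))\<^sup>2) = 0"
      by (intro antisym sum_nonneg) auto
    then have "bcond K D" by (simp add: sum_nonneg_eq_0_iff bcond_def)
    then show "(f,g) \<in> L_K m Q a b K"
      using D is_operatorD(1)[OF op fg] by (auto simp: L_K_eq opgraph_def)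
  qed
qed

text \<open>The boundary values (u, v) of G form the graph of a contraction from the subspace of all
  occurring u; K is that contraction composed with the orthogonal projection onto this subspace.\<close>
lemma max_dissipative_imp_L_K:
  assumes G: "max_dissipative a b G" and min: "L_min m Q a b \<subseteq> G"
  obtains K where "contraction m K" "G = L_K m Q a b K"
proof -
  have diss: "dissipative a b G" and maximal: "\<And>G'. dissipative a b G' \<Longrightarrow> G \<subseteq> G' \<Longrightarrow> G' = G"
    using G by (auto simp: max_dissipative_def)
  have op: "is_operator a b G" using diss by (simp add: dissipative_def)
  have minG: "opgraph minimal \<subseteq> G" using min by (simp add: L_min_eq)
  define DG where "DG = {D. qdom D \<and> (D 0, qop D) \<in> G}"
  have DGq: "qdom D" if "D \<in> DG" for D using that by (simp add: DG_def)
  have zero: "(\<lambda>_ _. 0) \<in> DG"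
    using qdom_zero is_operatorD(4)[OF op] by (simp add: DG_def qop_def[abs_def])
  have lin: "(\<lambda>k x. D k x + c * E k x) \<in> DG" if "D \<in> DG" "E \<in> DG" for D E c
    using that qdom_lincomb[of D E c] is_operatorD(2)[OF op, of "D 0" "qop D" "E 0" "qop E" c]
    by (simp add: DG_def qop_lincomb)
  have sum: "(\<lambda>k x. \<Sum>i\<in>I. c i * Z i k x) \<in> DG \<and>
      ubd (\<lambda>k x. \<Sum>i\<in>I. c i * Z i k x) = (\<lambda>j. \<Sum>i\<in>I. c i * ubd (Z i) j) \<and>
      vbd (\<lambda>k x. \<Sum>i\<in>I. c i * Z i k x) = (\<lambda>j. \<Sum>i\<in>I. c i * vbd (Z i) j)"
    if "finite I" "\<And>i. i \<in> I \<Longrightarrow> Z i \<in> DG" for I :: "nat set" and c Z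
    using that
  proof (induction I rule: finite_induct)
    case empty
    have "ubd (\<lambda>_ _. 0) = (\<lambda>_. 0)" "vbd (\<lambda>_ _. 0) = (\<lambda>_. 0)"
      by (auto simp: ubd_def vbd_def Gamma1_def Gamma2_def Let_def)
    then show ?case using zero by simp
  next
    case (insert i I)
    let ?S = "\<lambda>k x. \<Sum>i\<in>I. c i * Z i k x"
    have eq: "(\<lambda>k x. \<Sum>i\<in>insert i I. c i * Z i k x) = (\<lambda>k x. ?S k x + c i * Z i k x)"
      using insert.hyps by (simp add: add.commute)
    show ?case
      unfolding eq ubd_lincomb vbd_lincomb
      using insert lin[of ?S "Z i" "c i"] by (simp add: add.commute)
  qed
  define U where "U = ubd ` DG"
  have "(\<lambda>_. 0) \<in> U"
    using sum[of "{}" "\<lambda>_ _ _. 0" "\<lambda>_. 0"] by (auto simp: U_def image_iff intro!: bexI[of _ "\<lambda>_ _. 0"])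
  moreover have "(\<lambda>i. u i + c * v i) \<in> U" if "u \<in> U" "v \<in> U" for u v c
    using that lin unfolding U_def by (auto simp flip: ubd_lincomb)
  ultimately obtain r z where z: "\<And>j. j < r \<Longrightarrow> z j \<in> U"
    and span: "\<And>u. u \<in> U \<Longrightarrow> \<exists>c. \<forall>i<m. u i = (\<Sum>j<r::nat. c j * z j i)"
    using finitely_generated_subspace[of U m] by blast
  have vip_cong: "vip m v w = vip m v w'" if "\<forall>i<m. w i = w' i" for v w w'
    using that by (simp add: vip_def)
  \<comment> \<open>The tower \<open>P\<close> is chosen such that \<open>ubd P\<close> is the
    orthogonal projection of the \<open>k\<close>-th unit vector onto \<open>U\<close>.\<close>
  have "\<exists>P. P \<in> DG \<and> (\<forall>u\<in>U. vip m (\<lambda>j. (if j = k then 1 else 0) - ubd P j) u = 0)" for k :: nat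
  proof -
    obtain Z where Z: "\<And>j. j < r \<Longrightarrow> Z j \<in> DG" "\<And>j. j < r \<Longrightarrow> z j = ubd (Z j)"
      using z unfolding U_def image_iff by metis
    obtain c where c: "\<forall>i\<in>{..<r}. vip m (\<lambda>x. (if x = k then 1 else 0) - (\<Sum>j<r. c j * z j x)) (z i) = 0"
      using vec.ex_orthogonal_residual[of "{..<r}" z "\<lambda>x. if x = k then 1 else 0" m] by auto
    define P where "P = (\<lambda>l x. \<Sum>j<r. c j * Z j l x)"
    have P: "P \<in> DG" "ubd P = (\<lambda>j. \<Sum>i<r. c i * z i j)"
      using sum[of "{..<r}" Z c] Z by (auto simp: P_def)
    have "vip m (\<lambda>j. (if j = k then 1 else 0) - ubd P j) u = 0" if "u \<in> U" for u
    proof -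
      obtain d where "\<forall>i<m. u i = (\<Sum>j<r. d j * z j i)" using span[OF \<open>u \<in> U\<close>] by blast
      then have "vip m (\<lambda>j. (if j = k then 1 else 0) - ubd P j) u
          = vip m (\<lambda>j. (if j = k then 1 else 0) - ubd P j) (\<lambda>i. \<Sum>j<r. d j * z j i)"
        by (rule vip_cong)
      also have "\<dots> = 0" using c by (subst vec.ip_sum_right) (auto simp: P(2))
      finally show ?thesis .
    qed
    then show ?thesis using P(1) by blast
  qed
  then obtain P where P: "\<And>k. P k \<in> DG"
    and orth: "\<And>k u. u \<in> U \<Longrightarrow> vip m (\<lambda>j. (if j = k then 1 else 0) - ubd (P k) j) u = 0"
    by metis
  \<comment> \<open>Column \<open>j\<close> is the \<open>vbd\<close> partner of the projected unit
    vector. By linearity \<open>X w\<close> is a tower of \<open>G\<close> whose \<open>ubd\<close>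
    is the projection of \<open>w\<close> and whose \<open>vbd\<close> is \<open>K\<close> applied
    to \<open>w\<close>.\<close>
  define K where "K i j = vbd (P j) i" for i j
  define X where "X w = (\<lambda>k x. \<Sum>j<m. w j * P j k x)" for w
  have X: "X w \<in> DG" "ubd (X w) = (\<lambda>i. \<Sum>j<m. w j * ubd (P j) i)" "vbd (X w) = mat_app m K w" for w
    using sum[of "{..<m}" P w] P by (auto simp: X_def mat_app_def K_def mult.commute)
  have resid: "vip m (\<lambda>i. w i - ubd (X w) i) u = 0" if "u \<in> U" for w u
  proof -
    have "w i - ubd (X w) i = (\<Sum>j<m. w j * ((if i = j then 1 else 0) - ubd (P j) i))" if "i < m" for i
      using that by (simp add: X(2) right_diff_distrib sum_subtractf if_distrib[of "(*) _"] cong: if_cong)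
    then have "vip m (\<lambda>i. w i - ubd (X w) i) u
        = vip m (\<lambda>i. \<Sum>j<m. w j * ((if i = j then 1 else 0) - ubd (P j) i)) u"
      by (simp add: vip_def)
    also have "\<dots> = 0" using orth[OF that] by (subst vec.ip_sum) auto
    finally show ?thesis .
  qed
  have bound: "(\<Sum>j<m. (cmod (vbd D j))\<^sup>2) \<le> (\<Sum>j<m. (cmod (ubd D j))\<^sup>2)" if "D \<in> DG" for D
    using that dissipative_bound[OF diss] by (simp add: DG_def)
  have normsq: "Re (vip m w w) = (\<Sum>i<m. (cmod (w i))\<^sup>2)" for w by (simp add: vip_self)
  have K: "contraction m K"
    unfolding contraction_def
  proof
    fix w
    let ?u = "ubd (X w)"
    have uU: "?u \<in> U" using X(1) by (simp add: U_def)
    have "(\<Sum>i<m. (cmod (mat_app m K w i))\<^sup>2) \<le> Re (vip m ?u ?u)"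
      using bound[OF X(1)] unfolding X(3) normsq .
    also have "\<dots> \<le> Re (vip m w w)"
    proof -
      let ?d = "\<lambda>i. w i - ?u i"
      have "vip m w ?u = vip m ?u ?u" using resid[OF uU, of w] by (simp add: vec.ip_diff)
      then have "vip m ?d ?d = vip m w w - vip m ?u ?u"
        using resid[OF uU, of w] vec.ip_cnj[of w ?u m] vec.ip_cnj[of ?u ?u m]
        by (simp add: vec.ip_diff vec.ip_diff_right)
      then show ?thesis using vec.ip_nonneg[of ?d m] by simp
    qed
    finally show "(\<Sum>i<m. (cmod (mat_app m K w i))\<^sup>2) \<le> (\<Sum>i<m. (cmod (w i))\<^sup>2)" by (simp add: normsq)
  qed
  have cond: "bcond K D" if D: "D \<in> DG" for D
  proof -
    \<comment> \<open>The \<open>ubd\<close> of this difference belongs to \<open>U\<close> and is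
      orthogonal to \<open>U\<close>, so it has length zero; the dissipativity bound then
      annihilates its \<open>vbd\<close>.\<close>
    let ?E = "\<lambda>k x. D k x + (-1) * X (ubd D) k x"
    have E: "?E \<in> DG" using D X(1) by (rule lin)
    have uE: "ubd ?E = (\<lambda>i. ubd D i - ubd (X (ubd D)) i)" unfolding ubd_lincomb by simp
    have "ubd ?E \<in> U" using E by (simp add: U_def)
    then have "vip m (ubd ?E) (ubd ?E) = 0" using resid[of "ubd ?E" "ubd D"] by (simp only: uE)
    then have "(\<Sum>j<m. (cmod (vbd ?E j))\<^sup>2) \<le> 0" using bound[OF E] normsq[of "ubd ?E"] by simp
    then have "(\<Sum>j<m. (cmod (vbd ?E j))\<^sup>2) = 0" by (intro antisym sum_nonneg) auto
    then have "\<forall>j<m. vbd ?E j = 0" by (simp add: sum_nonneg_eq_0_iff)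
    then show ?thesis unfolding vbd_lincomb X(3) by (simp add: bcond_def)
  qed
  have "G \<subseteq> L_K m Q a b K"
  proof (rule subrelI)
    fix f g assume fg: "(f,g) \<in> G"
    obtain D where D: "qdom D" "aeq a b f (D 0)" "aeq a b g (qop D)"
      using dissipative_extension_le_max[OF diss minG fg] .
    have "(D 0, qop D) \<in> G"
      using is_operatorD(3)[OF op fg] l2_0[OF D(1)] l2_qop[OF D(1)] D aeq_sym by blast
    then have "bcond K D" using D(1) by (intro cond) (simp add: DG_def)
    then show "(f,g) \<in> L_K m Q a b K"
      using D is_operatorD(1)[OF op fg] by (auto simp: L_K_eq opgraph_def)
  qed
  then have "L_K m Q a b K = G" by (intro maximal dissipative_L_K K)
  then show thesis using K that by blast
qed

text \<open>Column \<open>j\<close> is recovered by a tower whose \<open>ubd\<close> is the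
  \<open>j\<close>-th unit vector and whose \<open>vbd\<close> is the column. It satisfies the
  condition for \<open>K\<close>, hence its graph element lies in the operator of \<open>K'\<close>
  too.\<close>

lemma L_K_inj:
  assumes eq: "L_K m Q a b K = L_K m Q a b K'" and "i < m" "j < m"
  shows "K i j = K' i j"
proof -
  define e where "e k = (if k = j then 1 else 0 :: complex)" for k
  have col: "mat_app m M e l = M l j" for M l
    using \<open>j < m\<close> by (simp add: mat_app_def e_def if_distrib[of "(*) _"] cong: if_cong)
  obtain D where D: "qdom D" "\<And>k. k < m \<Longrightarrow> ubd D k = e k" "\<And>k. k < m \<Longrightarrow> vbd D k = K k j"
    using bd_surjective[of e "\<lambda>k. K k j"] by blast
  have app: "mat_app m M (ubd D) l = M l j" for M l
    using mat_app_cong[of "ubd D" e M l] D(2) col by simp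
  have "bcond K D" using D(3) app by (simp add: bcond_def)
  then have "(D 0, qop D) \<in> opgraph (bcond K')"
    using mem_opgraph[of D "bcond K"] D(1) eq by (simp add: L_K_eq)
  then obtain E where E: "qdom E" "bcond K' E" "aeq a b (D 0) (E 0)" by (auto simp: opgraph_def)
  have same: "D k a = E k a" "D k b = E k b" if "k < m" for k
    using qdom_unique(1)[OF D(1) E(1,3) that] ab by simp_all
  \<comment> \<open>The tower \<open>E\<close> supplied by the second graph may differ from
    \<open>D\<close>, but both have the same endpoint values of order below \<open>m\<close>, so the
    difference has zero \<open>ubd\<close> and \<open>vbd\<close>.\<close>
  have "minimal (\<lambda>k x. D k x + (-1) * E k x)"
    using same by (simp add: minimal_def)
  then have "ubd D k = ubd E k \<and> vbd D k = vbd E k" if "k < m" for k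
    using bd_minimal[of "\<lambda>k x. D k x + (-1) * E k x" k] that unfolding ubd_lincomb vbd_lincomb by simp
  then have "vbd D i = mat_app m K' (ubd D) i"
    using E(2) \<open>i < m\<close> mat_app_cong[of "ubd D" "ubd E" K' i] by (simp add: bcond_def)
  then show ?thesis using D(3)[OF \<open>i < m\<close>] app by simp
qed

end

theorem theorem5:
  fixes a b :: real and m :: nat and Q :: "real \<Rightarrow> real"
  assumes "a < b" and "m \<ge> 3"
    and "integrable (lebesgue_on {a..b}) Q"
  shows "(\<forall>K. contraction m K \<longrightarrow>
            max_dissipative a b (L_K m Q a b K) \<and> L_min m Q a b \<subseteq> L_K m Q a b K)
    \<and> (\<forall>G. max_dissipative a b G \<and> L_min m Q a b \<subseteq> G \<longrightarrow>
            (\<exists>K. contraction m K \<and> G = L_K m Q a b K))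
    \<and> (\<forall>K K'. contraction m K \<and> contraction m K' \<and> L_K m Q a b K = L_K m Q a b K' \<longrightarrow>
            (\<forall>i<m. \<forall>j<m. K i j = K' i j))"
proof -
  interpret quasi_differential m Q a b
    using assms by unfold_locales
  show ?thesis
    using max_dissipative_L_K L_min_le L_K_inj max_dissipative_imp_L_K by metis
qed

end
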